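(* Let $M$ be a 2-dimensional complex manifold, and let $F_\epsilon$ be a family of automorphisms of $M$ depending holomorphically on $\epsilon$ near $0\in\mathbf C$, normalized near the fixed point $O$ of $F_0$ as $$F_\epsilon(x,y)=\left(x+(x^2+\epsilon^2)\alpha_\epsilon(x,y),\ b_\epsilon(x)y+(x^2+\epsilon^2)\beta_\epsilon(x,y)\right),$$ with $\alpha_\epsilon=1+(q+1)x+ry+O(|x|^2+|y|^2+|\epsilon|^2)$ and $b_0(0)=b$, $0<|b|<1$. Let $\alpha\in\mathbf C$, and let $\epsilon_j\to0$ and positive integers $n_j\to\infty$ be sequences such that $n_j-\pi/\epsilon_j\to\alpha$. Then $F_{\epsilon_j}^{n_j}$ converges to $T_\alpha$ uniformly on compact subsets of $\mathcal B$ as $j\to\infty$.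
   Context: The displayed form of $F_\epsilon$ holds in local holomorphic coordinates at $O=(0,0)$; $\alpha_\epsilon(x,y)$, $\beta_\epsilon(x,y)$, $b_\epsilon(x)$ are holomorphic in all variables including $\epsilon$, and $q,r\in\mathbf C$ are constants. $\mathcal B$ is the set of points of $M$ having a neighborhood on which the forward iterates $F_0^n$ converge uniformly to $O$ (the semi-parabolic basin). $\Sigma=\{p\in M\setminus\{O\}: F_0^{-n}(p)\to O \text{ as } n\to\infty\}$; it is a Riemann surface equivalent to $\mathbf C$. With principal logarithms put $w^\iota(x,y)=-\frac1x-q\log(-x)$ and $w^o(x,y)=-\frac1x-q\log(x)$. The Fatou coordinates are $$\varphi^\iota:\mathcal B\to\mathbf C,\ \ \varphi^\iota(p)=\lim_{n\to\infty}\left(w^\iota(F_0^n(p))-n\right),\qquad \varphi^o:\Sigma\to\mathbf C,\ \ \varphi^o(p)=\lim_{n\to\infty}\left(w^o(F_0^{-n}(p))+n\right).$$ These limits exist, $\varphi^\iota$ and $\varphi^o$ are holomorphic, $\varphi^{\iota}\circ F_0=\varphi^{\iota}+1$, $\varphi^{o}\circ F_0=\varphi^{o}+1$, and $\varphi^o$ is a bijection of $\Sigma$ onto $\mathbf C$. With $\tau_\alpha(\zeta)=\zeta+\alpha$, define $$T_\alpha=(\varphi^o)^{-1}\circ\tau_\alpha\circ\varphi^\iota:\mathcal B\to\Sigma\subset M.$$ *)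

theory Defs
  imports "HOL-Analysis.Analysis" "HOL-Library.Landau_Symbols"
begin

section \<open>Holomorphic maps of several complex variables\<close>

text \<open>
  The library has no class of complex normed spaces; the class below supplies it, so that
  the spaces \<open>complex \<times> complex\<close> and \<open>complex \<times> complex \<times> complex\<close> carry their coordinatewise
  complex scalar multiplication.
\<close>

class complex_normed_vector = real_normed_vector +
  fixes scaleC :: "complex \<Rightarrow> 'a \<Rightarrow> 'a"  (infixr "*\<^sub>C" 75)
  assumes scaleC_add_right: "c *\<^sub>C (u + v) = c *\<^sub>C u + c *\<^sub>C v"
    and scaleC_add_left: "(c + d) *\<^sub>C v = c *\<^sub>C v + d *\<^sub>C v"
    and scaleC_scaleC: "c *\<^sub>C (d *\<^sub>C v) = (c * d) *\<^sub>C v"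
    and scaleC_of_real: "complex_of_real t *\<^sub>C v = t *\<^sub>R v"
    and norm_scaleC: "norm (c *\<^sub>C v) = cmod c * norm v"

instantiation complex :: complex_normed_vector
begin

definition scaleC_complex_def: "c *\<^sub>C (z::complex) = c * z"

instance
  by standard (auto simp: scaleC_complex_def algebra_simps norm_mult scaleR_conv_of_real)

end

instantiation prod :: (complex_normed_vector, complex_normed_vector) complex_normed_vector
begin

definition scaleC_prod_def: "c *\<^sub>C v = (c *\<^sub>C fst v, c *\<^sub>C snd v)"

instance
proof
  fix c d :: complex and t :: real and u v :: "'a \<times> 'b"
  show "c *\<^sub>C (u + v) = c *\<^sub>C u + c *\<^sub>C v"
    by (simp add: scaleC_prod_def scaleC_add_right)
  show "(c + d) *\<^sub>C v = c *\<^sub>C v + d *\<^sub>C v"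
    by (simp add: scaleC_prod_def scaleC_add_left)
  show "c *\<^sub>C (d *\<^sub>C v) = (c * d) *\<^sub>C v"
    by (simp add: scaleC_prod_def scaleC_scaleC)
  show "complex_of_real t *\<^sub>C v = t *\<^sub>R v"
    by (simp add: scaleC_prod_def scaleC_of_real scaleR_prod_def)
  have "(cmod c * norm (fst v))\<^sup>2 + (cmod c * norm (snd v))\<^sup>2
      = (cmod c)\<^sup>2 * ((norm (fst v))\<^sup>2 + (norm (snd v))\<^sup>2)"
    by (simp add: algebra_simps power_mult_distrib)
  then show "norm (c *\<^sub>C v) = cmod c * norm v"
    by (simp add: scaleC_prod_def norm_prod_def norm_scaleC real_sqrt_mult)
qed

end

text \<open>
  Meant for open \<open>S\<close>: the derivative is taken in a full neighbourhood of each point of \<open>S\<close>.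
\<close>

definition cholomorphic_on ::
    "('a::complex_normed_vector \<Rightarrow> 'b::complex_normed_vector) \<Rightarrow> 'a set \<Rightarrow> bool"
    (infixl "cholomorphic'_on" 50) where
  "f cholomorphic_on S \<longleftrightarrow>
     (\<forall>z\<in>S. \<exists>D. (f has_derivative D) (at z) \<and> (\<forall>c v. D (c *\<^sub>C v) = c *\<^sub>C D v))"


section \<open>Complex manifolds\<close>

text \<open>
  A chart is a pair of a domain and a coordinate map, the latter being a total function of
  which only the values on the domain matter.  The manifold is the whole type \<open>'m\<close>, and its
  dimension is that of the model space \<open>'e\<close>.
\<close>

type_synonym ('m, 'e) chart = "'m set \<times> ('m \<Rightarrow> 'e)"

definition is_chart :: "('m::topological_space, 'e::topological_space) chart \<Rightarrow> bool" where
  "is_chart = (\<lambda>(U, \<psi>). open U \<and> open (\<psi> ` U) \<and> homeomorphism U (\<psi> ` U) \<psi> (inv_into U \<psi>))"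

definition compatible ::
    "('m, 'e::complex_normed_vector) chart \<Rightarrow> ('m, 'e) chart \<Rightarrow> bool" where
  "compatible = (\<lambda>(U, \<psi>) (V, \<phi>).
     (\<phi> \<circ> inv_into U \<psi>) cholomorphic_on (\<psi> ` (U \<inter> V)) \<and>
     (\<psi> \<circ> inv_into V \<phi>) cholomorphic_on (\<phi> ` (U \<inter> V)))"

definition complex_atlas ::
    "('m::topological_space, 'e::complex_normed_vector) chart set \<Rightarrow> bool" where
  "complex_atlas \<A> \<longleftrightarrow>
     (\<forall>c\<in>\<A>. is_chart c) \<and> \<Union>(fst ` \<A>) = UNIV \<and> (\<forall>c\<in>\<A>. \<forall>d\<in>\<A>. compatible c d)"

text \<open>Local holomorphic coordinates, i.e. the charts of the maximal atlas generated by \<open>\<A>\<close>.\<close>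

definition holomorphic_chart ::
    "('m::topological_space, 'e::complex_normed_vector) chart set \<Rightarrow> ('m, 'e) chart \<Rightarrow> bool" where
  "holomorphic_chart \<A> c \<longleftrightarrow> is_chart c \<and> (\<forall>d\<in>\<A>. compatible c d)"

definition holomorphic_map_on ::
    "('m::topological_space, 'e::complex_normed_vector) chart set \<Rightarrow>
     ('n::topological_space, 'f::complex_normed_vector) chart set \<Rightarrow>
     'm set \<Rightarrow> ('m \<Rightarrow> 'n) \<Rightarrow> bool" where
  "holomorphic_map_on \<A> \<B> S f \<longleftrightarrow>
     open S \<and> continuous_on S f \<and>
     (\<forall>(U, \<psi>)\<in>\<A>. \<forall>(V, \<phi>)\<in>\<B>.
        (\<phi> \<circ> f \<circ> inv_into U \<psi>) cholomorphic_on (\<psi> ` {p \<in> U \<inter> S. f p \<in> V}))"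

definition automorphism ::
    "('m::topological_space, 'e::complex_normed_vector) chart set \<Rightarrow> ('m \<Rightarrow> 'm) \<Rightarrow> bool" where
  "automorphism \<A> f \<longleftrightarrow>
     bij f \<and> holomorphic_map_on \<A> \<A> UNIV f \<and> holomorphic_map_on \<A> \<A> UNIV (inv f)"

text \<open>
  A family depends holomorphically on its parameter when \<open>(\<epsilon>, p) \<mapsto> F \<epsilon> p\<close> is holomorphic
  on an open subset of the product manifold \<open>\<complex> \<times> M\<close>.
\<close>

definition product_with_C ::
    "('m, 'e) chart set \<Rightarrow> (complex \<times> 'm, complex \<times> 'e) chart set" where
  "product_with_C \<A> = (\<lambda>(U, \<psi>). (UNIV \<times> U, map_prod id \<psi>)) ` \<A>"

definition holomorphic_family_of_automorphisms ::
    "('m::topological_space, 'e::complex_normed_vector) chart set \<Rightarrow>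
     complex set \<Rightarrow> (complex \<Rightarrow> 'm \<Rightarrow> 'm) \<Rightarrow> bool" where
  "holomorphic_family_of_automorphisms \<A> E F \<longleftrightarrow>
     (\<forall>\<epsilon>\<in>E. automorphism \<A> (F \<epsilon>)) \<and>
     holomorphic_map_on (product_with_C \<A>) \<A> (E \<times> UNIV) (\<lambda>(\<epsilon>, p). F \<epsilon> p)"


section \<open>Semi-parabolic basin, Fatou coordinates and the map \<open>T\<^sub>\<alpha>\<close>\<close>

text \<open>
  Here \<open>f\<close> stands for \<open>F\<^sub>0\<close>, \<open>pt\<close> for the fixed point \<open>O\<close>, and \<open>\<psi>\<close> for the coordinates
  \<open>(x, y)\<close>.  The functions \<open>\<psi>\<close>, \<open>fatou_in\<close>, \<open>fatou_out\<close> are total; \<open>fatou_in\<close> and the map \<open>T\<close>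
  are meaningful on the basin, and \<open>fatou_out\<close> on \<open>\<Sigma>\<close>.  In the limits defining the Fatou
  coordinates, \<open>\<psi>\<close> is eventually evaluated in its domain, since the orbits converge to \<open>O\<close>.
\<close>

definition basin :: "('m::metric_space \<Rightarrow> 'm) \<Rightarrow> 'm \<Rightarrow> 'm set" where
  "basin f pt =
     {p. \<exists>N. open N \<and> p \<in> N \<and> uniform_limit N (\<lambda>n. f ^^ n) (\<lambda>_. pt) sequentially}"

definition unstable_curve :: "('m::topological_space \<Rightarrow> 'm) \<Rightarrow> 'm \<Rightarrow> 'm set" where
  "unstable_curve f pt = {p. p \<noteq> pt \<and> (\<lambda>n. (inv f ^^ n) p) \<longlonglongrightarrow> pt}"

definition w_in :: "complex \<Rightarrow> complex \<times> complex \<Rightarrow> complex" where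
  "w_in q = (\<lambda>(x, y). - 1 / x - q * Ln (- x))"

definition w_out :: "complex \<Rightarrow> complex \<times> complex \<Rightarrow> complex" where
  "w_out q = (\<lambda>(x, y). - 1 / x - q * Ln x)"

definition fatou_in ::
    "complex \<Rightarrow> ('m \<Rightarrow> complex \<times> complex) \<Rightarrow> ('m \<Rightarrow> 'm) \<Rightarrow> 'm \<Rightarrow> complex" where
  "fatou_in q \<psi> f p = lim (\<lambda>n. w_in q (\<psi> ((f ^^ n) p)) - of_nat n)"

definition fatou_out ::
    "complex \<Rightarrow> ('m \<Rightarrow> complex \<times> complex) \<Rightarrow> ('m \<Rightarrow> 'm) \<Rightarrow> 'm \<Rightarrow> complex" where
  "fatou_out q \<psi> f p = lim (\<lambda>n. w_out q (\<psi> ((inv f ^^ n) p)) + of_nat n)"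

definition T_map ::
    "complex \<Rightarrow> ('m::topological_space \<Rightarrow> complex \<times> complex) \<Rightarrow> ('m \<Rightarrow> 'm) \<Rightarrow> 'm
     \<Rightarrow> complex \<Rightarrow> 'm \<Rightarrow> 'm" where
  "T_map q \<psi> f pt \<alpha> p =
     inv_into (unstable_curve f pt) (fatou_out q \<psi> f) (fatou_in q \<psi> f p + \<alpha>)"

end

theory Submission
  imports Defs "HOL-Complex_Analysis.Complex_Analysis" "HOL-Real_Asymp.Real_Asymp"
    "HOL-Library.Diagonal_Subsequence"
begin

text \<open>
  Put \<open>x = - \<epsilon> cot (\<epsilon> w)\<close>.  By the addition theorem of the tangent the perturbed map becomes an
  exact translation \<open>w \<mapsto> w + arctan (\<epsilon> g) / \<epsilon>\<close> with \<open>g = \<alpha>\<^sub>\<epsilon> / (1 + x \<alpha>\<^sub>\<epsilon>) = 1 + q x + r y + \<dots>\<close>, and the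
  correction \<open>W = w + q (log sin (\<epsilon> w) - log \<epsilon>)\<close> removes the term \<open>q x\<close>.  Since \<open>y\<close> is contracted, the
  drift \<open>W - W\<^sub>0 - k\<close> together with a multiple of \<open>\<bar>y\<bar>\<close> grows per step by at most a constant times
  \<open>\<bar>x\<bar>\<^sup>2 + \<bar>\<epsilon>\<bar>\<^sup>2\<close>, that is, \<open>1 / k\<^sup>2 + 1 / (n - k)\<^sup>2\<close>.  So from step \<open>N\<close> to step \<open>n - m\<close> the drift is
  \<open>O(1 / N + 1 / m)\<close>.  At the entrance \<open>W\<close> tends to the incoming coordinate \<open>w\<^sup>\<iota>\<close>; at the exit
  \<open>W - \<pi> / \<epsilon>\<close> tends to the outgoing coordinate \<open>w\<^sup>o\<close>.

  The limits of the points \<open>m\<close> steps before the end exist along a diagonal subsequence, and they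
  form a backward orbit of \<open>F\<^sub>0\<close> that tends to \<open>O\<close> and has outgoing Fatou coordinate \<open>\<phi>\<^sup>\<iota> + \<alpha>\<close>.  The
  outgoing coordinate is injective, because in the coordinates \<open>(1 / x, y)\<close> the forward map
  expands a suitable distance by a factor of at most \<open>1 + c / k\<^sup>2\<close>, with convergent product.
\<close>

section \<open>The one-step estimate\<close>

text \<open>The number of steps grows like pi / |\<epsilon>|, so continuity in the parameter
  controls only a bounded number of them at either end; between these the error per step must be
  summable with a bound uniform in \<epsilon>. The obstacle is the first-order part q x + r y: since
  x is about - 1 / k near the entrance, the sum of q x grows like a logarithm, and this forces a
  logarithmic correction. With it come branches, so the arguments of \<open>Ln\<close> are kept in
  the right half-plane, where logarithms of quotients split without a jump. The location of an orbit
  and the bound on its drift depend on each other and are proved in one induction, which closes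
  because a logarithm is small against a linear function. The exit distance m is fixed before the
  entrance time N, and both before \<epsilon>; the error O(1 / m) disappears only when m finally
  tends to infinity. Finally, 1 / x requires x \<noteq> 0, which has to be proved both in the basin
  and on \<Sigma>, by different properties of the axis x = 0.\<close>

lemma cmod_cos_minus_1:
  assumes "cmod z \<le> 1/2" shows "cmod (cos z - 1) \<le> 2 * (cmod z)\<^sup>2"
proof -
  have "(\<Sum>k\<le>Suc 0. complex_of_real (cos_coeff k) * z ^ k) = 1"
    by (simp add: cos_coeff_def)
  then have t: "cmod (cos z - 1) \<le> exp \<bar>Im z\<bar> * (cmod z)\<^sup>2"
    using Taylor_cos[of z "Suc 0"] by (simp add: power2_eq_square cos_coeff_def)
  have "exp \<bar>Im z\<bar> \<le> 2"
    using real_exp_bound_lemma[of "\<bar>Im z\<bar>"] abs_Im_le_cmod[of z] assms by auto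
  then have "exp \<bar>Im z\<bar> * (cmod z)\<^sup>2 \<le> 2 * (cmod z)\<^sup>2"
    by (rule mult_right_mono) simp
  then show ?thesis using t by simp
qed

text \<open>The derivative of \<open>Arctan z - z\<close> is - z^2 / (1 + z^2). The cubic order
  matters: after division by \<open>e\<close>, the error of replacing \<open>Arctan (e * g)\<close>
  by e g is still of order |e|^2, hence summable over about pi / |e| steps.\<close>

lemma cmod_Arctan_minus_id:
  fixes z :: complex
  assumes "cmod z \<le> 1/2" shows "cmod (Arctan z - z) \<le> 2 * cmod z ^ 3"
proof -
  have "cmod ((Arctan z - z) - (Arctan 0 - 0)) \<le> 2 * (cmod z)\<^sup>2 * cmod (z - 0)"
  proof (rule field_differentiable_bound[where S = "cball 0 (cmod z)" and f' = "\<lambda>w. inverse (1 + w\<^sup>2) - 1"])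
    fix w :: complex assume w: "w \<in> cball 0 (cmod z)"
    then have w2: "cmod w \<le> cmod z" by simp
    then have wh: "cmod w \<le> 1/2" using assms by simp
    have "Re w = 0 \<Longrightarrow> \<bar>Im w\<bar> < 1" using wh abs_Im_le_cmod[of w] by linarith
    then show "((\<lambda>z. Arctan z - z) has_field_derivative inverse (1 + w\<^sup>2) - 1) (at w within cball 0 (cmod z))"
      by (intro DERIV_diff DERIV_ident has_field_derivative_at_within[OF has_field_derivative_Arctan])
    have sq: "(cmod w)\<^sup>2 \<le> (1/2)\<^sup>2" using wh by (intro power_mono) auto
    have "cmod (1 + w\<^sup>2) \<ge> 1 - (cmod w)\<^sup>2"
      using norm_diff_ineq[of 1 "w\<^sup>2"] by (simp add: norm_power)
    then have h: "cmod (1 + w\<^sup>2) \<ge> 1/2" using sq by (simp add: power2_eq_square)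
    then have nz: "1 + w\<^sup>2 \<noteq> 0" by auto
    have "inverse (1 + w\<^sup>2) - 1 = - w\<^sup>2 / (1 + w\<^sup>2)"
      using nz by (simp add: field_simps)
    then have "cmod (inverse (1 + w\<^sup>2) - 1) = (cmod w)\<^sup>2 / cmod (1 + w\<^sup>2)"
      by (simp add: norm_divide norm_power)
    also have "\<dots> \<le> (cmod w)\<^sup>2 / (1/2)"
      using h by (intro divide_left_mono) auto
    also have "\<dots> \<le> 2 * (cmod z)\<^sup>2" using w2 by simp
    finally show "cmod (inverse (1 + w\<^sup>2) - 1) \<le> 2 * (cmod z)\<^sup>2" .
  qed auto
  then show ?thesis by (simp add: power3_eq_cube power2_eq_square)
qed

lemma norm_diff_triangle_ineq': "norm (x - z) \<le> norm (x - y) + norm (y - z)"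
  using norm_triangle_ineq[of "x - y" "y - z"] by simp

text \<open>The quantitative content of the normal form near O. \<open>C * d \<le> 1/100\<close>
  makes every quadratic error a small fraction of a linear one, which is why plain numerical
  constants suffice below. The parameter 0 is included, so one set of one-step estimates serves
  perturbed and unperturbed orbits.\<close>

locale semiparabolic_model =
  fixes d C lam :: real and q r :: complex
    and a \<beta> :: "complex \<Rightarrow> complex \<Rightarrow> complex \<Rightarrow> complex"
    and b :: "complex \<Rightarrow> complex \<Rightarrow> complex"
  assumes d_pos: "0 < d" and C_ge_1: "1 \<le> C" and Cd: "C * d \<le> 1/100"
    and q_le: "cmod q \<le> C" "cmod (q + 1) \<le> C" and r_le: "cmod r \<le> C"
    and lam: "0 \<le> lam" "lam < 1"
    and a_bound: "\<And>e x y. cmod e < d \<Longrightarrow> cmod x < d \<Longrightarrow> cmod y < d \<Longrightarrow>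
       cmod (a e x y - (1 + (q + 1) * x + r * y)) \<le> C * ((cmod x)\<^sup>2 + (cmod y)\<^sup>2 + (cmod e)\<^sup>2)"
    and \<beta>_bound: "\<And>e x y. cmod e < d \<Longrightarrow> cmod x < d \<Longrightarrow> cmod y < d \<Longrightarrow> cmod (\<beta> e x y) \<le> C"
    and b_bound: "\<And>e x. cmod e < d \<Longrightarrow> cmod x < d \<Longrightarrow> cmod (b e x) \<le> lam"
begin

definition step :: "complex \<Rightarrow> complex \<times> complex \<Rightarrow> complex \<times> complex" where
  "step e = (\<lambda>(x, y). (x + (x\<^sup>2 + e\<^sup>2) * a e x y, b e x * y + (x\<^sup>2 + e\<^sup>2) * \<beta> e x y))"

text \<open>This is the g that solves x + (x^2 + e^2) a = (x + e^2 g) / (1 - x g). The right-hand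
  side is the addition theorem of the cotangent for x = - e cot (e w) and an increment whose tangent
  is e g.\<close>

definition speed :: "complex \<Rightarrow> complex \<Rightarrow> complex \<Rightarrow> complex" where
  "speed e x y = a e x y / (1 + x * a e x y)"

text \<open>
  If \<open>x = - e cot (e w)\<close>, then one step of the map adds \<open>dw\<close> to \<open>w\<close> and multiplies \<open>sin (e w)\<close> by
  \<open>ratio\<close>; for \<open>e = 0\<close> the same holds with \<open>x = - 1 / w\<close> and \<open>w\<close> in place of \<open>sin (e w)\<close>.
\<close>

definition dw :: "complex \<Rightarrow> complex \<Rightarrow> complex \<Rightarrow> complex" where
  "dw e x y = (if e = 0 then speed e x y else Arctan (e * speed e x y) / e)"

definition ratio :: "complex \<Rightarrow> complex \<Rightarrow> complex \<Rightarrow> complex" where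
  "ratio e x y = cos (e * dw e x y) * (1 - x * speed e x y)"

text \<open>The factor 40 covers 20 from \<open>dw_bounds\<close>, 15 from
  \<open>ratio_bounds\<close> after multiplication by q, and the term r y; the squares of |y| are
  absorbed through |y| \<le> 1/100.\<close>

definition B :: real where "B = 40 * C\<^sup>2"

lemma d_le: "d \<le> 1/100"
proof -
  have "1 * d \<le> C * d" using C_ge_1 d_pos by (intro mult_right_mono) auto
  then show ?thesis using Cd by simp
qed

text \<open>To first order, division by 1 + x a subtracts x, which turns the coefficient q + 1 of x
  into q. \<open>s\<close> measures linear and \<open>Q\<close> quadratic size;
  \<open>Q \<le> d * s\<close> absorbs quadratic errors into linear ones.\<close>

lemma speed_bounds:
  assumes "cmod e < d" "cmod x < d" "cmod y < d"
  defines "s \<equiv> cmod x + cmod y + cmod e"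
  defines "Q \<equiv> (cmod x)\<^sup>2 + (cmod y)\<^sup>2 + (cmod e)\<^sup>2"
  shows "cmod (1 + x * a e x y) \<ge> 98/100"
    and "cmod (speed e x y - (1 + q * x + r * y)) \<le> 17 * C * Q"
    and "cmod (speed e x y - 1) \<le> 2 * C * s"
    and "cmod (speed e x y) \<le> 107/100"
    and "s\<^sup>2 \<le> 3 * Q" "Q \<le> d * s" "C * s \<le> 3/100" "cmod x * s \<le> 3 * Q"
    and "cmod (a e x y - 1) \<le> 3 * C * s"
proof -
  define A where "A = a e x y"
  have s0: "s \<ge> 0" "cmod x \<le> s" "cmod y \<le> s" "cmod e \<le> s" by (auto simp: s_def)
  have s3: "s \<le> 3 * d" using assms by (simp add: s_def)
  show Cs: "C * s \<le> 3/100"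
  proof -
    have "C * s \<le> C * (3 * d)" using s3 C_ge_1 by (intro mult_left_mono) auto
    then show ?thesis using Cd by simp
  qed
  show sQ: "s\<^sup>2 \<le> 3 * Q"
    unfolding s_def Q_def
    using sum_squares_ge_zero[of "cmod x - cmod y" "cmod x - cmod e"] zero_le_square[of "cmod y - cmod e"]
    by (simp add: power2_eq_square algebra_simps)
  show Qs: "Q \<le> d * s"
    unfolding s_def Q_def power2_eq_square distrib_left
    using assms by (intro add_mono mult_right_mono) auto
  have "cmod x * s \<le> s * s" using s0 by (intro mult_right_mono) auto
  then show xs: "cmod x * s \<le> 3 * Q" using sQ by (simp add: power2_eq_square)
  have Q0: "Q \<ge> 0" by (simp add: Q_def)
  have CQ: "C * Q \<le> s / 100"
  proof -
    have "C * Q \<le> C * (d * s)" using Qs C_ge_1 by (intro mult_left_mono) auto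
    also have "\<dots> = (C * d) * s" by simp
    also have "\<dots> \<le> 1/100 * s" using Cd s0 by (intro mult_right_mono) auto
    finally show ?thesis by simp
  qed
  have sCs: "s \<le> C * s" using C_ge_1 s0 by (simp add: mult_le_cancel_right1)
  define E where "E = A - (1 + (q + 1) * x + r * y)"
  have E: "cmod E \<le> C * Q" using a_bound[OF assms(1-3)] by (simp add: E_def A_def Q_def)
  have Aeq: "A = 1 + (q + 1) * x + r * y + E" by (simp add: E_def)
  have qx: "cmod (q * x) \<le> C * cmod x" "cmod ((q + 1) * x) \<le> C * cmod x" "cmod (r * y) \<le> C * cmod y"
    using q_le r_le by (auto simp: norm_mult intro!: mult_right_mono)
  have sum2: "C * cmod x + C * cmod y \<le> C * s"
    using C_ge_1 by (simp add: s_def algebra_simps)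
  have "cmod (A - 1) \<le> cmod ((q + 1) * x) + cmod (r * y) + cmod E"
    using norm_triangle_ineq[of "(q + 1) * x + r * y" E] norm_triangle_ineq[of "(q + 1) * x" "r * y"]
    by (simp add: Aeq add.assoc)
  also have "\<dots> \<le> C * s + s/100" using qx sum2 E CQ by linarith
  also have "\<dots> \<le> 101/100 * (C * s)" using sCs by simp
  finally have A1: "cmod (A - 1) \<le> 101/100 * (C * s)" .
  then show "cmod (a e x y - 1) \<le> 3 * C * s" using sCs s0 by (simp add: A_def)
  have A2: "cmod A \<le> 104/100"
    using norm_triangle_ineq[of "A - 1" 1] A1 Cs by simp
  have x1: "cmod x \<le> 1/100" using assms d_le by simp
  have xA: "cmod (x * A) \<le> 2/100"
  proof -
    have "cmod (x * A) \<le> 1/100 * (104/100)"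
      unfolding norm_mult using x1 A2 by (intro mult_mono) auto
    then show ?thesis by simp
  qed
  show den: "cmod (1 + x * a e x y) \<ge> 98/100"
    using norm_diff_ineq[of 1 "x * A"] xA by (simp add: A_def)
  then have nz: "1 + x * A \<noteq> 0" by (auto simp: A_def)
  have qr: "cmod (q * x + r * y) \<le> C * s"
    using norm_triangle_ineq[of "q * x" "r * y"] qx sum2 by linarith
  \<comment> \<open>All three terms of the numerator are of second order: \<open>E\<close> by
    hypothesis, the other two as products of factors of first order.\<close>
  have eq: "speed e x y - (1 + q * x + r * y)
     = (E - x * (A - 1) - x * A * (q * x + r * y)) / (1 + x * A)"
  proof -
    have "(speed e x y - (1 + q * x + r * y)) * (1 + x * A)
        = A - (1 + q * x + r * y) * (1 + x * A)"
      using nz by (simp add: speed_def A_def left_diff_distrib)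
    also have "\<dots> = E - x * (A - 1) - x * A * (q * x + r * y)"
      by (simp add: E_def algebra_simps)
    finally show ?thesis using nz by (simp add: eq_divide_eq)
  qed
  have "cmod (E - x * (A - 1) - x * A * (q * x + r * y))
      \<le> cmod E + cmod (x * (A - 1)) + cmod (x * A * (q * x + r * y))"
    by (meson add_mono norm_triangle_ineq4 order_refl order_trans)
  also have "\<dots> \<le> C * Q + 101/100 * (3 * (C * Q)) + 104/100 * (3 * (C * Q))"
  proof (intro add_mono E)
    have xsC: "cmod x * (C * s) \<le> 3 * (C * Q)"
      using mult_left_mono[OF xs, of C] C_ge_1 by (simp add: mult_ac)
    have "cmod (x * (A - 1)) \<le> cmod x * (101/100 * (C * s))"
      unfolding norm_mult by (intro mult_left_mono A1) auto
    then show "cmod (x * (A - 1)) \<le> 101/100 * (3 * (C * Q))" using xsC by simp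
    have "cmod (x * A * (q * x + r * y)) \<le> cmod x * (104/100) * (C * s)"
      unfolding norm_mult by (intro mult_mono A2 qr) auto
    then show "cmod (x * A * (q * x + r * y)) \<le> 104/100 * (3 * (C * Q))" using xsC by simp
  qed
  also have "\<dots> \<le> 8 * (C * Q)" using C_ge_1 Q0 by simp
  finally have num: "cmod (E - x * (A - 1) - x * A * (q * x + r * y)) \<le> 8 * (C * Q)" .
  have "cmod (speed e x y - (1 + q * x + r * y)) \<le> 8 * (C * Q) / (98/100)"
    unfolding eq norm_divide using num den C_ge_1 Q0 by (intro frac_le) (auto simp: A_def)
  also have "\<dots> \<le> 17 * (C * Q)" using C_ge_1 Q0 by simp
  finally show g: "cmod (speed e x y - (1 + q * x + r * y)) \<le> 17 * C * Q" by simp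
  have "cmod (speed e x y - 1) \<le> cmod (speed e x y - (1 + q * x + r * y)) + cmod (q * x + r * y)"
    using norm_triangle_ineq[of "speed e x y - (1 + q * x + r * y)" "q * x + r * y"] by (simp add: algebra_simps)
  also have "\<dots> \<le> 17 * (s/100) + C * s" using g qr CQ by linarith
  also have "\<dots> \<le> 2 * C * s" using sCs s0 by simp
  finally show g1: "cmod (speed e x y - 1) \<le> 2 * C * s" .
  show "cmod (speed e x y) \<le> 107/100"
    using norm_triangle_ineq[of "speed e x y - 1" 1] g1 Cs by simp
qed

text \<open>The arctangent costs only 3 |e|^2, which is contained in \<open>Q\<close>, so
  \<open>dw\<close> inherits the expansion of \<open>speed\<close>. The crude bound 1/8 serves to
  locate orbits before any sharper estimate is available.\<close>

lemma dw_bounds: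
  assumes "cmod e < d" "cmod x < d" "cmod y < d"
  defines "Q \<equiv> (cmod x)\<^sup>2 + (cmod y)\<^sup>2 + (cmod e)\<^sup>2"
  shows "cmod (dw e x y - speed e x y) \<le> 3 * (cmod e)\<^sup>2"
    and "cmod (dw e x y - (1 + q * x + r * y)) \<le> 20 * C * Q"
    and "cmod (dw e x y - 1) \<le> 1/8"
    and "e \<noteq> 0 \<Longrightarrow> tan (e * dw e x y) = e * speed e x y"
    and "cmod (e * dw e x y) \<le> 12/10 * cmod e"
proof -
  define g where "g = speed e x y"
  note sb = speed_bounds[OF assms(1-3)]
  have e1: "cmod e \<le> 1/100" using assms d_le by simp
  have g: "cmod g \<le> 107/100" using sb(4) by (simp add: g_def)
  have eg: "cmod (e * g) \<le> 2/100"
  proof -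
    have "cmod (e * g) \<le> 1/100 * (107/100)"
      unfolding norm_mult using e1 g by (intro mult_mono) auto
    then show ?thesis by simp
  qed
  show D: "cmod (dw e x y - speed e x y) \<le> 3 * (cmod e)\<^sup>2"
  proof (cases "e = 0")
    case False
    have "cmod (Arctan (e * g) - e * g) \<le> 2 * cmod (e * g) ^ 3"
      using eg by (intro cmod_Arctan_minus_id) auto
    moreover have "dw e x y - speed e x y = (Arctan (e * g) - e * g) / e"
      using False by (simp add: dw_def g_def diff_divide_distrib)
    ultimately have "cmod (dw e x y - speed e x y) \<le> 2 * cmod (e * g) ^ 3 / cmod e"
      by (simp add: norm_divide divide_right_mono)
    also have "\<dots> = 2 * (cmod e)\<^sup>2 * cmod g ^ 3"
      using False by (simp add: norm_mult power_mult_distrib power3_eq_cube power2_eq_square)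
    also have "\<dots> \<le> 2 * (cmod e)\<^sup>2 * (107/100) ^ 3"
      using g by (intro mult_left_mono power_mono) auto
    also have "\<dots> \<le> 3 * (cmod e)\<^sup>2"
      using zero_le_power2[of "cmod e"] by (simp add: power3_eq_cube)
    finally show ?thesis .
  qed (auto simp: dw_def)
  have eQ: "(cmod e)\<^sup>2 \<le> C * Q"
  proof -
    have "(cmod e)\<^sup>2 \<le> Q" by (simp add: Q_def)
    also have "Q \<le> C * Q" using C_ge_1 mult_right_mono[of 1 C Q] by (simp add: Q_def)
    finally show ?thesis .
  qed
  have "cmod (dw e x y - (1 + q * x + r * y)) \<le>
      cmod (dw e x y - g) + cmod (g - (1 + q * x + r * y))"
    by (rule norm_diff_triangle_ineq')
  then show "cmod (dw e x y - (1 + q * x + r * y)) \<le> 20 * C * Q"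
    using D sb(2) eQ by (simp add: g_def Q_def)
  have "cmod (dw e x y - 1) \<le> cmod (dw e x y - g) + cmod (g - 1)"
    using norm_triangle_ineq[of "dw e x y - g" "g - 1"] by simp
  moreover have "(cmod e)\<^sup>2 \<le> (1/100)\<^sup>2" using e1 by (intro power_mono) auto
  ultimately show d1: "cmod (dw e x y - 1) \<le> 1/8"
    using D sb(3,7) by (simp add: g_def power2_eq_square)
  show "tan (e * dw e x y) = e * speed e x y" if "e \<noteq> 0"
  proof -
    have "(e * g)\<^sup>2 \<noteq> -1"
    proof
      assume "(e * g)\<^sup>2 = -1"
      then have "(cmod (e * g))\<^sup>2 = 1" by (metis norm_minus_cancel norm_one norm_power)
      then have "cmod (e * g) = 1" using norm_ge_zero[of "e * g"] unfolding power2_eq_1_iff by linarith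
      then show False using eg by simp
    qed
    then show ?thesis using that tan_Arctan[of "e * g"] by (simp add: dw_def g_def)
  qed
  have "cmod (dw e x y) \<le> 12/10"
    using norm_triangle_ineq[of "dw e x y - 1" 1] d1 by simp
  then show "cmod (e * dw e x y) \<le> 12/10 * cmod e"
    unfolding norm_mult using mult_left_mono[of "cmod (dw e x y)" "12/10" "cmod e"] by (simp add: mult.commute)
qed

text \<open>The cosine differs from 1 by order |e|^2 and 1 - x g from 1 - x by order
  \<open>Q\<close>, so the logarithm of the ratio is - x up to order \<open>Q\<close>. Multiplied by
  q, it cancels the term q x of \<open>dw\<close>.\<close>

lemma ratio_bounds:
  assumes "cmod e < d" "cmod x < d" "cmod y < d"
  defines "Q \<equiv> (cmod x)\<^sup>2 + (cmod y)\<^sup>2 + (cmod e)\<^sup>2"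
  shows "cmod (ratio e x y - 1) \<le> 1/10"
    and "cmod (Ln (ratio e x y) + x) \<le> 15 * C * Q"
proof -
  define s where "s = cmod x + cmod y + cmod e"
  define g where "g = speed e x y"
  note sb = speed_bounds[OF assms(1-3), folded s_def Q_def]
  note db = dw_bounds[OF assms(1-3), folded Q_def]
  have e1: "cmod e \<le> 1/100" using assms d_le by simp
  have x1: "cmod x \<le> 1/100" using assms d_le by simp
  have Q0: "Q \<ge> 0" by (simp add: Q_def)
  have QC: "Q \<le> C * Q" using C_ge_1 Q0 by (simp add: mult_le_cancel_right1)
  have s0: "s \<ge> 0" by (simp add: s_def)
  have "cmod (cos (e * dw e x y) - 1) \<le> 2 * (cmod (e * dw e x y))\<^sup>2"
    using db(5) e1 by (intro cmod_cos_minus_1) auto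
  also have "\<dots> \<le> 2 * (12/10 * cmod e)\<^sup>2"
    using db(5) by (intro mult_left_mono power_mono) auto
  also have "\<dots> \<le> 3 * (cmod e)\<^sup>2" by (simp add: power2_eq_square)
  also have "\<dots> \<le> 3 * Q" by (simp add: Q_def)
  finally have c: "cmod (cos (e * dw e x y) - 1) \<le> 3 * Q" .
  have xg: "cmod (1 - x * g) \<le> 102/100"
  proof -
    have "cmod (x * g) \<le> 1/100 * (107/100)"
      unfolding norm_mult using x1 sb(4) by (intro mult_mono) (auto simp: g_def)
    then show ?thesis using norm_triangle_ineq4[of 1 "x * g"] by simp
  qed
  define z where "z = ratio e x y - 1"
  have eq: "z + x = (cos (e * dw e x y) - 1) * (1 - x * g) - x * (g - 1)"
    by (simp add: z_def ratio_def g_def algebra_simps)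
  have "cmod (z + x) \<le> cmod ((cos (e * dw e x y) - 1) * (1 - x * g)) + cmod (x * (g - 1))"
    unfolding eq by (rule norm_triangle_ineq4)
  also have "\<dots> \<le> 3 * Q * (102/100) + cmod x * (2 * C * s)"
    unfolding norm_mult using c xg sb(3) Q0 by (intro add_mono mult_mono) (auto simp: g_def)
  also have "\<dots> \<le> 4 * (C * Q) + 6 * (C * Q)"
  proof (rule add_mono)
    show "3 * Q * (102/100) \<le> 4 * (C * Q)" using QC Q0 by simp
    show "cmod x * (2 * C * s) \<le> 6 * (C * Q)"
      using mult_left_mono[OF sb(8), of "2 * C"] C_ge_1 by (simp add: mult_ac)
  qed
  finally have zx: "cmod (z + x) \<le> 10 * (C * Q)" by simp
  have "C * Q \<le> C * d * s" using mult_left_mono[OF sb(6), of C] C_ge_1 by simp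
  also have "\<dots> \<le> 1/100 * s" using Cd s0 by (intro mult_right_mono) auto
  finally have CQs: "C * Q \<le> s / 100" by simp
  have "cmod z \<le> cmod (z + x) + cmod x" using norm_triangle_ineq4[of "z + x" x] by simp
  also have "\<dots> \<le> 11/10 * s"
  proof -
    have "cmod x \<le> s" by (simp add: s_def)
    then show ?thesis using zx CQs by linarith
  qed
  finally have zs: "cmod z \<le> 11/10 * s" .
  have s3: "s \<le> 3/100" using assms d_le by (simp add: s_def)
  show z1: "cmod (ratio e x y - 1) \<le> 1/10" using zs s3 by (simp add: z_def)
  have "cmod (ln (1 + z) - z) \<le> (cmod z)\<^sup>2 / (1 - cmod z)"
    using z1 by (intro Ln_approx_linear) (simp add: z_def)
  also have "\<dots> \<le> (11/10 * s)\<^sup>2 / (9/10)"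
    using zs z1 by (intro frac_le power_mono) (auto simp: z_def)
  also have "\<dots> \<le> 4/3 * s\<^sup>2 * 1.02" using zero_le_power2[of s] by (simp add: power2_eq_square)
  also have "\<dots> \<le> 4/3 * (3 * Q) * 1.02" using sb(5) by (intro mult_right_mono mult_left_mono) auto
  finally have "cmod (ln (1 + z) - z) \<le> 4.08 * Q" by simp
  moreover have "cmod (Ln (ratio e x y) + x) \<le> cmod (ln (1 + z) - z) + cmod (z + x)"
    using norm_triangle_ineq[of "ln (1 + z) - z" "z + x"] by (simp add: z_def)
  ultimately show "cmod (Ln (ratio e x y) + x) \<le> 15 * C * Q"
    using zx QC Q0 by simp
qed


end

section \<open>Logarithms on the right half-plane, and the cotangent coordinate away from its
  poles\<close>

lemma Ln_divide_right_half_plane: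
  assumes "0 < Re u" "0 < Re v"
  shows "Ln (v / u) = Ln v - Ln u"
proof -
  have nz: "u \<noteq> 0" "v \<noteq> 0" using assms by auto
  have im: "\<bar>Im (Ln u)\<bar> < pi/2" "\<bar>Im (Ln v)\<bar> < pi/2"
    using assms by (intro Re_Ln_pos_lt_imp; simp)+
  have "exp (Ln v - Ln u) = v / u" using nz by (simp add: exp_diff)
  moreover have "- pi < Im (Ln v - Ln u)" "Im (Ln v - Ln u) \<le> pi" using im by auto
  ultimately show ?thesis by (intro Ln_unique)
qed

text \<open>From sin x \<ge> x - x^3 / 6. The range reaches 101/100 because the bound is applied at
  64/100 of an angle that is at most pi / 2.\<close>

lemma sin_ge_linear:
  fixes x :: real
  assumes "0 \<le> x" "x \<le> 101/100"
  shows "8/10 * x \<le> sin x"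
proof -
  have "x - x ^ 3 / 6 \<le> sin x"
  proof -
    define f where "f = (\<lambda>t::real. sin t - (t - t ^ 3 / 6))"
    define f' where "f' = (\<lambda>t::real. cos t - (1 - t\<^sup>2 / 2))"
    have f: "(f has_real_derivative f' t) (at t)" for t
      unfolding f_def f'_def by (auto intro!: derivative_eq_intros simp: power2_eq_square)
    have "0 \<le> f' t" for t
    proof -
      have "cos t = 1 - 2 * (sin (t / 2))\<^sup>2" using cos_double_sin[of "t / 2"] by simp
      moreover have "(sin (t / 2))\<^sup>2 \<le> (t / 2)\<^sup>2"
        using abs_sin_x_le_abs_x[of "t / 2"] by (rule abs_le_square_iff[THEN iffD1])
      ultimately show ?thesis by (simp add: f'_def power_divide)
    qed
    then have "f 0 \<le> f x" using f assms by (intro DERIV_nonneg_imp_nondecreasing[where f = f]) auto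
    then show ?thesis by (simp add: f_def)
  qed
  moreover have "x ^ 3 \<le> x * (101/100)\<^sup>2"
    unfolding power3_eq_cube power2_eq_square mult.assoc
    using assms by (intro mult_left_mono mult_mono) auto
  ultimately show ?thesis using assms by (simp add: power2_eq_square)
qed

lemma sin_ge_linear_symmetric:
  fixes a \<mu> :: real
  assumes "0 \<le> \<mu>" "\<mu> \<le> 101/100" "\<mu> \<le> a" "a \<le> pi - \<mu>"
  shows "8/10 * \<mu> \<le> sin a"
proof -
  have p: "101/100 \<le> pi/2" using pi_gt3 by simp
  have "sin \<mu> \<le> sin a"
  proof (cases "a \<le> pi/2")
    case True
    then show ?thesis using assms by (intro sin_monotone_2pi_le) auto
  next
    case False
    then have "sin \<mu> \<le> sin (pi - a)" using assms p by (intro sin_monotone_2pi_le) auto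
    then show ?thesis by simp
  qed
  then show ?thesis using sin_ge_linear[of \<mu>] assms by linarith
qed

lemma cmod_sin_le:
  assumes "cmod z \<le> 1" shows "cmod (sin z) \<le> 3 * cmod z"
proof -
  have "cmod (sin z) \<le> exp \<bar>Im z\<bar> * cmod z"
    using Taylor_sin[of z 0] by (simp add: sin_coeff_def)
  moreover have "exp \<bar>Im z\<bar> \<le> exp 1" using abs_Im_le_cmod[of z] assms by simp
  moreover have "exp \<bar>Im z\<bar> * cmod z \<le> 3 * cmod z"
    using exp_le \<open>exp \<bar>Im z\<bar> \<le> exp 1\<close> by (intro mult_right_mono order_trans[OF _ exp_le]) auto
  ultimately show ?thesis by linarith
qed

text \<open>The situation at time \<open>k\<close> of a passage of length \<open>n\<close>, where
  \<kappa> is the distance in time to the nearer end. At both ends e w approaches a pole of the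
  cotangent, so every tolerance has to be proportional to \<kappa>. The factor 100 makes the phase
  error at most one percent of \<kappa>.\<close>

locale cot_region =
  fixes e w :: complex and n k A \<kappa> :: real
  assumes e_nz: "e \<noteq> 0" and phase: "cmod (of_real n - of_real pi / e) \<le> A" and A: "1 \<le> A"
    and \<kappa>: "\<kappa> \<le> k" "\<kappa> \<le> n - k" "k = \<kappa> \<or> n - k = \<kappa>" "100 * A \<le> \<kappa>"
    and w: "cmod (w - of_real k) \<le> \<kappa> / 3"
begin

definition "\<mu> = pi * \<kappa> / n"

lemma n_ge: "2 * \<kappa> \<le> n" "200 * A \<le> n" "200 \<le> n" "100 \<le> \<kappa>"
  using \<kappa> A by linarith+

text \<open>Writing the phase defect as \<alpha>', one has e (n - \<alpha>') = pi exactly, and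
  |\<alpha>'| \<le> \<open>A\<close> \<le> n / 200 leaves half a percent of uncertainty.\<close>

lemma e_bounds: "cmod e * (995/1000 * n) \<le> pi" "pi \<le> cmod e * (1005/1000 * n)"
proof -
  define \<alpha>' where "\<alpha>' = of_real n - of_real pi / e"
  have \<alpha>': "cmod \<alpha>' \<le> n / 200" using phase n_ge by (simp add: \<alpha>'_def)
  have "e * (of_real n - \<alpha>') = of_real pi" using e_nz by (simp add: \<alpha>'_def)
  then have eq: "cmod e * cmod (of_real n - \<alpha>') = pi"
    by (metis norm_mult norm_of_real abs_of_nonneg pi_ge_zero)
  have "cmod (of_real n) = n" using n_ge by simp
  then have b: "995/1000 * n \<le> cmod (of_real n - \<alpha>')" "cmod (of_real n - \<alpha>') \<le> 1005/1000 * n"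
    using \<alpha>' norm_triangle_ineq4[of "of_real n" \<alpha>'] norm_triangle_ineq2[of "of_real n" \<alpha>'] by simp_all
  show "cmod e * (995/1000 * n) \<le> pi" using mult_left_mono[OF b(1), of "cmod e"] eq by simp
  show "pi \<le> cmod e * (1005/1000 * n)" using mult_left_mono[OF b(2), of "cmod e"] eq by simp
qed

lemma e\<kappa>: "cmod e * \<kappa> \<le> 1006/1000 * \<mu>" "995/1000 * \<mu> \<le> cmod e * \<kappa>" "0 < \<mu>" "\<mu> \<le> pi/2"
proof -
  have n: "n > 0" "\<kappa> > 0" using n_ge by auto
  have "cmod e * (995/1000 * n) * \<kappa> \<le> pi * \<kappa>"
    using e_bounds(1) n by (intro mult_right_mono) auto
  then have "995/1000 * (cmod e * \<kappa>) \<le> \<mu>" using n by (simp add: \<mu>_def pos_le_divide_eq mult_ac)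
  moreover have "0 \<le> cmod e * \<kappa>" using n by simp
  ultimately show "cmod e * \<kappa> \<le> 1006/1000 * \<mu>" by linarith
  have "pi * \<kappa> \<le> cmod e * (1005/1000 * n) * \<kappa>"
    using e_bounds(2) n by (intro mult_right_mono) auto
  then have "\<mu> \<le> 1005/1000 * (cmod e * \<kappa>)" using n by (simp add: \<mu>_def pos_divide_le_eq mult_ac)
  then show "995/1000 * \<mu> \<le> cmod e * \<kappa>"
    using \<open>0 \<le> cmod e * \<kappa>\<close> by linarith
  show "0 < \<mu>" using n by (simp add: \<mu>_def)
  show "\<mu> \<le> pi/2" using n_ge n by (simp add: \<mu>_def pos_divide_le_eq)
qed

text \<open>The deviation from the ideal angle pi k / n has two sources: the radius \<kappa> / 3
  about \<open>k\<close> and the phase defect, at most \<kappa> / 100. Their sum, with the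
  uncertainty in |e|, stays below 36/100 of the angle \<mu> that corresponds to \<kappa>.\<close>

lemma angle: "cmod (e * w - of_real (pi * k / n)) \<le> 36/100 * \<mu>"
proof -
  define \<alpha>' where "\<alpha>' = of_real n - of_real pi / e"
  have n: "n > 0" "\<kappa> > 0" using n_ge by auto
  have k: "0 \<le> k" "k \<le> n" using \<kappa> n by auto
  have eq: "e * w - of_real (pi * k / n) = e * (w - of_real k) + e * (\<alpha>' * of_real (k / n))"
    using e_nz n by (simp add: \<alpha>'_def field_simps)
  have "cmod (\<alpha>' * of_real (k / n)) \<le> A * 1"
    unfolding norm_mult norm_of_real using phase k n A by (intro mult_mono) (auto simp: \<alpha>'_def)
  also have "A * 1 \<le> \<kappa> / 100" using \<kappa> by simp
  finally have a: "cmod (\<alpha>' * of_real (k / n)) \<le> \<kappa> / 100" .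
  have "cmod (e * w - of_real (pi * k / n)) \<le> cmod e * (\<kappa> / 3) + cmod e * (\<kappa> / 100)"
    unfolding eq using w a
    by (intro order_trans[OF norm_triangle_ineq] add_mono; subst norm_mult) (intro mult_left_mono; simp)+
  also have "\<dots> = 103/300 * (cmod e * \<kappa>)" by simp
  also have "\<dots> \<le> 103/300 * (1006/1000 * \<mu>)" using e\<kappa>(1) by (intro mult_left_mono) auto
  also have "\<dots> \<le> 36/100 * \<mu>" using e\<kappa>(3) by simp
  finally show ?thesis .
qed

lemma \<tau>: "\<mu> \<le> pi * k / n" "pi * k / n \<le> pi - \<mu>" "\<mu> = pi * k / n \<or> \<mu> = pi - pi * k / n"
proof -
  have n: "n > 0" using n_ge by auto
  have *: "pi - \<mu> = pi * (n - \<kappa>) / n" using n by (simp add: \<mu>_def field_simps)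
  show "\<mu> \<le> pi * k / n" unfolding \<mu>_def using n \<kappa> by (intro divide_right_mono mult_left_mono) auto
  show "pi * k / n \<le> pi - \<mu>" unfolding * using n \<kappa> by (intro divide_right_mono mult_left_mono) auto
  show "\<mu> = pi * k / n \<or> \<mu> = pi - pi * k / n"
    using \<kappa>(3) n by (auto simp: \<mu>_def field_simps)
qed

text \<open>The real part of e w stays between 64/100 \<mu> and pi - 64/100 \<mu>, and Re sin (s + i
  t) = sin s cosh t \<ge> sin s there. The positivity is what later allows principal logarithms of
  sin (e w) to be added step by step.\<close>

lemma Re_sin_ge: "51/100 * \<mu> \<le> Re (sin (e * w))"
proof -
  define t where "t = Re (e * w)"
  have "\<bar>t - pi * k / n\<bar> \<le> 36/100 * \<mu>"
    using abs_Re_le_cmod[of "e * w - of_real (pi * k / n)"] angle by (simp add: t_def)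
  then have "64/100 * \<mu> \<le> t" "t \<le> pi - 64/100 * \<mu>" using \<tau>(1,2) by linarith+
  then have s: "8/10 * (64/100 * \<mu>) \<le> sin t"
    using e\<kappa> pi_less_4 pi_approx by (intro sin_ge_linear_symmetric) auto
  have "2 \<le> exp (Im (e * w)) + exp (- Im (e * w))"
    using exp_ge_add_one_self[of "Im (e * w)"] exp_ge_add_one_self[of "- Im (e * w)"] by linarith
  then have "sin t * 2 \<le> sin t * (exp (Im (e * w)) + exp (- Im (e * w)))"
    using s e\<kappa>(3) by (intro mult_left_mono) auto
  then show ?thesis using s e\<kappa>(3) unfolding Re_sin t_def[symmetric] by linarith
qed

lemma Re_sin_pos: "0 < Re (sin (e * w))"
  using Re_sin_ge e\<kappa>(3) by linarith

lemma angle_1: "cmod (e * w - of_real (pi * k / n)) \<le> 1"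
  using angle e\<kappa>(4) pi_less_4 by linarith

text \<open>In the logarithm, sin (e w) / e takes the place that w has for the parameter 0. It is
  comparable to \<kappa> during the whole passage, whence |x| \<le> 12 / \<kappa>, with summable
  squares.\<close>

lemma cmod_sin_lower: "\<kappa> / 4 \<le> cmod (sin (e * w) / e)"
proof -
  have "\<kappa> / 4 * cmod e = (cmod e * \<kappa>) / 4" by simp
  also have "\<dots> \<le> 51/100 * \<mu>" using e\<kappa>(1,3) by linarith
  also have "\<dots> \<le> cmod (sin (e * w))" using Re_sin_ge complex_Re_le_cmod order_trans by blast
  finally show ?thesis using e_nz by (simp add: norm_divide pos_le_divide_eq)
qed

lemma cmod_sin_upper: "cmod (sin (e * w) / e) \<le> 5 * \<kappa>"
proof -
  define \<tau> where "\<tau> = pi * k / n"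
  define z where "z = e * w - of_real \<tau>"
  have z: "cmod z \<le> 36/100 * \<mu>" "cmod z \<le> 1" using angle angle_1 by (auto simp: z_def \<tau>_def)
  have "cmod (cos z) \<le> exp 1" using norm_cos_le[of z] z(2) by (meson exp_le_cancel_iff order_trans)
  then have c: "cmod (cos z) \<le> 3" using exp_le by linarith
  have st: "\<bar>sin \<tau>\<bar> \<le> \<mu>"
    using \<tau>(3) abs_sin_x_le_abs_x[of \<tau>] abs_sin_x_le_abs_x[of "pi - \<tau>"] e\<kappa>(3) by (auto simp: \<tau>_def[symmetric])
  have "sin (e * w) = sin (of_real \<tau>) * cos z + cos (of_real \<tau>) * sin z"
    using sin_add[of "of_real \<tau>" z] by (simp add: z_def)
  then have "cmod (sin (e * w)) \<le> \<bar>sin \<tau>\<bar> * cmod (cos z) + \<bar>cos \<tau>\<bar> * cmod (sin z)"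
    by (metis norm_mult norm_triangle_ineq sin_of_real cos_of_real norm_of_real)
  also have "\<dots> \<le> \<mu> * 3 + 1 * (3 * (36/100 * \<mu>))"
    using st c cmod_sin_le[OF z(2)] z(1) e\<kappa>(3) by (intro add_mono mult_mono) auto
  also have "\<dots> \<le> 5 * (995/1000 * \<mu>)" using e\<kappa>(3) by simp
  also have "\<dots> \<le> 5 * (cmod e * \<kappa>)" using e\<kappa>(2) by simp
  finally show ?thesis using e_nz by (simp add: norm_divide pos_divide_le_eq mult_ac)
qed

lemma cmod_cos_le: "cmod (cos (e * w)) \<le> 3"
proof -
  have "\<bar>Im (e * w)\<bar> \<le> 1"
    using abs_Im_le_cmod[of "e * w - of_real (pi * k / n)"] angle_1 by simp
  then have "exp \<bar>Im (e * w)\<bar> \<le> exp 1" by simp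
  moreover have "cmod (cos (e * w)) \<le> exp \<bar>Im (e * w)\<bar>"
    using cmod_cos_le_exp[of 1 "e * w"] by (simp del: times_complex.sel)
  ultimately show ?thesis using exp_le by linarith
qed

lemma cmod_x_le: "cmod (- e * cos (e * w) / sin (e * w)) \<le> 12 / \<kappa>"
proof -
  have "- e * cos (e * w) / sin (e * w) = - cos (e * w) / (sin (e * w) / e)"
    using e_nz by simp
  then have "cmod (- e * cos (e * w) / sin (e * w)) = cmod (cos (e * w)) / cmod (sin (e * w) / e)"
    by (metis norm_divide norm_minus_cancel)
  also have "\<dots> \<le> 3 / (\<kappa> / 4)"
    using cmod_cos_le cmod_sin_lower n_ge by (intro frac_le) auto
  finally show ?thesis by simp
qed

lemma cmod_e_le: "cmod e \<le> 2 / \<kappa>"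
proof -
  have "cmod e * \<kappa> \<le> 1006/1000 * (4/2)"
    using e\<kappa>(1,4) pi_less_4 by simp
  moreover have "cmod e * \<kappa> \<le> 2"
    using e\<kappa>(1,4) pi_approx by simp
  ultimately show ?thesis using n_ge by (simp add: pos_le_divide_eq)
qed

text \<open>Hence w and its corrected version differ by O(ln \<kappa>), negligible against the
  tolerance \<kappa> / 4 of the induction in \<open>transit\<close>. Of the constant 7, 2 bounds ln
  5 and the rest the imaginary parts of the two logarithms, at most pi / 2 and pi.\<close>

lemma log_bound: "cmod (Ln (sin (e * w)) - Ln e) \<le> ln \<kappa> + 7"
proof -
  define s where "s = sin (e * w)"
  have nz: "s \<noteq> 0" using Re_sin_pos by (auto simp: s_def)
  have k1: "\<kappa> \<ge> 100" by (rule n_ge)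
  have re: "Re (Ln s - Ln e) = ln (cmod (s / e))"
    using nz e_nz by (simp add: norm_divide ln_div)
  have up: "ln (cmod (s / e)) \<le> ln \<kappa> + 2"
  proof -
    have "ln (cmod (s / e)) \<le> ln (5 * \<kappa>)"
      using cmod_sin_upper nz e_nz k1 by (subst ln_le_cancel_iff) (auto simp: s_def)
    also have "\<dots> = ln 5 + ln \<kappa>" using k1 by (simp add: ln_mult)
    also have "ln (5::real) \<le> 2"
    proof -
      have "1 + 2 + 2\<^sup>2 / 2 \<le> exp (2::real)"
        by (rule exp_lower_Taylor_quadratic) simp
      then have "5 \<le> exp (2::real)" by simp
      then show ?thesis using ln_ge_iff[of "5::real" 2] by (metis exp_gt_zero ln_exp ln_le_cancel_iff zero_less_numeral)
    qed
    finally show ?thesis by simp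
  qed
  have lo: "0 \<le> ln (cmod (s / e))"
    using cmod_sin_lower k1 by (intro ln_ge_zero) (auto simp: s_def)
  have "\<bar>Im (Ln s)\<bar> \<le> 2"
    using Re_sin_pos Re_Ln_pos_lt_imp[of s] pi_less_4 by (auto simp: s_def)
  moreover have "\<bar>Im (Ln e)\<bar> \<le> pi" using mpi_less_Im_Ln[OF e_nz] Im_Ln_le_pi[OF e_nz] by auto
  moreover have "pi \<le> 32/10" using pi_approx by simp
  moreover have "cmod (Ln s - Ln e) \<le> \<bar>Re (Ln s - Ln e)\<bar> + \<bar>Im (Ln s - Ln e)\<bar>" by (rule cmod_le)
  ultimately have "cmod (Ln s - Ln e) \<le> ln (cmod (s / e)) + (\<bar>Im (Ln s)\<bar> + \<bar>Im (Ln e)\<bar>)"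
    using re lo by simp
  then show ?thesis using up \<open>\<bar>Im (Ln s)\<bar> \<le> 2\<close> \<open>\<bar>Im (Ln e)\<bar> \<le> pi\<close> \<open>pi \<le> 32/10\<close>
      Re_Ln_pos_lt_imp[OF Re_sin_pos] by (simp add: s_def)
qed

end

section \<open>Exact translation, contraction of y and accumulated drift\<close>

context semiparabolic_model
begin

lemma B_bounds: "C \<le> B" "1 \<le> B" "35 * C\<^sup>2 \<le> B" "C \<le> C\<^sup>2" "0 < B"
proof -
  show cc: "C \<le> C\<^sup>2" using C_ge_1 by (simp add: power2_eq_square mult_le_cancel_left1)
  show "C \<le> B" "1 \<le> B" "35 * C\<^sup>2 \<le> B" "0 < B" unfolding B_def using cc C_ge_1 by auto
qed

text \<open>The terms q x of \<open>dw\<close> and - q x of \<open>q * Ln (ratio e x y)\<close>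
  cancel. Of first order only r y survives, so |y| enters linearly while |x| and |e| enter
  quadratically.\<close>

lemma log_step:
  assumes "cmod e < d" "cmod x < d" "cmod y < d"
  shows "cmod (dw e x y + q * Ln (ratio e x y) - 1) \<le> B * (cmod y + ((cmod x)\<^sup>2 + (cmod e)\<^sup>2))"
proof -
  define Q where "Q = (cmod x)\<^sup>2 + (cmod y)\<^sup>2 + (cmod e)\<^sup>2"
  have Q0: "0 \<le> Q" by (simp add: Q_def)
  have eq: "dw e x y + q * Ln (ratio e x y) - 1
     = (dw e x y - (1 + q * x + r * y)) + q * (Ln (ratio e x y) + x) + r * y"
    by (simp add: algebra_simps)
  have 1: "cmod (dw e x y - (1 + q * x + r * y)) \<le> 20 * C\<^sup>2 * Q"
    using dw_bounds(2)[OF assms] mult_right_mono[OF B_bounds(4) Q0] by (simp add: Q_def)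
  have 2: "cmod (q * (Ln (ratio e x y) + x)) \<le> 15 * C\<^sup>2 * Q"
  proof -
    have "cmod (q * (Ln (ratio e x y) + x)) \<le> C * (15 * C * Q)"
      unfolding norm_mult using ratio_bounds(2)[OF assms] q_le C_ge_1
      by (intro mult_mono) (auto simp: Q_def)
    then show ?thesis by (simp add: power2_eq_square)
  qed
  have 3: "cmod (r * y) \<le> C\<^sup>2 * cmod y"
    unfolding norm_mult using r_le B_bounds(4) by (intro mult_right_mono) auto
  have y1: "cmod y \<le> 1/100" using assms d_le by simp
  have "(cmod y)\<^sup>2 \<le> 1/100 * cmod y"
    unfolding power2_eq_square using y1 by (intro mult_right_mono) auto
  then have "35 * (cmod y)\<^sup>2 + cmod y \<le> 40 * cmod y" using norm_ge_zero[of y] by linarith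
  then have "C\<^sup>2 * (35 * (cmod y)\<^sup>2 + cmod y) \<le> C\<^sup>2 * (40 * cmod y)"
    by (intro mult_left_mono) auto
  moreover have "B * (cmod y + ((cmod x)\<^sup>2 + (cmod e)\<^sup>2)) - (20 * C\<^sup>2 * Q + 15 * C\<^sup>2 * Q + C\<^sup>2 * cmod y)
      = C\<^sup>2 * (40 * cmod y) - C\<^sup>2 * (35 * (cmod y)\<^sup>2 + cmod y) + 5 * (C\<^sup>2 * ((cmod x)\<^sup>2 + (cmod e)\<^sup>2))"
    by (simp add: Q_def B_def algebra_simps)
  moreover have "0 \<le> C\<^sup>2 * ((cmod x)\<^sup>2 + (cmod e)\<^sup>2)" by simp
  ultimately have "20 * C\<^sup>2 * Q + 15 * C\<^sup>2 * Q + C\<^sup>2 * cmod y \<le> B * (cmod y + ((cmod x)\<^sup>2 + (cmod e)\<^sup>2))"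
    by linarith
  moreover have "cmod (dw e x y + q * Ln (ratio e x y) - 1)
     \<le> cmod (dw e x y - (1 + q * x + r * y)) + cmod (q * (Ln (ratio e x y) + x)) + cmod (r * y)"
    unfolding eq by (meson add_right_mono norm_triangle_ineq order_trans)
  ultimately show ?thesis using 1 2 3 by linarith
qed

lemma snd_step_le:
  assumes "cmod e < d" "cmod x < d" "cmod y < d"
  shows "cmod (snd (step e (x, y))) \<le> lam * cmod y + B * ((cmod x)\<^sup>2 + (cmod e)\<^sup>2)"
proof -
  have "cmod (snd (step e (x, y))) \<le> cmod (b e x * y) + cmod ((x\<^sup>2 + e\<^sup>2) * \<beta> e x y)"
    unfolding step_def by (simp add: norm_triangle_ineq)
  also have "cmod (b e x * y) \<le> lam * cmod y"
    unfolding norm_mult using b_bound assms by (intro mult_right_mono) auto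
  also have "cmod ((x\<^sup>2 + e\<^sup>2) * \<beta> e x y) \<le> ((cmod x)\<^sup>2 + (cmod e)\<^sup>2) * C"
    unfolding norm_mult using \<beta>_bound assms C_ge_1 norm_triangle_ineq[of "x\<^sup>2" "e\<^sup>2"]
    by (intro mult_mono) (auto simp: norm_power)
  also have "((cmod x)\<^sup>2 + (cmod e)\<^sup>2) * C \<le> B * ((cmod x)\<^sup>2 + (cmod e)\<^sup>2)"
    using B_bounds(1) by (simp add: mult.commute mult_right_mono)
  finally show ?thesis by simp
qed

lemma one_plus_xa_nonzero:
  assumes "cmod e < d" "cmod x < d" "cmod y < d"
  shows "1 + x * a e x y \<noteq> 0"
  using speed_bounds(1)[OF assms] by auto

lemma one_minus_x_speed:
  assumes "cmod e < d" "cmod x < d" "cmod y < d"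
  shows "1 - x * speed e x y = 1 / (1 + x * a e x y)"
  using one_plus_xa_nonzero[OF assms] by (simp add: speed_def field_simps)

lemma ratio_nonzero:
  assumes "cmod e < d" "cmod x < d" "cmod y < d"
  shows "ratio e x y \<noteq> 0"
  using ratio_bounds(1)[OF assms] by auto

lemma step_cot:
  assumes "cmod e < d" "cmod x < d" "cmod y < d"
    and e: "e \<noteq> 0" and s: "sin (e * w) \<noteq> 0" and x: "x = - e * cos (e * w) / sin (e * w)"
  defines "w' \<equiv> w + dw e x y"
  shows "sin (e * w') = sin (e * w) * ratio e x y"
    and "sin (e * w') \<noteq> 0"
    and "fst (step e (x, y)) = - e * cos (e * w') / sin (e * w')"
proof -
  define \<xi> where "\<xi> = e * dw e x y"
  define g where "g = speed e x y"
  have t: "tan \<xi> = e * g" using dw_bounds(4)[OF assms(1-3) e] by (simp add: \<xi>_def g_def)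
  have c: "cos \<xi> \<noteq> 0" using ratio_nonzero[OF assms(1-3)] by (auto simp: ratio_def \<xi>_def)
  \<comment> \<open>With this and cos (e w) = - x sin (e w) / e, both addition formulas acquire the
    common factor sin (e w) cos \<xi>, which cancels in the cotangent.\<close>
  have sx: "sin \<xi> = e * g * cos \<xi>" using t c by (simp add: tan_def field_simps)
  have cw: "cos (e * w) = - x * sin (e * w) / e" using x s e by (simp add: field_simps)
  have w': "e * w' = e * w + \<xi>" by (simp add: w'_def \<xi>_def distrib_left)
  show r: "sin (e * w') = sin (e * w) * ratio e x y"
    unfolding w' sin_add sx cw ratio_def \<xi>_def[symmetric] g_def[symmetric]
    using e by (simp add: field_simps)
  then show nz: "sin (e * w') \<noteq> 0" using s ratio_nonzero[OF assms(1-3)] by simp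
  have cw': "cos (e * w') = - (sin (e * w) * cos \<xi>) * (x + e\<^sup>2 * g) / e"
    unfolding w' cos_add sx cw using e by (simp add: field_simps power2_eq_square)
  have "- e * cos (e * w') / sin (e * w') = (x + e\<^sup>2 * g) / (1 - x * g)"
    unfolding cw' r ratio_def \<xi>_def[symmetric] g_def[symmetric] using e s c by simp
  also have "\<dots> = (x + e\<^sup>2 * g) * (1 + x * a e x y)"
    using one_minus_x_speed[OF assms(1-3)] by (simp add: g_def)
  also have "\<dots> = x * (1 + x * a e x y) + e\<^sup>2 * a e x y"
    using one_plus_xa_nonzero[OF assms(1-3)] by (simp add: g_def speed_def distrib_right)
  also have "\<dots> = fst (step e (x, y))" by (simp add: step_def algebra_simps power2_eq_square)
  finally show "fst (step e (x, y)) = - e * cos (e * w') / sin (e * w')" by simp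
qed

lemma step_zero:
  assumes "cmod x < d" "cmod y < d" and x: "x \<noteq> 0"
  shows "fst (step 0 (x, y)) \<noteq> 0"
    and "- 1 / fst (step 0 (x, y)) = - 1 / x + dw 0 x y"
    and "(- 1 / fst (step 0 (x, y))) / (- 1 / x) = ratio 0 x y"
proof -
  have e: "cmod 0 < d" using d_pos by simp
  note nz = one_plus_xa_nonzero[OF e assms(1,2)]
  have f: "fst (step 0 (x, y)) = x * (1 + x * a 0 x y)"
    by (simp add: step_def algebra_simps power2_eq_square)
  then show "fst (step 0 (x, y)) \<noteq> 0" using x nz by simp
  show "- 1 / fst (step 0 (x, y)) = - 1 / x + dw 0 x y"
    unfolding f dw_def speed_def using x nz by (simp add: divide_simps)
  show "(- 1 / fst (step 0 (x, y))) / (- 1 / x) = ratio 0 x y"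
    unfolding f ratio_def one_minus_x_speed[OF e assms(1,2)] using x nz by simp
qed

text \<open>With the weight \<open>K\<close> on \<open>\<bar>y\<bar>\<close> the contraction of \<open>y\<close> absorbs the term \<open>B \<bar>y\<bar>\<close> of the drift.\<close>

definition K :: real where "K = B / (1 - lam)"

lemma K_bounds: "B \<le> K" "1 \<le> K" "0 < K" "B + K * lam = K"
proof -
  have l: "0 < 1 - lam" using lam by simp
  show "B + K * lam = K" using l by (simp add: K_def field_simps)
  have "B * (1 - lam) \<le> B * 1" using B_bounds lam by (intro mult_left_mono) auto
  then show "B \<le> K" using l by (simp add: K_def pos_le_divide_eq)
  then show "1 \<le> K" "0 < K" using B_bounds by auto
qed

text \<open>Because \<open>B + K * lam = K\<close>, what |y| adds to the drift and what the
  contraction leaves of K |y| recombine to K |y|. Only \<open>h\<close>, which bounds |x|^2 + |e|^2,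
  makes the sum grow.\<close>

lemma drift_step:
  assumes "cmod (W' - W - 1) \<le> B * (Y + h)" "Y' \<le> lam * Y + B * h"
    and "cmod (W - W0 - c) + K * Y \<le> E"
  shows "cmod (W' - W0 - (c + 1)) + K * Y' \<le> E + B * (1 + K) * h"
proof -
  have "cmod (W' - W0 - (c + 1)) \<le> cmod (W' - W - 1) + cmod (W - W0 - c)"
    using norm_triangle_ineq[of "W' - W - 1" "W - W0 - c"] by (simp add: algebra_simps)
  moreover have "K * Y' \<le> K * (lam * Y + B * h)"
    using assms(2) K_bounds by (intro mult_left_mono) auto
  moreover have "B * (Y + h) + K * (lam * Y + B * h) = (B + K * lam) * Y + B * (1 + K) * h"
    by (simp add: algebra_simps)
  ultimately show ?thesis using assms(1,3) K_bounds(4) by simp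
qed

text \<open>For orbits already known to stay in the polydisc. A perturbed passage has to use
  \<open>drift_step\<close> one step at a time, since there the location of the orbit is inferred
  from the drift.\<close>

lemma drift:
  assumes "k \<le> l"
    and "\<And>i. k \<le> i \<Longrightarrow> i < l \<Longrightarrow> cmod (W (Suc i) - W i - 1) \<le> B * (Y i + h i)"
    and "\<And>i. k \<le> i \<Longrightarrow> i < l \<Longrightarrow> Y (Suc i) \<le> lam * Y i + B * h i"
  shows "cmod (W l - W k - of_nat (l - k)) + K * Y l \<le> K * Y k + B * (1 + K) * (\<Sum>i\<in>{k..<l}. h i)"
  using assms
proof (induction l rule: dec_induct)
  case base
  then show ?case by simp
next
  case (step l)
  have "cmod (W l - W k - of_nat (l - k)) + K * Y l \<le> K * Y k + B * (1 + K) * (\<Sum>i\<in>{k..<l}. h i)"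
    using step by simp
  then have "cmod (W (Suc l) - W k - (of_nat (l - k) + 1)) + K * Y (Suc l)
      \<le> K * Y k + B * (1 + K) * (\<Sum>i\<in>{k..<l}. h i) + B * (1 + K) * h l"
    using step by (intro drift_step[where W = "W l" and Y = "Y l"]) auto
  then show ?case using step by (simp add: Suc_diff_le distrib_left add.commute)
qed

end

lemma sum_inverse_squares_le:
  assumes "k \<le> l" "2 \<le> k"
  shows "(\<Sum>i\<in>{k..<l}. 1 / (real i)\<^sup>2) \<le> 1 / (real k - 1)"
proof -
  have "(\<Sum>i\<in>{k..<l}. 1 / (real i)\<^sup>2) \<le> 1 / (real k - 1) - 1 / (real l - 1)"
    using assms
  proof (induction l rule: dec_induct)
    case base
    then show ?case by simp
  next
    case (step l)
    then have l: "real l > 1" by simp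
    have "1 / (real l)\<^sup>2 \<le> 1 / (real l - 1) - 1 / real l"
      using l by (simp add: field_simps power2_eq_square)
    then show ?case using step by simp
  qed
  moreover have "0 \<le> 1 / (real l - 1)" using assms by simp
  ultimately show ?thesis by linarith
qed

lemma sum_inverse_squares_reflected_le:
  assumes "k \<le> l" "l < n"
  shows "(\<Sum>i\<in>{k..<l}. 1 / (real n - real i)\<^sup>2) \<le> 1 / (real n - real l)"
proof -
  have "(\<Sum>i\<in>{k..<l}. 1 / (real n - real i)\<^sup>2) \<le> 1 / (real n - real l) - 1 / (real n - real k)"
    using assms
  proof (induction l rule: dec_induct)
    case base
    then show ?case by simp
  next
    case (step l)
    define t where "t = real n - real l"
    have t: "t > 1" using step by (simp add: t_def)
    have "1 / t\<^sup>2 \<le> 1 / (t - 1) - 1 / t"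
      using t by (simp add: field_simps power2_eq_square)
    then have "1 / (real n - real l)\<^sup>2 \<le> 1 / (real n - real (Suc l)) - 1 / (real n - real l)"
      by (simp add: t_def algebra_simps)
    then show ?case using step by simp
  qed
  moreover have "0 \<le> 1 / (real n - real k)" using assms by simp
  ultimately show ?thesis by linarith
qed

section \<open>Transit of perturbed orbits\<close>

context semiparabolic_model
begin

definition dist_end :: "nat \<Rightarrow> nat \<Rightarrow> real" where
  "dist_end n k = min (real k) (real n - real k)"

text \<open>The W of the overview. Subtracting \<open>Ln e\<close> gives it a limit as the parameter
  tends to 0, because sin (e w) / e tends to w.\<close>

definition pert_log :: "complex \<Rightarrow> complex \<Rightarrow> complex" where
  "pert_log e w = w + q * (Ln (sin (e * w)) - Ln e)"

text \<open>148 = 12^2 + 2^2 comes from the bounds 12 / \<kappa> and 2 / \<kappa> for |x| and |e|;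
  the other factors are those of \<open>drift_step\<close>.\<close>

definition G :: real where "G = B * (1 + K) * 148"

lemma G_pos: "0 < G"
  unfolding G_def using B_bounds K_bounds by auto

lemma cot_region_nat:
  assumes "e \<noteq> 0" "cmod (of_nat n - of_real pi / e) \<le> A" "1 \<le> A" "100 * A \<le> dist_end n k"
    and "cmod (w - of_nat k) \<le> dist_end n k / 3"
  shows "cot_region e w (real n) (real k) A (dist_end n k)"
  using assms by unfold_locales (auto simp: dist_end_def)

text \<open>A bootstrap: the drift bound keeps w within a quarter of \<open>dist_end n k\<close> of
  its index, and this location yields the estimates of |x| and |e| that bound the next drift.
  \<open>far\<close> closes the circle, as bounded drift plus a logarithm stays below the tolerance.
  Two drift bounds are recorded: the partial sum is inductive, the uniform one is for later
  use.\<close>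

lemma transit:
  assumes e: "e \<noteq> 0" and phase: "cmod (of_nat n - of_real pi / e) \<le> A" and A: "1 \<le> A"
    and M: "100 * A \<le> M" "12 / M < d"
    and far: "\<And>\<kappa>. M \<le> \<kappa> \<Longrightarrow> H + 1 + C * (ln \<kappa> + 7) \<le> \<kappa> / 4"
    and Nm: "M \<le> real N" "M \<le> real m" "N + m \<le> n" "2 * N \<le> n"
    and w0: "cmod (w0 - of_nat N) \<le> real N / 4" and x0: "fst z = - e * cos (e * w0) / sin (e * w0)"
    and W0: "cmod (pert_log e w0 - of_nat N) \<le> H"
    and small: "K * cmod (snd z) + G * (1 / (real N - 1) + 1 / real m) \<le> 1"
      "K * cmod (snd z) + G * (1 / (real N - 1) + 1 / real m) < K * d"
    and k: "N \<le> k" "k \<le> n - m"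
  shows "\<exists>w. cmod (w - of_nat k) \<le> dist_end n k / 4
    \<and> fst ((step e ^^ (k - N)) z) = - e * cos (e * w) / sin (e * w)
    \<and> cmod (pert_log e w - pert_log e w0 - of_nat (k - N)) + K * cmod (snd ((step e ^^ (k - N)) z))
        \<le> K * cmod (snd z) + G * (\<Sum>i\<in>{N..<k}. 1 / (dist_end n i)\<^sup>2)
    \<and> cmod (fst ((step e ^^ (k - N)) z)) < d \<and> cmod (snd ((step e ^^ (k - N)) z)) < d
    \<and> cmod (pert_log e w - pert_log e w0 - of_nat (k - N)) + K * cmod (snd ((step e ^^ (k - N)) z))
        \<le> K * cmod (snd z) + G * (1 / (real N - 1) + 1 / real m)"
    (is "\<exists>w. ?P k w")
proof -
  have M100: "100 \<le> M" using M A by linarith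
  have dist: "M \<le> dist_end n k" if "N \<le> k" "k \<le> n - m" for k
    using that Nm unfolding dist_end_def by (auto simp: of_nat_diff)
  \<comment> \<open>The inverse square of a minimum is at most the sum of both inverse squares, and
    each of the two sums telescopes to a bound independent of \<open>n\<close>.\<close>
  have sums: "(\<Sum>i\<in>{N..<k}. 1 / (dist_end n i)\<^sup>2) \<le> 1 / (real N - 1) + 1 / real m"
    if "N \<le> k" "k \<le> n - m" for k
  proof -
    have m0: "0 < real m" "0 < m" "2 \<le> N" using Nm M100 by linarith+
    have "(\<Sum>i\<in>{N..<k}. 1 / (dist_end n i)\<^sup>2) \<le> (\<Sum>i\<in>{N..<k}. 1 / (real i)\<^sup>2 + 1 / (real n - real i)\<^sup>2)"
      by (intro sum_mono) (auto simp: dist_end_def min_def)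
    also have "\<dots> \<le> 1 / (real N - 1) + 1 / (real n - real k)"
      unfolding sum.distrib using that m0 Nm
      by (intro add_mono sum_inverse_squares_le sum_inverse_squares_reflected_le) auto
    also have "1 / (real n - real k) \<le> 1 / real m"
      using that m0 Nm by (intro divide_left_mono) (auto simp: of_nat_diff)
    finally show ?thesis by simp
  qed
  have e_small: "cmod e < d" if "cot_region e w (real n) (real k) A (dist_end n k)" "M \<le> dist_end n k" for w k
  proof -
    have "cmod e \<le> 2 / dist_end n k" using that(1) by (rule cot_region.cmod_e_le)
    also have "\<dots> \<le> 12 / M" using that(2) M100 by (intro frac_le) auto
    finally show ?thesis using M by simp
  qed
  have x_small: "cmod (- e * cos (e * w) / sin (e * w)) < d"
    if "cot_region e w (real n) (real k) A (dist_end n k)" "M \<le> dist_end n k" for w k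
  proof -
    have "cmod (- e * cos (e * w) / sin (e * w)) \<le> 12 / dist_end n k" using that(1) by (rule cot_region.cmod_x_le)
    also have "\<dots> \<le> 12 / M" using that(2) M100 by (intro frac_le) auto
    finally show ?thesis using M by simp
  qed
  have conclude: "?P k w"
    if k: "N \<le> k" "k \<le> n - m" and w: "cmod (w - of_nat k) \<le> dist_end n k / 4"
      and fst: "fst ((step e ^^ (k - N)) z) = - e * cos (e * w) / sin (e * w)"
      and E: "cmod (pert_log e w - pert_log e w0 - of_nat (k - N)) + K * cmod (snd ((step e ^^ (k - N)) z))
        \<le> K * cmod (snd z) + G * (\<Sum>i\<in>{N..<k}. 1 / (dist_end n i)\<^sup>2)" for k w
  proof -
    have D: "M \<le> dist_end n k" using dist k by simp
    have cr: "cot_region e w (real n) (real k) A (dist_end n k)"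
      using e phase A w D M M100 by (intro cot_region_nat) auto
    have "G * (\<Sum>i\<in>{N..<k}. 1 / (dist_end n i)\<^sup>2) \<le> G * (1 / (real N - 1) + 1 / real m)"
      using sums[OF k] G_pos by (intro mult_left_mono) auto
    then have E2: "cmod (pert_log e w - pert_log e w0 - of_nat (k - N)) + K * cmod (snd ((step e ^^ (k - N)) z))
        \<le> K * cmod (snd z) + G * (1 / (real N - 1) + 1 / real m)" using E by linarith
    have "K * cmod (snd ((step e ^^ (k - N)) z)) < K * d"
      using E2 small(2) norm_ge_zero[of "pert_log e w - pert_log e w0 - of_nat (k - N)"] by linarith
    then have "cmod (snd ((step e ^^ (k - N)) z)) < d" using K_bounds by simp
    moreover have "cmod (fst ((step e ^^ (k - N)) z)) < d" using x_small[OF cr D] fst by simp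
    ultimately show ?thesis using w fst E E2 by blast
  qed
  show ?thesis using k
  proof (induction k rule: dec_induct)
    case base
    have "dist_end n N = real N" using Nm by (simp add: dist_end_def)
    then have "?P N w0" using w0 x0 base Nm by (intro conclude) auto
    then show ?case by blast
  next
    case (step k)
    have k: "N \<le> k" "k \<le> n - m" "Suc k \<le> n - m" using step by auto
    then obtain w where P: "?P k w" using step.IH by auto
    define u where "u = (step e ^^ (k - N)) z"
    define x where "x = fst u"
    define y where "y = snd u"
    have u: "u = (x, y)" by (simp add: x_def y_def)
    have w: "cmod (w - of_nat k) \<le> dist_end n k / 4" and x: "x = - e * cos (e * w) / sin (e * w)"
      and E: "cmod (pert_log e w - pert_log e w0 - of_nat (k - N)) + K * cmod y
        \<le> K * cmod (snd z) + G * (\<Sum>i\<in>{N..<k}. 1 / (dist_end n i)\<^sup>2)"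
      and xd: "cmod x < d" and yd: "cmod y < d"
      using P by (auto simp: x_def y_def u_def)
    have D: "M \<le> dist_end n k" and D': "M \<le> dist_end n (Suc k)" using dist k by auto
    have DD: "dist_end n k \<le> dist_end n (Suc k) + 1" by (auto simp: dist_end_def)
    have cr: "cot_region e w (real n) (real k) A (dist_end n k)"
      using e phase A w D M M100 by (intro cot_region_nat) auto
    note ed = e_small[OF cr D]
    define w' where "w' = w + dw e x y"
    have dw1: "cmod (dw e x y - 1) \<le> 1/8" by (rule dw_bounds(3)[OF ed xd yd])
    have "w' - of_nat (Suc k) = (w - of_nat k) + (dw e x y - 1)" by (simp add: w'_def)
    then have "cmod (w' - of_nat (Suc k)) \<le> cmod (w - of_nat k) + cmod (dw e x y - 1)"
      by (metis norm_triangle_ineq)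
    \<comment> \<open>A provisional location: one step changes the offset by at most 1/8 and the
      distance to the end by at most 1. The fraction 1/3 already allows the logarithms to be split;
      the fraction 1/4 is recovered afterwards from the drift.\<close>
    also have "\<dots> \<le> dist_end n (Suc k) / 3" using w dw1 DD D' M100 by linarith
    finally have cr': "cot_region e w' (real n) (real (Suc k)) A (dist_end n (Suc k))"
      using e phase A D' M by (intro cot_region_nat) auto
    have sp: "0 < Re (sin (e * w))" and sp': "0 < Re (sin (e * w'))"
      using cot_region.Re_sin_pos[OF cr] cot_region.Re_sin_pos[OF cr'] by auto
    then have snz: "sin (e * w) \<noteq> 0" by auto
    note sc = step_cot[OF ed xd yd e snz x, folded w'_def]
    have Suc: "(step e ^^ (Suc k - N)) z = step e (x, y)"
      using k u by (simp add: Suc_diff_le u_def)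
    have "Ln (sin (e * w') / sin (e * w)) = Ln (sin (e * w')) - Ln (sin (e * w))"
      using sp sp' by (rule Ln_divide_right_half_plane)
    moreover have "sin (e * w') / sin (e * w) = ratio e x y" using sc(1) snz by simp
    ultimately have "Ln (sin (e * w')) = Ln (sin (e * w)) + Ln (ratio e x y)" by simp
    then have "pert_log e w' - pert_log e w - 1 = dw e x y + q * Ln (ratio e x y) - 1"
      unfolding pert_log_def by (simp add: w'_def distrib_left right_diff_distrib)
    then have ls: "cmod (pert_log e w' - pert_log e w - 1) \<le> B * (cmod y + ((cmod x)\<^sup>2 + (cmod e)\<^sup>2))"
      using log_step[OF ed xd yd] by simp
    define h where "h = (cmod x)\<^sup>2 + (cmod e)\<^sup>2"
    have h: "h \<le> 148 * (1 / (dist_end n k)\<^sup>2)"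
    proof -
      have "(cmod x)\<^sup>2 \<le> (12 / dist_end n k)\<^sup>2"
        unfolding x using cot_region.cmod_x_le[OF cr] by (intro power_mono) auto
      moreover have "(cmod e)\<^sup>2 \<le> (2 / dist_end n k)\<^sup>2"
        using cot_region.cmod_e_le[OF cr] by (intro power_mono) auto
      ultimately show ?thesis by (simp add: h_def power_divide)
    qed
    have "cmod (pert_log e w' - pert_log e w0 - (of_nat (k - N) + 1)) + K * cmod (snd (step e (x, y)))
      \<le> (K * cmod (snd z) + G * (\<Sum>i\<in>{N..<k}. 1 / (dist_end n i)\<^sup>2)) + B * (1 + K) * h"
      using ls snd_step_le[OF ed xd yd] E unfolding h_def by (rule drift_step)
    also have "B * (1 + K) * h \<le> B * (1 + K) * (148 * (1 / (dist_end n k)\<^sup>2))"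
      using h B_bounds K_bounds by (intro mult_left_mono) auto
    also have "\<dots> = G * (1 / (dist_end n k)\<^sup>2)" by (simp add: G_def)
    finally have E': "cmod (pert_log e w' - pert_log e w0 - of_nat (Suc k - N)) + K * cmod (snd ((step e ^^ (Suc k - N)) z))
        \<le> K * cmod (snd z) + G * (\<Sum>i\<in>{N..<Suc k}. 1 / (dist_end n i)\<^sup>2)"
      unfolding Suc using k by (simp add: Suc_diff_le distrib_left add.commute add.left_commute)
    have "G * (\<Sum>i\<in>{N..<Suc k}. 1 / (dist_end n i)\<^sup>2) \<le> G * (1 / (real N - 1) + 1 / real m)"
      using sums[of "Suc k"] k G_pos by (intro mult_left_mono) auto
    moreover have "0 \<le> K * cmod (snd ((step e ^^ (Suc k - N)) z))" using K_bounds by simp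
    ultimately have W1: "cmod (pert_log e w' - pert_log e w0 - of_nat (Suc k - N)) \<le> 1"
      using E' small(1) by linarith
    have "pert_log e w' - of_nat (Suc k)
       = (pert_log e w' - pert_log e w0 - of_nat (Suc k - N)) + (pert_log e w0 - of_nat N)"
      using k by (simp add: of_nat_diff)
    then have "cmod (pert_log e w' - of_nat (Suc k))
        \<le> cmod (pert_log e w' - pert_log e w0 - of_nat (Suc k - N)) + cmod (pert_log e w0 - of_nat N)"
      by (metis norm_triangle_ineq)
    then have W2: "cmod (pert_log e w' - of_nat (Suc k)) \<le> 1 + H" using W1 W0 by linarith
    have "cmod (q * (Ln (sin (e * w')) - Ln e)) \<le> C * (ln (dist_end n (Suc k)) + 7)"
      unfolding norm_mult using cot_region.log_bound[OF cr'] q_le C_ge_1 by (intro mult_mono) auto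
    moreover have "w' - of_nat (Suc k) = (pert_log e w' - of_nat (Suc k)) - q * (Ln (sin (e * w')) - Ln e)"
      by (simp add: pert_log_def)
    then have "cmod (w' - of_nat (Suc k)) \<le> cmod (pert_log e w' - of_nat (Suc k)) + cmod (q * (Ln (sin (e * w')) - Ln e))"
      by (metis norm_triangle_ineq4)
    ultimately have "cmod (w' - of_nat (Suc k)) \<le> (1 + H) + C * (ln (dist_end n (Suc k)) + 7)"
      using W2 by linarith
    also have "\<dots> \<le> dist_end n (Suc k) / 4" using far[OF D'] by simp
    finally have "?P (Suc k) w'"
      using k E' sc(3) Suc by (intro conclude) auto
    then show ?case by blast
  qed
qed

end

section \<open>Unperturbed orbits\<close>

text \<open>The error is split between the two indices because for backward orbits the weight K |y|
  enters at the later index, where the forward iteration starts.\<close>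

lemma convergent_if_tails_small:
  fixes V :: "nat \<Rightarrow> 'a::banach"
  assumes "\<And>k l. i \<le> k \<Longrightarrow> k \<le> l \<Longrightarrow> norm (V l - V k) \<le> f k + g l"
    and "f \<longlonglongrightarrow> 0" "g \<longlonglongrightarrow> (0::real)"
  shows "convergent V"
proof (rule Cauchy_convergent, rule metric_CauchyI)
  fix e :: real assume e: "0 < e"
  have "\<forall>\<^sub>F n in sequentially. f n < e/2 \<and> g n < e/2"
    using order_tendstoD(2)[OF assms(2), of "e/2"] order_tendstoD(2)[OF assms(3), of "e/2"] e
    by (auto intro: eventually_conj)
  then obtain N where N: "\<And>n. N \<le> n \<Longrightarrow> f n < e/2 \<and> g n < e/2"
    by (auto simp: eventually_sequentially)
  have *: "norm (V l - V k) < e" if "max i N \<le> k" "k \<le> l" for k l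
    using assms(1)[of k l] N[of k] N[of l] that by simp
  show "\<exists>M. \<forall>m\<ge>M. \<forall>n\<ge>M. dist (V m) (V n) < e"
  proof (intro exI allI impI)
    fix m n assume "max i N \<le> m" "max i N \<le> n"
    then show "dist (V m) (V n) < e"
      using *[of m n] *[of n m] by (cases "m \<le> n") (auto simp: dist_norm norm_minus_commute)
  qed
qed

lemma Ln_inverse_right_half_plane: "0 < Re z \<Longrightarrow> Ln (1 / z) = - Ln z"
  using Ln_inverse[of z] by (auto simp: inverse_eq_divide complex_nonpos_Reals_iff)

text \<open>On the right half-plane \<open>Ln\<close> changes sign under inversion. The incoming
  coordinate thus becomes w + q Ln w with w = - 1 / x, the form in which it is the limit of
  \<open>pert_log\<close>.\<close>

lemma w_in_eq:
  assumes "x \<noteq> 0" "0 < Re (- 1 / x)"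
  shows "w_in q (x, y) = - 1 / x + q * Ln (- 1 / x)"
proof -
  have "- x = 1 / (- 1 / x)" using assms by simp
  then have "Ln (- x) = - Ln (- 1 / x)" using Ln_inverse_right_half_plane[OF assms(2)] by metis
  then show ?thesis by (simp add: w_in_def)
qed

lemma w_out_eq:
  assumes "x \<noteq> 0" "0 < Re (1 / x)"
  shows "w_out q (x, y) = - 1 / x + q * Ln (1 / x)"
proof -
  have "x = 1 / (1 / x)" using assms by simp
  then have "Ln x = - Ln (1 / x)" using Ln_inverse_right_half_plane[OF assms(2)] by metis
  then show ?thesis by (simp add: w_out_def)
qed

lemma near_real:
  fixes w :: complex and t :: real
  assumes "cmod (w - of_real t) \<le> t / 4" "0 < t"
  shows "0 < Re w" "3/4 * t \<le> cmod w" "cmod (1 / w) \<le> 4 / (3 * t)" "(cmod (1 / w))\<^sup>2 \<le> 2 / t\<^sup>2"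
proof -
  have "\<bar>Re w - t\<bar> \<le> t / 4" using abs_Re_le_cmod[of "w - of_real t"] assms by simp
  then have "3/4 * t \<le> Re w" by linarith
  then show "0 < Re w" and w: "3/4 * t \<le> cmod w" using assms complex_Re_le_cmod[of w] by linarith+
  then have "cmod (1 / w) \<le> 1 / (3/4 * t)"
    unfolding norm_divide norm_one using assms w by (intro divide_left_mono mult_pos_pos) linarith+
  then show 1: "cmod (1 / w) \<le> 4 / (3 * t)" by simp
  have "(cmod (1 / w))\<^sup>2 \<le> (4 / (3 * t))\<^sup>2" using 1 by (intro power_mono) auto
  also have "\<dots> \<le> 2 / t\<^sup>2" using assms by (simp add: power_divide power_mult_distrib field_simps)
  finally show "(cmod (1 / w))\<^sup>2 \<le> 2 / t\<^sup>2" .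
qed

lemma eventually_le_linear: "\<forall>\<^sub>F i in sequentially. c \<le> real i / 8"
proof -
  have "\<forall>\<^sub>F i in sequentially. 8 * c \<le> real i"
    using filterlim_real_sequentially by (auto simp: filterlim_at_top)
  then show ?thesis by eventually_elim simp
qed

text \<open>The increments contribute at most i / 8 to the deviation, and the initial offset is
  eventually below i / 16. The total 3/16 stays under the tolerance 1/4.\<close>

lemma eventually_near_index:
  fixes w :: "nat \<Rightarrow> complex"
  assumes s: "\<And>i. i0 \<le> i \<Longrightarrow> cmod (w (Suc i) - w i - 1) \<le> 1/8"
  shows "\<forall>\<^sub>F i in sequentially. cmod (w i - of_nat i) \<le> 3/16 * real i"
proof -
  have dr: "cmod (w l - of_nat l) \<le> cmod (w i0 - of_nat i0) + real (l - i0) / 8" if "i0 \<le> l" for l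
    using that
  proof (induction l rule: dec_induct)
    case (step l)
    have "w (Suc l) - of_nat (Suc l) = (w (Suc l) - w l - 1) + (w l - of_nat l)" by simp
    then have "cmod (w (Suc l) - of_nat (Suc l)) \<le> cmod (w (Suc l) - w l - 1) + cmod (w l - of_nat l)"
      by (metis norm_triangle_ineq)
    moreover have "real (Suc l - i0) / 8 = real (l - i0) / 8 + 1/8"
      using step by (simp add: Suc_diff_le add_divide_distrib)
    ultimately show ?case using step s[of l] by linarith
  qed simp
  show ?thesis
    using eventually_ge_at_top[of i0] eventually_le_linear[of "2 * cmod (w i0 - of_nat i0)"]
  proof eventually_elim
    case (elim i)
    have "real (i - i0) / 8 \<le> real i / 8" by simp
    then show ?case using dr[OF elim(1)] elim(2) by linarith
  qed
qed

context semiparabolic_model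
begin

lemma eventually_in_polydisc:
  assumes "X \<longlonglongrightarrow> (0::complex)" "Y \<longlonglongrightarrow> (0::complex)"
  shows "\<forall>\<^sub>F i in sequentially. cmod (X i) < d \<and> cmod (Y i) < d"
  using tendstoD[OF assms(1) d_pos] tendstoD[OF assms(2) d_pos] by (auto elim: eventually_elim2)

text \<open>Rough asymptotics without the logarithmic correction. They already give |x| = O(1 / i),
  which is the summability needed for the finer convergence.\<close>

lemma forward_speed:
  assumes rec: "\<forall>\<^sub>F i in sequentially. (X (Suc i), Y (Suc i)) = step 0 (X i, Y i)"
    and nz: "\<forall>\<^sub>F i in sequentially. X i \<noteq> 0" and lim: "X \<longlonglongrightarrow> 0" "Y \<longlonglongrightarrow> 0"
  shows "\<forall>\<^sub>F i in sequentially. cmod (- 1 / X i - of_nat i) \<le> 3/16 * real i"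
proof -
  define w where "w i = - 1 / X i" for i
  have "\<forall>\<^sub>F i in sequentially. (X (Suc i), Y (Suc i)) = step 0 (X i, Y i) \<and> X i \<noteq> 0 \<and> cmod (X i) < d \<and> cmod (Y i) < d"
    using rec nz eventually_in_polydisc[OF lim] by eventually_elim auto
  then obtain i0 where i0: "\<And>i. i0 \<le> i \<Longrightarrow> (X (Suc i), Y (Suc i)) = step 0 (X i, Y i) \<and> X i \<noteq> 0 \<and> cmod (X i) < d \<and> cmod (Y i) < d"
    by (auto simp: eventually_sequentially)
  have s: "cmod (w (Suc i) - w i - 1) \<le> 1/8" if "i0 \<le> i" for i
  proof -
    have "w (Suc i) = w i + dw 0 (X i) (Y i)"
      using i0[OF that] step_zero(2)[of "X i" "Y i"] by (metis fst_conv w_def)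
    then show ?thesis using dw_bounds(3)[of 0 "X i" "Y i"] i0[OF that] d_pos by simp
  qed
  from eventually_near_index[of i0 w, OF s] show ?thesis by (simp add: w_def)
qed

text \<open>Needed because \<open>fatou_in\<close> is defined by \<open>lim\<close>, which has a
  meaningful value only for convergent sequences. The tails of W - i are bounded by K |y| plus O(1 /
  k), and both tend to 0.\<close>

lemma forward_Fatou_convergent:
  assumes rec: "\<forall>\<^sub>F i in sequentially. (X (Suc i), Y (Suc i)) = step 0 (X i, Y i)"
    and nz: "\<forall>\<^sub>F i in sequentially. X i \<noteq> 0" and lim: "X \<longlonglongrightarrow> 0" "Y \<longlonglongrightarrow> 0"
  shows "convergent (\<lambda>i. w_in q (X i, Y i) - of_nat i)"
proof -
  define w where "w i = - 1 / X i" for i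
  define W where "W i = w i + q * Ln (w i)" for i
  have "\<forall>\<^sub>F i in sequentially. (X (Suc i), Y (Suc i)) = step 0 (X i, Y i) \<and> X i \<noteq> 0 \<and> cmod (X i) < d \<and> cmod (Y i) < d
      \<and> cmod (w i - of_nat i) \<le> real i / 4 \<and> 2 \<le> i"
    unfolding w_def using rec nz eventually_in_polydisc[OF lim] forward_speed[OF assms] eventually_ge_at_top[of 2]
    by eventually_elim auto
  then obtain i0 where i0: "\<And>i. i0 \<le> i \<Longrightarrow> (X (Suc i), Y (Suc i)) = step 0 (X i, Y i) \<and> X i \<noteq> 0 \<and> cmod (X i) < d \<and> cmod (Y i) < d
      \<and> cmod (w i - of_nat i) \<le> real i / 4 \<and> 2 \<le> i"
    by (auto simp: eventually_sequentially)
  have re: "0 < Re (w i)" and xsq: "(cmod (X i))\<^sup>2 \<le> 2 / (real i)\<^sup>2" if "i0 \<le> i" for i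
    using near_real[of "w i" "real i"] i0[OF that] by (auto simp: w_def norm_divide)
  have W: "W i = w_in q (X i, Y i)" if "i0 \<le> i" for i
    using w_in_eq[of "X i"] re[OF that] i0[OF that] by (simp add: W_def w_def)
  have dW: "cmod (W (Suc i) - W i - 1) \<le> B * (cmod (Y i) + 2 / (real i)\<^sup>2)"
    and dY: "cmod (Y (Suc i)) \<le> lam * cmod (Y i) + B * (2 / (real i)\<^sup>2)" if "i0 \<le> i" for i
  proof -
    have i: "(X (Suc i), Y (Suc i)) = step 0 (X i, Y i)" "X i \<noteq> 0" "cmod (X i) < d" "cmod (Y i) < d" "cmod 0 < d"
      using i0[OF that] d_pos by auto
    have X': "X (Suc i) = fst (step 0 (X i, Y i))" "Y (Suc i) = snd (step 0 (X i, Y i))"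
      using i(1) by (metis fst_conv, metis snd_conv)
    have "Ln (w (Suc i)) = Ln (w i) + Ln (ratio 0 (X i) (Y i))"
      using step_zero(3)[OF i(3,4,2)] Ln_divide_right_half_plane[OF re[OF that] re[of "Suc i"]] that
      by (simp add: w_def X'(1))
    moreover have "w (Suc i) = w i + dw 0 (X i) (Y i)"
      using step_zero(2)[OF i(3,4,2)] by (simp add: w_def X'(1))
    ultimately have "W (Suc i) - W i - 1 = dw 0 (X i) (Y i) + q * Ln (ratio 0 (X i) (Y i)) - 1"
      by (simp add: W_def distrib_left)
    then have "cmod (W (Suc i) - W i - 1) \<le> B * (cmod (Y i) + ((cmod (X i))\<^sup>2 + (cmod 0)\<^sup>2))"
      using log_step[OF i(5,3,4)] by simp
    also have "\<dots> \<le> B * (cmod (Y i) + 2 / (real i)\<^sup>2)"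
      using xsq[OF that] B_bounds by (intro mult_left_mono) auto
    finally show "cmod (W (Suc i) - W i - 1) \<le> B * (cmod (Y i) + 2 / (real i)\<^sup>2)" .
    have "cmod (Y (Suc i)) \<le> lam * cmod (Y i) + B * ((cmod (X i))\<^sup>2 + (cmod 0)\<^sup>2)"
      unfolding X'(2) by (rule snd_step_le[OF i(5,3,4)])
    also have "\<dots> \<le> lam * cmod (Y i) + B * (2 / (real i)\<^sup>2)"
      using xsq[OF that] B_bounds by (intro add_left_mono mult_left_mono) auto
    finally show "cmod (Y (Suc i)) \<le> lam * cmod (Y i) + B * (2 / (real i)\<^sup>2)" .
  qed
  have "convergent (\<lambda>i. W i - of_nat i)"
  proof (rule convergent_if_tails_small)
    fix k l assume kl: "i0 \<le> k" "k \<le> l"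
    have k2: "2 \<le> k" using i0[OF kl(1)] by simp
    have "cmod (W l - W k - of_nat (l - k)) + K * cmod (Y l) \<le> K * cmod (Y k) + B * (1 + K) * (\<Sum>i\<in>{k..<l}. 2 / (real i)\<^sup>2)"
      using kl dW dY by (intro drift) auto
    also have "(\<Sum>i\<in>{k..<l}. 2 / (real i)\<^sup>2) = 2 * (\<Sum>i\<in>{k..<l}. 1 / (real i)\<^sup>2)"
      by (simp add: sum_distrib_left)
    also have "B * (1 + K) * (2 * (\<Sum>i\<in>{k..<l}. 1 / (real i)\<^sup>2)) \<le> B * (1 + K) * (2 * (1 / (real k - 1)))"
      using sum_inverse_squares_le[OF kl(2) k2] B_bounds K_bounds by (intro mult_left_mono) auto
    also have "1 / (real k - 1) \<le> 2 / real k" using k2 by (simp add: field_simps)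
    then have "B * (1 + K) * (2 * (1 / (real k - 1))) \<le> B * (1 + K) * (2 * (2 / real k))"
      using B_bounds K_bounds by (intro mult_left_mono) auto
    finally have "cmod (W l - W k - of_nat (l - k)) + K * cmod (Y l) \<le> K * cmod (Y k) + B * (1 + K) * 4 / real k"
      by simp
    moreover have "0 \<le> K * cmod (Y l)" using K_bounds by simp
    moreover have "W l - W k - of_nat (l - k) = (W l - of_nat l) - (W k - of_nat k)"
      using kl by (simp add: of_nat_diff)
    ultimately show "norm ((W l - of_nat l) - (W k - of_nat k)) \<le> (K * cmod (Y k) + B * (1 + K) * 4 / real k) + 0"
      by simp
  next
    show "(\<lambda>k. K * cmod (Y k) + B * (1 + K) * 4 / real k) \<longlonglongrightarrow> 0"
      using tendsto_add[OF tendsto_mult_right_zero[OF tendsto_norm_zero[OF lim(2)], of K] lim_const_over_n] by simp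
  qed auto
  moreover have "\<forall>\<^sub>F i in sequentially. W i - of_nat i = w_in q (X i, Y i) - of_nat i"
    using eventually_ge_at_top[of i0] by eventually_elim (simp add: W)
  ultimately show ?thesis by (rule convergent_cong[THEN iffD1, rotated])
qed

lemma backward_speed:
  assumes rec: "\<forall>\<^sub>F i in sequentially. (X i, Y i) = step 0 (X (Suc i), Y (Suc i))"
    and nz: "\<forall>\<^sub>F i in sequentially. X i \<noteq> 0" and lim: "X \<longlonglongrightarrow> 0" "Y \<longlonglongrightarrow> 0"
  shows "\<forall>\<^sub>F i in sequentially. cmod (1 / X i - of_nat i) \<le> real i / 4"
proof -
  define w where "w i = 1 / X i" for i
  have "\<forall>\<^sub>F i in sequentially. (X i, Y i) = step 0 (X (Suc i), Y (Suc i)) \<and> X i \<noteq> 0 \<and> cmod (X i) < d \<and> cmod (Y i) < d"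
    using rec nz eventually_in_polydisc[OF lim] by eventually_elim auto
  then obtain i0 where i0: "\<And>i. i0 \<le> i \<Longrightarrow> (X i, Y i) = step 0 (X (Suc i), Y (Suc i)) \<and> X i \<noteq> 0 \<and> cmod (X i) < d \<and> cmod (Y i) < d"
    by (auto simp: eventually_sequentially)
  have s: "cmod (w (Suc i) - w i - 1) \<le> 1/8" if "i0 \<le> i" for i
  proof -
    have S: "i0 \<le> Suc i" using that by simp
    have "fst (step 0 (X (Suc i), Y (Suc i))) = X i" using i0[OF that] by (metis fst_conv)
    then have "- w i = - w (Suc i) + dw 0 (X (Suc i)) (Y (Suc i))"
      using i0[OF S] step_zero(2)[of "X (Suc i)" "Y (Suc i)"] by (simp add: w_def)
    then have "w (Suc i) - w i - 1 = dw 0 (X (Suc i)) (Y (Suc i)) - 1" by (simp add: algebra_simps)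
    then show ?thesis using dw_bounds(3)[of 0 "X (Suc i)" "Y (Suc i)"] i0[OF S] d_pos by simp
  qed
  from eventually_near_index[of i0 w, OF s] show ?thesis by (auto simp: w_def elim: eventually_mono)
qed

lemma backward_Fatou_convergent:
  assumes rec: "\<forall>\<^sub>F i in sequentially. (X i, Y i) = step 0 (X (Suc i), Y (Suc i))"
    and nz: "\<forall>\<^sub>F i in sequentially. X i \<noteq> 0" and lim: "X \<longlonglongrightarrow> 0" "Y \<longlonglongrightarrow> 0"
  shows "convergent (\<lambda>i. w_out q (X i, Y i) + of_nat i)"
proof -
  define w where "w i = 1 / X i" for i
  define W where "W i = - w i + q * Ln (w i)" for i
  have "\<forall>\<^sub>F i in sequentially. (X i, Y i) = step 0 (X (Suc i), Y (Suc i)) \<and> X i \<noteq> 0 \<and> cmod (X i) < d \<and> cmod (Y i) < d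
      \<and> cmod (w i - of_nat i) \<le> real i / 4 \<and> 2 \<le> i"
    unfolding w_def using rec nz eventually_in_polydisc[OF lim] backward_speed[OF assms] eventually_ge_at_top[of 2]
    by eventually_elim auto
  then obtain i0 where i0: "\<And>i. i0 \<le> i \<Longrightarrow> (X i, Y i) = step 0 (X (Suc i), Y (Suc i)) \<and> X i \<noteq> 0 \<and> cmod (X i) < d \<and> cmod (Y i) < d
      \<and> cmod (w i - of_nat i) \<le> real i / 4 \<and> 2 \<le> i"
    by (auto simp: eventually_sequentially)
  have re: "0 < Re (w i)" and xsq: "(cmod (X i))\<^sup>2 \<le> 2 / (real i)\<^sup>2" if "i0 \<le> i" for i
    using near_real[of "w i" "real i"] i0[OF that] by (auto simp: w_def norm_divide)
  have W: "W i = w_out q (X i, Y i)" if "i0 \<le> i" for i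
  proof -
    have "X i \<noteq> 0" using i0[OF that] by blast
    then show ?thesis using w_out_eq[of "X i" q "Y i"] re[OF that] by (simp add: W_def w_def)
  qed
  have dW: "cmod (W i - W (Suc i) - 1) \<le> B * (cmod (Y (Suc i)) + 2 / (real (Suc i))\<^sup>2)"
    and dY: "cmod (Y i) \<le> lam * cmod (Y (Suc i)) + B * (2 / (real (Suc i))\<^sup>2)" if "i0 \<le> i" for i
  proof -
    have S: "i0 \<le> Suc i" using that by simp
    have i: "(X i, Y i) = step 0 (X (Suc i), Y (Suc i))" "X (Suc i) \<noteq> 0" "cmod (X (Suc i)) < d" "cmod (Y (Suc i)) < d" "cmod 0 < d"
      using i0[OF that] i0[OF S] d_pos by auto
    have X': "X i = fst (step 0 (X (Suc i), Y (Suc i)))" "Y i = snd (step 0 (X (Suc i), Y (Suc i)))"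
      using i(1) by (metis fst_conv, metis snd_conv)
    have "w i / w (Suc i) = ratio 0 (X (Suc i)) (Y (Suc i))"
      using step_zero(3)[OF i(3,4,2)] by (simp add: w_def X'(1))
    then have "Ln (w i) = Ln (w (Suc i)) + Ln (ratio 0 (X (Suc i)) (Y (Suc i)))"
      using Ln_divide_right_half_plane[OF re[OF S] re[OF that]] by simp
    moreover have "- w i = - w (Suc i) + dw 0 (X (Suc i)) (Y (Suc i))"
      using step_zero(2)[OF i(3,4,2)] by (simp add: w_def X'(1))
    ultimately have "W i - W (Suc i) - 1 = dw 0 (X (Suc i)) (Y (Suc i)) + q * Ln (ratio 0 (X (Suc i)) (Y (Suc i))) - 1"
      by (simp add: W_def distrib_left)
    then have "cmod (W i - W (Suc i) - 1) \<le> B * (cmod (Y (Suc i)) + ((cmod (X (Suc i)))\<^sup>2 + (cmod 0)\<^sup>2))"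
      using log_step[OF i(5,3,4)] by simp
    also have "\<dots> \<le> B * (cmod (Y (Suc i)) + 2 / (real (Suc i))\<^sup>2)"
      using xsq[OF S] B_bounds by (intro mult_left_mono) auto
    finally show "cmod (W i - W (Suc i) - 1) \<le> B * (cmod (Y (Suc i)) + 2 / (real (Suc i))\<^sup>2)" .
    have "cmod (Y i) \<le> lam * cmod (Y (Suc i)) + B * ((cmod (X (Suc i)))\<^sup>2 + (cmod 0)\<^sup>2)"
      unfolding X'(2) by (rule snd_step_le[OF i(5,3,4)])
    also have "\<dots> \<le> lam * cmod (Y (Suc i)) + B * (2 / (real (Suc i))\<^sup>2)"
      using xsq[OF S] B_bounds by (intro add_left_mono mult_left_mono) auto
    finally show "cmod (Y i) \<le> lam * cmod (Y (Suc i)) + B * (2 / (real (Suc i))\<^sup>2)" .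
  qed
  have "convergent (\<lambda>i. W i + of_nat i)"
  proof (rule convergent_if_tails_small)
    fix k l assume kl: "i0 \<le> k" "k \<le> l"
    have k2: "2 \<le> k" using i0[OF kl(1)] by simp
    have Sd: "Suc (l - Suc j) = l - j" "i0 \<le> l - Suc j" "real (l - j) = real l - real j" if "j < l - k" for j
      using that kl by (auto simp: of_nat_diff)
    \<comment> \<open>Read from index \<open>l\<close> downwards the orbit is a forward orbit, with
      \<open>j\<close> counting its steps. In this direction y contracts, so \<open>drift\<close>
      applies.\<close>
    have "cmod (W (l - (l - k)) - W (l - 0) - of_nat ((l - k) - 0)) + K * cmod (Y (l - (l - k)))
       \<le> K * cmod (Y (l - 0)) + B * (1 + K) * (\<Sum>j\<in>{0..<l - k}. 2 / (real l - real j)\<^sup>2)"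
    proof (rule drift[where W = "\<lambda>j. W (l - j)" and Y = "\<lambda>j. cmod (Y (l - j))"])
      fix j assume "j < l - k"
      note Sd = Sd[OF this]
      show "cmod (W (l - Suc j) - W (l - j) - 1) \<le> B * (cmod (Y (l - j)) + 2 / (real l - real j)\<^sup>2)"
        using dW[OF Sd(2)] unfolding Sd(1) Sd(3) .
      show "cmod (Y (l - Suc j)) \<le> lam * cmod (Y (l - j)) + B * (2 / (real l - real j)\<^sup>2)"
        using dY[OF Sd(2)] unfolding Sd(1) Sd(3) .
    qed simp
    also have "(\<Sum>j\<in>{0..<l - k}. 2 / (real l - real j)\<^sup>2) = 2 * (\<Sum>j\<in>{0..<l - k}. 1 / (real l - real j)\<^sup>2)"
      by (simp add: sum_distrib_left)
    also have "B * (1 + K) * (2 * (\<Sum>j\<in>{0..<l - k}. 1 / (real l - real j)\<^sup>2))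
      \<le> B * (1 + K) * (2 * (1 / (real l - real (l - k))))"
      using sum_inverse_squares_reflected_le[of 0 "l - k" l] kl k2 B_bounds K_bounds by (intro mult_left_mono) auto
    also have "real l - real (l - k) = real k" using kl by (simp add: of_nat_diff)
    finally have "cmod (W k - W l - of_nat (l - k)) + K * cmod (Y k) \<le> K * cmod (Y l) + B * (1 + K) * 2 / real k"
      using kl by simp
    moreover have "0 \<le> K * cmod (Y k)" using K_bounds by simp
    moreover have "W k - W l - of_nat (l - k) = (W k + of_nat k) - (W l + of_nat l)"
      using kl by (simp add: of_nat_diff)
    ultimately show "norm ((W l + of_nat l) - (W k + of_nat k)) \<le> B * (1 + K) * 2 / real k + K * cmod (Y l)"
      by (simp add: norm_minus_commute)
  next
    show "(\<lambda>k. K * cmod (Y k)) \<longlonglongrightarrow> 0"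
      using tendsto_mult_right_zero[OF tendsto_norm_zero[OF lim(2)], of K] by simp
  qed (rule lim_const_over_n)
  moreover have "\<forall>\<^sub>F i in sequentially. W i + of_nat i = w_out q (X i, Y i) + of_nat i"
    using eventually_ge_at_top[of i0] by eventually_elim (simp add: W)
  ultimately show ?thesis by (rule convergent_cong[THEN iffD1, rotated])
qed

end

section \<open>Uniqueness of a backward orbit with given outgoing coordinate\<close>

lemma cmod_Ln_diff_le:
  fixes t :: real
  assumes "0 < t" "cmod (u - of_real t) \<le> t / 4" "cmod (v - of_real t) \<le> t / 4"
  shows "cmod (Ln u - Ln v) \<le> 4 / (3 * t) * cmod (u - v)"
proof (rule field_differentiable_bound[where S = "cball (of_real t) (t / 4)" and f' = "\<lambda>z. 1 / z"])
  fix z :: complex assume "z \<in> cball (of_real t) (t / 4)"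
  then have z: "cmod (z - of_real t) \<le> t / 4" by (simp add: dist_norm norm_minus_commute)
  show "(Ln has_field_derivative 1 / z) (at z within cball (of_real t) (t / 4))"
    using near_real(1)[OF z] assms(1)
    by (auto simp: complex_nonpos_Reals_iff inverse_eq_divide[symmetric] intro!: has_field_derivative_at_within has_field_derivative_Ln)
  show "cmod (1 / z) \<le> 4 / (3 * t)" using near_real(3)[OF z] assms(1) by simp
qed (use assms in \<open>auto simp: dist_norm norm_minus_commute\<close>)

text \<open>Comparing two orbits requires differences of the coefficients instead of their sizes.
  The comparison concerns only backward orbits of the unperturbed map, hence the parameter
  0.\<close>

locale semiparabolic_lipschitz = semiparabolic_model +
  assumes a_lipschitz: "\<And>x x' y y'. cmod x < d \<Longrightarrow> cmod x' < d \<Longrightarrow> cmod y < d \<Longrightarrow> cmod y' < d \<Longrightarrow>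
      cmod (a 0 x y - a 0 x' y') \<le> C * (cmod (x - x') + cmod (y - y'))"
    and \<beta>_lipschitz: "\<And>x x' y y'. cmod x < d \<Longrightarrow> cmod x' < d \<Longrightarrow> cmod y < d \<Longrightarrow> cmod y' < d \<Longrightarrow>
      cmod (\<beta> 0 x y - \<beta> 0 x' y') \<le> C * (cmod (x - x') + cmod (y - y'))"
    and b_lipschitz: "\<And>x x'. cmod x < d \<Longrightarrow> cmod x' < d \<Longrightarrow> cmod (b 0 x - b 0 x') \<le> C * cmod (x - x')"
begin

lemma speed_lipschitz:
  assumes "cmod x < d" "cmod x' < d" "cmod y < d" "cmod y' < d"
  shows "cmod (speed 0 x y - speed 0 x' y') \<le> 3 * C * (cmod (x - x') + cmod (y - y'))"
proof -
  define A where "A = a 0 x y"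
  define A' where "A' = a 0 x' y'"
  have e: "cmod 0 < d" using d_pos by simp
  have den: "98/100 \<le> cmod (1 + x * A)" "98/100 \<le> cmod (1 + x' * A')"
    using speed_bounds(1)[OF e assms(1,3)] speed_bounds(1)[OF e assms(2,4)] by (auto simp: A_def A'_def)
  then have nz: "1 + x * A \<noteq> 0" "1 + x' * A' \<noteq> 0" by auto
  have A_le: "cmod (a 0 x y) \<le> 11/10" if "cmod x < d" "cmod y < d" for x y
    using norm_triangle_ineq[of "a 0 x y - 1" 1] speed_bounds(9)[OF e that] speed_bounds(7)[OF e that] by simp
  define N where "N = (A - A') + A * A' * (x' - x)"
  have eq: "speed 0 x y - speed 0 x' y' = N / ((1 + x * A) * (1 + x' * A'))"
    unfolding speed_def A_def[symmetric] A'_def[symmetric] N_def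
    using nz by (simp add: field_simps)
  have "cmod N \<le> cmod (A - A') + cmod (A * A' * (x' - x))"
    unfolding N_def by (rule norm_triangle_ineq)
  also have "cmod (A * A' * (x' - x)) \<le> 11/10 * (11/10) * cmod (x - x')"
    unfolding norm_mult norm_minus_commute[of x'] using A_le assms
    by (intro mult_mono) (auto simp: A_def A'_def)
  also have "\<dots> \<le> 121/100 * (C * (cmod (x - x') + cmod (y - y')))"
  proof -
    have "1 * cmod (x - x') \<le> C * (cmod (x - x') + cmod (y - y'))"
      using C_ge_1 by (intro mult_mono) auto
    then show ?thesis by simp
  qed
  also have "cmod (A - A') \<le> C * (cmod (x - x') + cmod (y - y'))"
    unfolding A_def A'_def using assms by (intro a_lipschitz)
  finally have N: "cmod N \<le> 221/100 * (C * (cmod (x - x') + cmod (y - y')))" by simp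
  have "98/100 * (98/100) \<le> cmod (1 + x * A) * cmod (1 + x' * A')"
    using den by (intro mult_mono) auto
  then have "cmod (speed 0 x y - speed 0 x' y') \<le> 221/100 * (C * (cmod (x - x') + cmod (y - y'))) / (98/100 * (98/100))"
    unfolding eq norm_divide norm_mult using N C_ge_1 by (intro frac_le) auto
  also have "\<dots> \<le> 3 * C * (cmod (x - x') + cmod (y - y'))"
    using C_ge_1 by (simp add: field_simps)
  finally show ?thesis .
qed

text \<open>Chosen like \<open>K\<close>, with the Lipschitz constant \<open>3 * C\<close> of
  \<open>speed\<close> in place of \<open>B\<close>.\<close>

definition K' :: real where "K' = 3 * C / (1 - lam)"

lemma K'_bounds: "3 * C \<le> K'" "1 \<le> K'" "3 * C + K' * lam = K'"
proof -
  have l: "0 < 1 - lam" using lam by simp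
  show "3 * C + K' * lam = K'" using l by (simp add: K'_def field_simps)
  have "3 * C * (1 - lam) \<le> 3 * C * 1" using C_ge_1 lam by (intro mult_left_mono) auto
  then show "3 * C \<le> K'" using l by (simp add: K'_def pos_le_divide_eq)
  then show "1 \<le> K'" using C_ge_1 by simp
qed

text \<open>The map translates 1 / x by - \<open>speed\<close>, and |x - x'| = |x x'| |1 / x - 1 /
  x'| damps the dependence on x by 1 / t^2. The dependence of \<open>speed\<close> on y is not
  damped; the contraction absorbs it through the weight \<open>K'\<close>.\<close>

lemma step_expansion:
  assumes xy: "cmod x < d" "cmod x' < d" "cmod y < d" "cmod y' < d" and nz: "x \<noteq> 0" "x' \<noteq> 0"
    and t: "0 < t" "cmod x \<le> 4 / (3 * t)" "cmod x' \<le> 4 / (3 * t)"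
  defines "u \<equiv> step 0 (x, y)" and "u' \<equiv> step 0 (x', y')"
  shows "cmod (1 / fst u - 1 / fst u') + K' * cmod (snd u - snd u')
    \<le> (1 + (6 * C + 8 * C * K') / t\<^sup>2) * (cmod (1 / x - 1 / x') + K' * cmod (y - y'))"
proof -
  define D where "D = cmod (1 / x - 1 / x')"
  define E where "E = cmod (y - y')"
  define h where "h = 2 / t\<^sup>2"
  have h0: "0 \<le> h" "0 \<le> D" "0 \<le> E" by (auto simp: h_def D_def E_def)
  have sq: "4 / (3 * t) * (4 / (3 * t)) \<le> h" using t by (simp add: h_def field_simps power2_eq_square)
  have dx: "cmod (x - x') \<le> h * D"
  proof -
    have "x - x' = - (x * x' * (1 / x - 1 / x'))" using nz by (simp add: field_simps)
    then have "cmod (x - x') = cmod x * cmod x' * D" by (simp add: norm_mult D_def)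
    also have "\<dots> \<le> (4 / (3 * t) * (4 / (3 * t))) * D"
      using t h0 by (intro mult_right_mono mult_mono) auto
    also have "\<dots> \<le> h * D" using sq h0 by (intro mult_right_mono) auto
    finally show ?thesis .
  qed
  have xsq: "(cmod x)\<^sup>2 \<le> h"
  proof -
    have "cmod x * cmod x \<le> 4 / (3 * t) * (4 / (3 * t))" using t by (intro mult_mono) auto
    then show ?thesis using sq by (simp add: power2_eq_square)
  qed
  have dd: "cmod x \<le> 1/100" "cmod x' \<le> 1/100" "cmod y' \<le> 1/100" using xy d_le by auto
  have s: "1 / fst u = 1 / x - speed 0 x y" "1 / fst u' = 1 / x' - speed 0 x' y'"
    using step_zero(2)[OF xy(1,3) nz(1)] step_zero(2)[OF xy(2,4) nz(2)]
    by (auto simp: u_def u'_def dw_def algebra_simps add_eq_0_iff dest!: arg_cong[of _ _ uminus])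
  have "1 / fst u - 1 / fst u' = (1 / x - 1 / x') - (speed 0 x y - speed 0 x' y')"
    unfolding s by simp
  then have "cmod (1 / fst u - 1 / fst u') \<le> D + cmod (speed 0 x y - speed 0 x' y')"
    unfolding D_def by (metis norm_triangle_ineq4)
  also have "\<dots> \<le> D + 3 * C * (cmod (x - x') + E)"
    using speed_lipschitz[OF xy] by (simp add: E_def)
  also have "\<dots> \<le> D + 3 * C * (h * D + E)"
    using dx C_ge_1 by (intro add_left_mono mult_left_mono add_right_mono) auto
  finally have 1: "cmod (1 / fst u - 1 / fst u') \<le> D + 3 * C * (h * D + E)" .
  have eq: "snd u - snd u' = b 0 x * (y - y') + (b 0 x - b 0 x') * y'
      + x\<^sup>2 * (\<beta> 0 x y - \<beta> 0 x' y') + (x + x') * (x - x') * \<beta> 0 x' y'"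
    by (simp add: u_def u'_def step_def algebra_simps power2_eq_square)
  have "cmod (snd u - snd u') \<le> cmod (b 0 x * (y - y')) + cmod ((b 0 x - b 0 x') * y')
      + cmod (x\<^sup>2 * (\<beta> 0 x y - \<beta> 0 x' y')) + cmod ((x + x') * (x - x') * \<beta> 0 x' y')"
    unfolding eq by (intro order_trans[OF norm_triangle_ineq] add_right_mono order_refl)
  also have "\<dots> \<le> lam * E + C * cmod (x - x') * 1 + (C * cmod (x - x') + h * (C * E)) + 1 * cmod (x - x') * C"
  proof (intro add_mono)
    show "cmod (b 0 x * (y - y')) \<le> lam * E"
      unfolding norm_mult E_def using b_bound[of 0 x] xy d_pos by (intro mult_right_mono) auto
    show "cmod ((b 0 x - b 0 x') * y') \<le> C * cmod (x - x') * 1"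
      unfolding norm_mult using b_lipschitz xy dd C_ge_1 by (intro mult_mono) auto
    have "cmod (x\<^sup>2 * (\<beta> 0 x y - \<beta> 0 x' y')) \<le> (cmod x)\<^sup>2 * (C * (cmod (x - x') + E))"
      unfolding norm_mult norm_power E_def using \<beta>_lipschitz xy by (intro mult_left_mono) auto
    also have "\<dots> = (cmod x)\<^sup>2 * (C * cmod (x - x')) + (cmod x)\<^sup>2 * (C * E)" by (simp add: algebra_simps)
    also have "\<dots> \<le> 1 * (C * cmod (x - x')) + h * (C * E)"
      using dd xsq C_ge_1 h0 power_le_one[of "cmod x" 2] by (intro add_mono mult_right_mono) auto
    finally show "cmod (x\<^sup>2 * (\<beta> 0 x y - \<beta> 0 x' y')) \<le> C * cmod (x - x') + h * (C * E)" by simp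
    have "cmod (x + x') \<le> 1" using norm_triangle_ineq[of x x'] dd by linarith
    then show "cmod ((x + x') * (x - x') * \<beta> 0 x' y') \<le> 1 * cmod (x - x') * C"
      unfolding norm_mult using \<beta>_bound[of 0 x' y'] xy d_pos by (intro mult_mono) auto
  qed
  also have "\<dots> = lam * E + 3 * (C * cmod (x - x')) + h * (C * E)" by simp
  also have "\<dots> \<le> lam * E + 3 * (C * (h * D)) + h * (C * E)"
    using dx C_ge_1 by (intro add_right_mono add_left_mono mult_left_mono) auto
  finally have "K' * cmod (snd u - snd u') \<le> K' * (lam * E + 3 * (C * (h * D)) + h * (C * E))"
    using K'_bounds by (intro mult_left_mono) auto
  with 1 have "cmod (1 / fst u - 1 / fst u') + K' * cmod (snd u - snd u')
      \<le> D + 3 * C * (h * D + E) + K' * (lam * E + 3 * (C * (h * D)) + h * (C * E))" by linarith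
  also have "\<dots> = D + (3 * C + K' * lam) * E + h * ((3 * C + 3 * C * K') * D + C * (K' * E))"
    by (simp add: algebra_simps)
  also have "\<dots> \<le> D + K' * E + h * ((3 * C + 4 * C * K') * D + (3 * C + 4 * C * K') * (K' * E))"
    unfolding K'_bounds(3) using h0 C_ge_1 K'_bounds
    by (intro add_left_mono mult_left_mono add_mono mult_right_mono) auto
  also have "\<dots> = (1 + (6 * C + 8 * C * K') / t\<^sup>2) * (D + K' * E)"
    by (simp add: h_def algebra_simps add_divide_distrib)
  finally show ?thesis by (simp add: D_def E_def)
qed

text \<open>Equal outgoing coordinates make the weighted distance \<open>V\<close> tend to 0 along
  the backward orbits. Returning from index l to i multiplies it by at most a factor bounded in l,
  so it already vanishes at i.\<close>

lemma backward_unique: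
  assumes rec: "\<forall>\<^sub>F i in sequentially. (X i, Y i) = step 0 (X (Suc i), Y (Suc i))"
    and nz: "\<forall>\<^sub>F i in sequentially. X i \<noteq> 0" and lim: "X \<longlonglongrightarrow> 0" "Y \<longlonglongrightarrow> 0"
    and rec': "\<forall>\<^sub>F i in sequentially. (X' i, Y' i) = step 0 (X' (Suc i), Y' (Suc i))"
    and nz': "\<forall>\<^sub>F i in sequentially. X' i \<noteq> 0" and lim': "X' \<longlonglongrightarrow> 0" "Y' \<longlonglongrightarrow> 0"
    and fatou: "(\<lambda>i. w_out q (X i, Y i) + of_nat i) \<longlonglongrightarrow> \<phi>" "(\<lambda>i. w_out q (X' i, Y' i) + of_nat i) \<longlonglongrightarrow> \<phi>"
  shows "\<forall>\<^sub>F i in sequentially. X i = X' i \<and> Y i = Y' i"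
proof -
  define c where "c = 6 * C + 8 * C * K'"
  have c0: "0 \<le> c" using C_ge_1 K'_bounds by (simp add: c_def)
  define V where "V i = cmod (1 / X i - 1 / X' i) + K' * cmod (Y i - Y' i)" for i
  have "\<forall>\<^sub>F i in sequentially. ((X i, Y i) = step 0 (X (Suc i), Y (Suc i)) \<and> X i \<noteq> 0 \<and> cmod (X i) < d \<and> cmod (Y i) < d
      \<and> cmod (1 / X i - of_nat i) \<le> real i / 4) \<and> 2 \<le> i \<and> 2 * C \<le> real i \<and>
      ((X' i, Y' i) = step 0 (X' (Suc i), Y' (Suc i)) \<and> X' i \<noteq> 0 \<and> cmod (X' i) < d \<and> cmod (Y' i) < d
      \<and> cmod (1 / X' i - of_nat i) \<le> real i / 4)"
    using rec nz eventually_in_polydisc[OF lim] backward_speed[OF rec nz lim]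
      rec' nz' eventually_in_polydisc[OF lim'] backward_speed[OF rec' nz' lim']
      eventually_ge_at_top[of 2] eventually_le_linear[of "C / 4"]
    by eventually_elim auto
  then obtain i0 where i0: "\<And>i. i0 \<le> i \<Longrightarrow> ((X i, Y i) = step 0 (X (Suc i), Y (Suc i)) \<and> X i \<noteq> 0 \<and> cmod (X i) < d \<and> cmod (Y i) < d
      \<and> cmod (1 / X i - of_nat i) \<le> real i / 4) \<and> 2 \<le> i \<and> 2 * C \<le> real i \<and>
      ((X' i, Y' i) = step 0 (X' (Suc i), Y' (Suc i)) \<and> X' i \<noteq> 0 \<and> cmod (X' i) < d \<and> cmod (Y' i) < d
      \<and> cmod (1 / X' i - of_nat i) \<le> real i / 4)"
    by (auto simp: eventually_sequentially)
  \<comment> \<open>The exponential weight turns the infinite product into a telescoping exponent: 1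
    + c / (i + 1)^2 is at most exp (c / i - c / (i + 1)).\<close>
  have V_step: "exp (- c / real i) * V i \<le> exp (- c / real (Suc i)) * V (Suc i)" if i: "i0 \<le> i" for i
  proof -
    have S: "i0 \<le> Suc i" using i by simp
    have i2: "2 \<le> i" using i0[OF i] by blast
    have Si: "cmod (1 / X (Suc i) - of_real (real (Suc i))) \<le> real (Suc i) / 4"
      "cmod (1 / X' (Suc i) - of_real (real (Suc i))) \<le> real (Suc i) / 4"
      using i0[OF S] unfolding of_real_of_nat_eq by blast+
    have le: "cmod (X (Suc i)) \<le> 4 / (3 * real (Suc i))" "cmod (X' (Suc i)) \<le> 4 / (3 * real (Suc i))"
      using near_real(3)[OF Si(1)] near_real(3)[OF Si(2)] by simp_all
    have XY: "X i = fst (step 0 (X (Suc i), Y (Suc i)))" "Y i = snd (step 0 (X (Suc i), Y (Suc i)))"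
      "X' i = fst (step 0 (X' (Suc i), Y' (Suc i)))" "Y' i = snd (step 0 (X' (Suc i), Y' (Suc i)))"
      using i0[OF i] by (metis fst_conv snd_conv)+
    have "V i \<le> (1 + c / (real (Suc i))\<^sup>2) * V (Suc i)"
      unfolding V_def XY c_def using i0[OF S] le by (intro step_expansion) auto
    also have "\<dots> \<le> exp (c / real i - c / real (Suc i)) * V (Suc i)"
    proof (rule mult_right_mono)
      have "1 / (real (Suc i))\<^sup>2 \<le> 1 / real i - 1 / real (Suc i)"
      proof -
        have "1 / (real (Suc i))\<^sup>2 \<le> 1 / (real i * real (Suc i))"
          unfolding power2_eq_square using i2 by (intro divide_left_mono mult_right_mono mult_pos_pos) auto
        also have "\<dots> = 1 / real i - 1 / real (Suc i)"
          using i2 by (simp add: field_simps)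
        finally show ?thesis .
      qed
      from mult_left_mono[OF this c0] have "c / (real (Suc i))\<^sup>2 \<le> c / real i - c / real (Suc i)"
        by (simp add: right_diff_distrib)
      then show "1 + c / (real (Suc i))\<^sup>2 \<le> exp (c / real i - c / real (Suc i))"
        using exp_ge_add_one_self[of "c / real i - c / real (Suc i)"] by linarith
      show "0 \<le> V (Suc i)" using K'_bounds by (simp add: V_def)
    qed
    finally have "exp (- c / real i) * V i \<le> exp (- c / real i) * (exp (c / real i - c / real (Suc i)) * V (Suc i))"
      by (intro mult_left_mono) auto
    also have "\<dots> = exp (- c / real (Suc i)) * V (Suc i)"
      by (simp add: mult.assoc[symmetric] exp_add[symmetric])
    finally show ?thesis .
  qed
  have V_mono: "exp (- c / real i) * V i \<le> exp (- c / real l) * V l" if "i0 \<le> i" "i \<le> l" for i l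
    using that(2,1)
  proof (induction l rule: dec_induct)
    case (step l)
    then show ?case using V_step[of l] by simp
  qed simp
  have Wlim: "(\<lambda>i. w_out q (X i, Y i) - w_out q (X' i, Y' i)) \<longlonglongrightarrow> 0"
    using tendsto_diff[OF fatou] by simp
  have wlim: "(\<lambda>i. 1 / X i - 1 / X' i) \<longlonglongrightarrow> 0"
  proof (rule Lim_null_comparison)
    show "\<forall>\<^sub>F i in sequentially. norm (1 / X i - 1 / X' i) \<le> 3 * norm (w_out q (X i, Y i) - w_out q (X' i, Y' i))"
      using eventually_ge_at_top[of i0]
    proof eventually_elim
      case (elim i)
      define u where "u = 1 / X i"
      define v where "v = 1 / X' i"
      have u: "cmod (u - of_real (real i)) \<le> real i / 4" and v: "cmod (v - of_real (real i)) \<le> real i / 4"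
        using i0[OF elim] unfolding of_real_of_nat_eq u_def v_def by blast+
      have i: "0 < real i" "2 * C \<le> real i" "X i \<noteq> 0" "X' i \<noteq> 0" using i0[OF elim] by auto
      have wuv: "w_out q (X i, Y i) = - u + q * Ln u" "w_out q (X' i, Y' i) = - v + q * Ln v"
        using w_out_eq[of "X i" q "Y i"] w_out_eq[of "X' i" q "Y' i"] near_real(1)[OF u i(1)] near_real(1)[OF v i(1)] i(3,4)
        by (simp_all add: u_def v_def)
      have "w_out q (X i, Y i) - w_out q (X' i, Y' i) = - (u - v) + q * (Ln u - Ln v)"
        unfolding wuv by (simp add: algebra_simps)
      then have "u - v = q * (Ln u - Ln v) - (w_out q (X i, Y i) - w_out q (X' i, Y' i))" by simp
      then have "cmod (u - v) \<le> cmod (q * (Ln u - Ln v)) + cmod (w_out q (X i, Y i) - w_out q (X' i, Y' i))"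
        by (metis norm_triangle_ineq4)
      \<comment> \<open>Near i the logarithm has Lipschitz constant 4 / (3 i), and 2 C \<le> i
        brings the product with q down to 2/3. So the difference of the outgoing coordinates
        controls u - v with factor 3.\<close>
      moreover have "cmod (q * (Ln u - Ln v)) \<le> 2/3 * cmod (u - v)"
      proof -
        have "cmod (q * (Ln u - Ln v)) \<le> C * (4 / (3 * real i) * cmod (u - v))"
          unfolding norm_mult using cmod_Ln_diff_le[OF i(1) u v] q_le C_ge_1 by (intro mult_mono) auto
        also have "\<dots> = (4 * C / (3 * real i)) * cmod (u - v)" by simp
        also have "\<dots> \<le> 2/3 * cmod (u - v)"
          using i by (intro mult_right_mono) (auto simp: field_simps)
        finally show ?thesis .
      qed
      ultimately show ?case unfolding u_def[symmetric] v_def[symmetric] by simp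
    qed
    show "(\<lambda>i. 3 * norm (w_out q (X i, Y i) - w_out q (X' i, Y' i))) \<longlonglongrightarrow> 0"
      using tendsto_mult_right_zero[OF tendsto_norm_zero[OF Wlim]] by simp
  qed
  have Vlim: "V \<longlonglongrightarrow> 0"
  proof -
    have "(\<lambda>i. Y i - Y' i) \<longlonglongrightarrow> 0" using tendsto_diff[OF lim(2) lim'(2)] by simp
    then show ?thesis unfolding V_def
      using tendsto_add[OF tendsto_norm_zero[OF wlim] tendsto_mult_right_zero[OF tendsto_norm_zero, of "\<lambda>i. Y i - Y' i" sequentially K']]
      by simp
  qed
  have "V i = 0" if "i0 \<le> i" for i
  proof -
    have "\<forall>\<^sub>F l in sequentially. exp (- c / real i) * V i \<le> V l"
      using eventually_ge_at_top[of i]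
    proof eventually_elim
      case (elim l)
      have "exp (- c / real l) * V l \<le> 1 * V l"
        using c0 K'_bounds by (intro mult_right_mono) (auto simp: V_def)
      then show ?case using V_mono[OF that elim] by linarith
    qed
    then have "exp (- c / real i) * V i \<le> 0"
      using tendsto_lowerbound[OF Vlim] by simp
    moreover have "0 \<le> V i" using K'_bounds by (simp add: V_def)
    ultimately show ?thesis by (simp add: mult_le_0_iff)
  qed
  then have "X i = X' i \<and> Y i = Y' i" if "i0 \<le> i" for i
  proof -
    have "cmod (1 / X i - 1 / X' i) + K' * cmod (Y i - Y' i) = 0" using \<open>\<And>i. i0 \<le> i \<Longrightarrow> V i = 0\<close>[OF that] by (simp add: V_def)
    moreover have "0 \<le> K' * cmod (Y i - Y' i)" using K'_bounds by simp
    ultimately have "cmod (1 / X i - 1 / X' i) = 0" "K' * cmod (Y i - Y' i) = 0"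
      using norm_ge_zero[of "1 / X i - 1 / X' i"] by linarith+
    then show ?thesis using K'_bounds i0[OF that] by (auto simp: field_simps)
  qed
  then show ?thesis by (auto simp: eventually_sequentially)
qed

end

section \<open>Limits of perturbed orbits\<close>

lemma sin_quotient_tendsto:
  fixes e w :: "nat \<Rightarrow> complex"
  assumes "\<And>j. e j \<noteq> 0" "e \<longlonglongrightarrow> 0" "w \<longlonglongrightarrow> w\<^sub>0"
  shows "(\<lambda>j. sin (e j * w j) / e j) \<longlonglongrightarrow> w\<^sub>0"
proof -
  have "(\<lambda>j. sin (e j * w j) / e j - w j) \<longlonglongrightarrow> 0"
  proof (rule Lim_null_comparison)
    have "cmod (sin z - z) \<le> exp (cmod z) * (cmod z)\<^sup>2" for z
    proof -
      have "cmod (sin z - z) \<le> exp \<bar>Im z\<bar> * (cmod z)\<^sup>2"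
        using Taylor_sin[of z "Suc 0"] by (simp add: sin_coeff_def power2_eq_square)
      also have "\<dots> \<le> exp (cmod z) * (cmod z)\<^sup>2"
        using abs_Im_le_cmod[of z] by (intro mult_right_mono) auto
      finally show ?thesis .
    qed
    then have "cmod (sin (e j * w j) / e j - w j) \<le> exp (cmod (e j * w j)) * (cmod (w j))\<^sup>2 * cmod (e j)" for j
    proof -
      assume s: "\<And>z. cmod (sin z - z) \<le> exp (cmod z) * (cmod z)\<^sup>2"
      have "sin (e j * w j) / e j - w j = (sin (e j * w j) - e j * w j) / e j"
        using assms(1)[of j] by (simp add: diff_divide_distrib)
      then have "cmod (sin (e j * w j) / e j - w j) = cmod (sin (e j * w j) - e j * w j) / cmod (e j)"
        by (simp add: norm_divide)
      also have "\<dots> \<le> exp (cmod (e j * w j)) * (cmod (e j * w j))\<^sup>2 / cmod (e j)"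
        by (intro divide_right_mono s) auto
      also have "\<dots> = exp (cmod (e j * w j)) * (cmod (w j))\<^sup>2 * cmod (e j)"
        using assms(1)[of j] by (simp add: norm_mult power2_eq_square)
      finally show ?thesis .
    qed
    then show "\<forall>\<^sub>F j in sequentially. norm (sin (e j * w j) / e j - w j) \<le> exp (cmod (e j * w j)) * (cmod (w j))\<^sup>2 * cmod (e j)"
      by simp
    have "(\<lambda>j. exp (cmod (e j * w j)) * (cmod (w j))\<^sup>2 * cmod (e j)) \<longlonglongrightarrow> exp (cmod (0 * w\<^sub>0)) * (cmod w\<^sub>0)\<^sup>2 * cmod 0"
      by (intro tendsto_intros assms)
    then show "(\<lambda>j. exp (cmod (e j * w j)) * (cmod (w j))\<^sup>2 * cmod (e j)) \<longlonglongrightarrow> 0" by simp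
  qed
  from tendsto_add[OF this assms(3)] show ?thesis by simp
qed

lemma Re_pos_eventually:
  assumes "(f :: nat \<Rightarrow> complex) \<longlonglongrightarrow> l" "0 < Re l"
  shows "\<forall>\<^sub>F j in sequentially. 0 < Re (f j)"
  using order_tendstoD(1)[OF tendsto_Re[OF assms(1)], of 0] assms(2) by simp

lemma Re_of_nat_mult_pos: "0 < Re (of_nat n * z) \<Longrightarrow> 0 < Re z"
  by (simp add: zero_less_mult_iff)

lemma parameter_times_time:
  fixes e :: "nat \<Rightarrow> complex" and n :: "nat \<Rightarrow> nat"
  assumes "\<And>j. e j \<noteq> 0" "e \<longlonglongrightarrow> 0" "(\<lambda>j. of_nat (n j) - complex_of_real pi / e j) \<longlonglongrightarrow> \<alpha>"
  shows "(\<lambda>j. of_nat (n j) * e j) \<longlonglongrightarrow> of_real pi"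
proof -
  have "(\<lambda>j. (of_nat (n j) - complex_of_real pi / e j) * e j + of_real pi) \<longlonglongrightarrow> \<alpha> * 0 + of_real pi"
    by (intro tendsto_intros assms)
  moreover have "(of_nat (n j) - complex_of_real pi / e j) * e j + of_real pi = of_nat (n j) * e j" for j
    using assms(1)[of j] by (simp add: left_diff_distrib)
  ultimately show ?thesis by simp
qed

text \<open>Since \<open>n\<^sub>j \<epsilon>\<^sub>j \<rightarrow> \<pi>\<close>, the arguments stay near the positive axis and the branches of the
  logarithm do not jump.\<close>

lemma Ln_sin_quotient_tendsto:
  fixes e w :: "nat \<Rightarrow> complex" and n :: "nat \<Rightarrow> nat" and s :: complex
  assumes "\<And>j. e j \<noteq> 0" "e \<longlonglongrightarrow> 0" "(\<lambda>j. of_nat (n j) * e j) \<longlonglongrightarrow> of_real pi"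
    and w: "w \<longlonglongrightarrow> w\<^sub>0" "0 < Re (s * w\<^sub>0)"
  shows "(\<lambda>j. Ln (s * sin (e j * w j)) - Ln (e j)) \<longlonglongrightarrow> Ln (s * w\<^sub>0)"
proof -
  have S: "(\<lambda>j. s * (sin (e j * w j) / e j)) \<longlonglongrightarrow> s * w\<^sub>0"
    by (intro tendsto_intros sin_quotient_tendsto assms)
  have "(\<lambda>j. of_nat (n j) * e j * (s * (sin (e j * w j) / e j))) \<longlonglongrightarrow> of_real pi * (s * w\<^sub>0)"
    by (intro tendsto_mult assms(3) S)
  moreover have "0 < Re (of_real pi * (s * w\<^sub>0))" 
  proof -
    have "Re (of_real pi * t) = pi * Re t" for t by simp
    then show ?thesis using w(2) by (simp only: zero_less_mult_iff pi_gt_zero simp_thms)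
  qed
  ultimately have "\<forall>\<^sub>F j in sequentially. 0 < Re (of_nat (n j) * e j * (s * (sin (e j * w j) / e j)))"
    by (rule Re_pos_eventually)
  moreover have "of_nat (n j) * e j * (s * (sin (e j * w j) / e j)) = of_nat (n j) * (s * sin (e j * w j))" for j
    using assms(1)[of j] by simp
  ultimately have 1: "\<forall>\<^sub>F j in sequentially. 0 < Re (s * sin (e j * w j))"
    by (auto elim!: eventually_mono intro: Re_of_nat_mult_pos simp del: times_complex.sel)
  have "\<forall>\<^sub>F j in sequentially. 0 < Re (of_nat (n j) * e j)"
    using assms(3) by (rule Re_pos_eventually) simp
  then have 2: "\<forall>\<^sub>F j in sequentially. 0 < Re (e j)"
    by (rule eventually_mono) (rule Re_of_nat_mult_pos)
  have "\<forall>\<^sub>F j in sequentially. Ln (s * (sin (e j * w j) / e j)) = Ln (s * sin (e j * w j)) - Ln (e j)"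
    using 1 2
  proof eventually_elim
    case (elim j)
    then show ?case using Ln_divide_right_half_plane[OF elim(2,1)] by simp
  qed
  moreover have "(\<lambda>j. Ln (s * (sin (e j * w j) / e j))) \<longlonglongrightarrow> Ln (s * w\<^sub>0)"
    using w(2) by (intro tendsto_Ln S) (auto simp: complex_nonpos_Reals_iff)
  ultimately show ?thesis by (rule Lim_transform_eventually[rotated])
qed

context semiparabolic_model
begin

text \<open>\<open>v = w - \<pi> / e\<close> is the coordinate at the exit.\<close>

definition exit_point :: "nat \<Rightarrow> complex \<Rightarrow> complex \<times> complex \<Rightarrow> complex \<Rightarrow> bool" where
  "exit_point m e z c \<longleftrightarrow> cmod (snd z) \<le> (G + 6) / real m \<and>
     (\<exists>v. cmod (v + of_nat m) \<le> real m / 2 \<and> fst z = - e * cos (e * v) / sin (e * v) \<and>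
       cmod (v + q * (Ln (- sin (e * v)) - Ln e) + of_nat m - c) \<le> (G + 6) / real m)"

text \<open>\<open>z\<close> is the point at time \<open>N\<close>, not at time 0: the first
  \<open>N\<close> steps take place on the manifold, possibly outside the chart.\<close>

definition passes :: "nat \<Rightarrow> nat \<Rightarrow> nat \<Rightarrow> complex \<Rightarrow> complex \<times> complex \<Rightarrow> complex \<Rightarrow> bool" where
  "passes N m n e z c \<longleftrightarrow> N + m \<le> n \<and>
     (\<forall>k\<in>{N..n - m}. cmod (fst ((step e ^^ (k - N)) z)) < d \<and> cmod (snd ((step e ^^ (k - N)) z)) < d) \<and>
     exit_point m e ((step e ^^ (n - m - N)) z) c"

text \<open>For a fixed entrance time x stays away from 0 while the parameter tends to 0. So x = - e
  cot (e w) is inverted by w = Arctan (- e / x) / e with argument tending to 0, and w tends to - 1 /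
  x.\<close>

lemma incoming_coordinate:
  fixes e x :: "nat \<Rightarrow> complex" and n :: "nat \<Rightarrow> nat"
  assumes "\<And>j. e j \<noteq> 0" "e \<longlonglongrightarrow> 0" "(\<lambda>j. of_nat (n j) * e j) \<longlonglongrightarrow> of_real pi"
    and x: "x \<longlonglongrightarrow> x\<^sub>0" "x\<^sub>0 \<noteq> 0" "0 < Re (- 1 / x\<^sub>0)"
  obtains w where "w \<longlonglongrightarrow> - 1 / x\<^sub>0" "(\<lambda>j. pert_log (e j) (w j)) \<longlonglongrightarrow> w_in q (x\<^sub>0, y)"
    "\<forall>\<^sub>F j in sequentially. x j = - e j * cos (e j * w j) / sin (e j * w j)"
proof -
  define w where "w j = Arctan (- e j / x j) / e j" for j
  have zlim: "(\<lambda>j. - e j / x j) \<longlonglongrightarrow> - 0 / x\<^sub>0"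
    by (intro tendsto_intros assms)
  then have "(\<lambda>j. cmod (- e j / x j)) \<longlonglongrightarrow> cmod (- 0 / x\<^sub>0)" by (rule tendsto_norm)
  then have zsmall: "\<forall>\<^sub>F j in sequentially. cmod (- e j / x j) < 1/2"
    using order_tendstoD(2)[of _ "cmod (- 0 / x\<^sub>0)" sequentially "1/2"] by simp
  have xnz: "\<forall>\<^sub>F j in sequentially. x j \<noteq> 0" using x(1,2) by (rule tendsto_imp_eventually_ne)
  have "(\<lambda>j. w j - (- 1 / x j)) \<longlonglongrightarrow> 0"
  proof (rule Lim_null_comparison)
    show "\<forall>\<^sub>F j in sequentially. norm (w j - (- 1 / x j)) \<le> 2 * (cmod (e j))\<^sup>2 / cmod (x j) ^ 3"
      using zsmall xnz
    proof eventually_elim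
      case (elim j)
      have "w j - (- 1 / x j) = (Arctan (- e j / x j) - (- e j / x j)) / e j"
        using assms(1)[of j] by (simp add: w_def add_divide_distrib)
      then have "cmod (w j - (- 1 / x j)) = cmod (Arctan (- e j / x j) - (- e j / x j)) / cmod (e j)"
        by (metis norm_divide)
      also have "\<dots> \<le> 2 * cmod (- e j / x j) ^ 3 / cmod (e j)"
        using elim by (intro divide_right_mono cmod_Arctan_minus_id) auto
      also have "\<dots> = 2 * (cmod (e j))\<^sup>2 / cmod (x j) ^ 3"
        using assms(1)[of j] by (simp add: norm_divide power_divide power2_eq_square power3_eq_cube)
      finally show ?case .
    qed
    have "(\<lambda>j. 2 * (cmod (e j))\<^sup>2 / cmod (x j) ^ 3) \<longlonglongrightarrow> 2 * (cmod 0)\<^sup>2 / cmod x\<^sub>0 ^ 3"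
      using x by (intro tendsto_intros assms) auto
    then show "(\<lambda>j. 2 * (cmod (e j))\<^sup>2 / cmod (x j) ^ 3) \<longlonglongrightarrow> 0" by simp
  qed
  from tendsto_add[OF this tendsto_divide[OF tendsto_const[of "- 1"] x(1,2)]]
  have w: "w \<longlonglongrightarrow> - 1 / x\<^sub>0" by simp
  moreover have "(\<lambda>j. pert_log (e j) (w j)) \<longlonglongrightarrow> w_in q (x\<^sub>0, y)"
  proof -
    have "(\<lambda>j. Ln (1 * sin (e j * w j)) - Ln (e j)) \<longlonglongrightarrow> Ln (1 * (- 1 / x\<^sub>0))"
      using Ln_sin_quotient_tendsto[OF assms(1-3) w, of 1] x(3) by simp
    then have "(\<lambda>j. w j + q * (Ln (sin (e j * w j)) - Ln (e j))) \<longlonglongrightarrow> - 1 / x\<^sub>0 + q * Ln (- 1 / x\<^sub>0)"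
      by (intro tendsto_intros w) simp
    then show ?thesis unfolding pert_log_def w_in_eq[OF x(2,3)] .
  qed
  moreover have "\<forall>\<^sub>F j in sequentially. x j = - e j * cos (e j * w j) / sin (e j * w j)"
    using zsmall xnz
  proof eventually_elim
    case (elim j)
    define z where "z = - e j / x j"
    have z2: "z\<^sup>2 \<noteq> -1"
    proof
      assume "z\<^sup>2 = -1"
      then have "(cmod z)\<^sup>2 = 1" by (metis norm_minus_cancel norm_one norm_power)
      moreover have "(cmod z)\<^sup>2 \<le> (1/2)\<^sup>2" using elim by (intro power_mono) (auto simp: z_def)
      ultimately show False by (simp add: power2_eq_square)
    qed
    have z0: "z \<noteq> 0" using assms(1)[of j] elim by (simp add: z_def)
    have "tan (e j * w j) = z" using tan_Arctan[OF z2] assms(1)[of j] by (simp add: w_def z_def)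
    then have t: "sin (e j * w j) / cos (e j * w j) = - e j / x j" by (simp add: tan_def z_def)
    then have "sin (e j * w j) \<noteq> 0" "cos (e j * w j) \<noteq> 0" using z0 by (auto simp: z_def)
    then show ?case using t elim assms(1)[of j] by (simp add: field_simps)
  qed
  ultimately show ?thesis using that by blast
qed

text \<open>The order of choices is essential: \<open>m\<close> is given, \<open>N\<close> is then
  taken so late that the entrance errors fall below 1 / m, and j so large that the perturbed point
  at time \<open>N\<close> is close to the unperturbed one. \<open>G + 6\<close> collects the drift,
  at most (G + 3) / m, and 1 / m each for entrance and phase, with one to spare.
  \<open>N\<^sub>1\<close> lets the caller force the entrance point into the chart.\<close>

lemma transit_limit:
  fixes X Y :: "nat \<Rightarrow> complex" and e :: "nat \<Rightarrow> complex" and n :: "nat \<Rightarrow> nat"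
    and z :: "nat \<Rightarrow> nat \<Rightarrow> complex \<times> complex"
  assumes rec: "\<forall>\<^sub>F i in sequentially. (X (Suc i), Y (Suc i)) = step 0 (X i, Y i)"
    and nz: "\<forall>\<^sub>F i in sequentially. X i \<noteq> 0" and lim: "X \<longlonglongrightarrow> 0" "Y \<longlonglongrightarrow> 0"
    and fatou: "(\<lambda>i. w_in q (X i, Y i) - of_nat i) \<longlonglongrightarrow> \<phi>"
    and e: "\<And>j. e j \<noteq> 0" "e \<longlonglongrightarrow> 0" and n: "filterlim n at_top sequentially"
    and phase: "(\<lambda>j. of_nat (n j) - complex_of_real pi / e j) \<longlonglongrightarrow> \<alpha>"
    and z: "\<forall>\<^sub>F N in sequentially. z N \<longlonglongrightarrow> (X N, Y N)"
  obtains M where "\<forall>m\<ge>M. 0 < m \<and> (\<exists>N\<ge>N\<^sub>1. \<forall>\<^sub>F j in sequentially. passes N m (n j) (e j) (z N j) (\<phi> + \<alpha>))"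
proof -
  define A where "A = cmod \<alpha> + 1"
  have A1: "1 \<le> A" by (simp add: A_def)
  define H where "H = cmod \<phi> + 2"
  have phA: "\<forall>\<^sub>F j in sequentially. cmod (of_nat (n j) - of_real pi / e j) \<le> A"
    using order_tendstoD(2)[OF tendsto_norm[OF phase], of A] by (auto simp: A_def elim: eventually_mono)
  have ne: "(\<lambda>j. of_nat (n j) * e j) \<longlonglongrightarrow> of_real pi"
    by (rule parameter_times_time[OF e phase])
  have "\<forall>\<^sub>F t in at_top. H + 1 + C * (ln t + 7) \<le> t / 4" by real_asymp
  then obtain t\<^sub>0 where t\<^sub>0: "\<And>t::real. t\<^sub>0 \<le> t \<Longrightarrow> H + 1 + C * (ln t + 7) \<le> t / 4"
    by (auto simp: eventually_at_top_linorder)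
  \<comment> \<open>\<open>t\<^sub>0\<close> serves the hypothesis \<open>far\<close> of
    \<open>transit\<close>, \<open>100 * A\<close> the cotangent region and 13 / d the polydisc; the
    entries with \<open>G\<close> make (G + 3) / m smaller than 1 and than \<open>d\<close>.\<close>
  define M\<^sub>0 where "M\<^sub>0 = Max {t\<^sub>0, 100 * A, 13 / d, G + 4, (G + 4) / d}"
  have M0: "t\<^sub>0 \<le> M\<^sub>0" "100 * A \<le> M\<^sub>0" "13 / d \<le> M\<^sub>0" "G + 4 \<le> M\<^sub>0" "(G + 4) / d \<le> M\<^sub>0"
    by (auto simp: M\<^sub>0_def)
  have M0p: "100 \<le> M\<^sub>0" using M0 A1 by linarith
  have M12: "12 / M\<^sub>0 < d"
  proof -
    have "13 \<le> M\<^sub>0 * d" using M0(3) d_pos by (simp add: pos_divide_le_eq)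
    then show ?thesis using M0p by (simp add: pos_divide_less_eq mult.commute)
  qed
  show ?thesis
  proof (rule that[of "nat \<lceil>M\<^sub>0\<rceil>"], intro allI impI)
    fix m assume "nat \<lceil>M\<^sub>0\<rceil> \<le> m"
    then have m: "M\<^sub>0 \<le> real m" by linarith
    have m0: "0 < real m" "0 < m" using m M0p by linarith+
    have sm: "(G + 3) / real m < 1" "(G + 3) / real m < d"
    proof -
      show "(G + 3) / real m < 1" using m M0(4) m0 by simp
      have "(G + 4) \<le> M\<^sub>0 * d" using M0(5) d_pos by (simp add: pos_divide_le_eq)
      also have "\<dots> \<le> real m * d" using m d_pos by (intro mult_right_mono) auto
      finally show "(G + 3) / real m < d" using m0 by (simp add: pos_divide_less_eq mult.commute)
    qed
    have "(\<lambda>N. K * cmod (Y N)) \<longlonglongrightarrow> 0"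
      using tendsto_mult_right_zero[OF tendsto_norm_zero[OF lim(2)]] by simp
    then have ev1: "\<forall>\<^sub>F N in sequentially. K * cmod (Y N) < 1 / real m"
      using order_tendstoD(2)[of _ 0 sequentially "1 / real m"] m0 by simp
    have "(\<lambda>N. w_in q (X N, Y N) - of_nat N - \<phi>) \<longlonglongrightarrow> 0"
      using tendsto_diff[OF fatou tendsto_const[of \<phi>]] by simp
    then have ev2: "\<forall>\<^sub>F N in sequentially. cmod (w_in q (X N, Y N) - of_nat N - \<phi>) < 1 / real m"
      using order_tendstoD(2)[OF tendsto_norm_zero, of _ sequentially "1 / real m"] m0 by simp
    have ev4: "\<forall>\<^sub>F N in sequentially. G / (real N - 1) < 1 / real m"
    proof -
      have "((\<lambda>N. G / (real N - 1)) \<longlonglongrightarrow> 0)" by real_asymp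
      then show ?thesis using order_tendstoD(2)[of _ 0 sequentially "1 / real m"] m0 by simp
    qed
    have ev5: "\<forall>\<^sub>F N in sequentially. M\<^sub>0 \<le> real N"
      using filterlim_real_sequentially by (auto simp: filterlim_at_top)
    obtain N where N: "N\<^sub>1 \<le> N" "K * cmod (Y N) < 1 / real m" "cmod (w_in q (X N, Y N) - of_nat N - \<phi>) < 1 / real m"
      "cmod (- 1 / X N - of_nat N) < real N / 4" "G / (real N - 1) < 1 / real m" "M\<^sub>0 \<le> real N"
      "z N \<longlonglongrightarrow> (X N, Y N)" "X N \<noteq> 0"
    proof -
      have "\<forall>\<^sub>F N in sequentially. cmod (- 1 / X N - of_nat N) < real N / 4"
        using forward_speed[OF rec nz lim] eventually_gt_at_top[of 0] by eventually_elim simp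
      then have "\<forall>\<^sub>F N in sequentially. cmod (- 1 / X N - of_nat N) < real N / 4 \<and> K * cmod (Y N) < 1 / real m \<and>
        cmod (w_in q (X N, Y N) - of_nat N - \<phi>) < 1 / real m \<and> G / (real N - 1) < 1 / real m \<and> M\<^sub>0 \<le> real N \<and>
        z N \<longlonglongrightarrow> (X N, Y N) \<and> X N \<noteq> 0 \<and> N\<^sub>1 \<le> N"
        using ev1 ev2 ev4 ev5 z nz eventually_ge_at_top[of N\<^sub>1] by eventually_elim blast
      from eventually_happens'[OF sequentially_bot this]
      obtain N where "cmod (- 1 / X N - of_nat N) < real N / 4 \<and> K * cmod (Y N) < 1 / real m \<and>
        cmod (w_in q (X N, Y N) - of_nat N - \<phi>) < 1 / real m \<and> G / (real N - 1) < 1 / real m \<and> M\<^sub>0 \<le> real N \<and>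
        z N \<longlonglongrightarrow> (X N, Y N) \<and> X N \<noteq> 0 \<and> N\<^sub>1 \<le> N" ..
      then show ?thesis using that by blast
    qed
    have Re: "0 < Re (- 1 / X N)"
      using near_real(1)[of "- 1 / X N" "real N"] N M0p by simp
    have zx: "(\<lambda>j. fst (z N j)) \<longlonglongrightarrow> X N" and zy: "(\<lambda>j. snd (z N j)) \<longlonglongrightarrow> Y N"
      using tendsto_fst[OF N(7)] tendsto_snd[OF N(7)] by auto
    obtain w where w: "w \<longlonglongrightarrow> - 1 / X N" "(\<lambda>j. pert_log (e j) (w j)) \<longlonglongrightarrow> w_in q (X N, Y N)"
      "\<forall>\<^sub>F j in sequentially. fst (z N j) = - e j * cos (e j * w j) / sin (e j * w j)"
      by (rule incoming_coordinate[OF e ne zx N(8) Re])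
    have evA: "\<forall>\<^sub>F j in sequentially. cmod (w j - of_nat N) < real N / 4"
      using order_tendstoD(2)[OF tendsto_norm[OF tendsto_diff[OF w(1) tendsto_const[of "of_nat N"]]] N(4)] .
    have evB: "\<forall>\<^sub>F j in sequentially. cmod (pert_log (e j) (w j) - of_nat N - \<phi>) < 1 / real m"
      using order_tendstoD(2)[OF tendsto_norm[OF tendsto_diff[OF tendsto_diff[OF w(2) tendsto_const[of "of_nat N"]] tendsto_const[of \<phi>]]] N(3)] .
    have evC: "\<forall>\<^sub>F j in sequentially. K * cmod (snd (z N j)) < 1 / real m"
      using order_tendstoD(2)[OF tendsto_mult[OF tendsto_const[of K] tendsto_norm[OF zy]] N(2)] .
    have evD: "\<forall>\<^sub>F j in sequentially. cmod (of_nat (n j) - of_real pi / e j - \<alpha>) < 1 / real m"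
      using order_tendstoD(2)[OF tendsto_norm[OF tendsto_diff[OF phase tendsto_const[of \<alpha>]]], of "1 / real m"] m0 by simp
    have evE: "\<forall>\<^sub>F j in sequentially. N + m + 2 * N \<le> n j"
      using n by (simp add: filterlim_at_top)
    have "\<forall>\<^sub>F j in sequentially. passes N m (n j) (e j) (z N j) (\<phi> + \<alpha>)"
      using w(3) evA evB evC evD evE phA
    proof eventually_elim
      case (elim j)
      define \<eta> where "\<eta> = K * cmod (snd (z N j)) + G * (1 / (real N - 1) + 1 / real m)"
      have \<eta>: "\<eta> \<le> (G + 3) / real m"
      proof -
        have "\<eta> = K * cmod (snd (z N j)) + G / (real N - 1) + G * (1 / real m)"
          by (simp add: \<eta>_def distrib_left)
        moreover have "(G + 3) / real m = G * (1 / real m) + 3 * (1 / real m)"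
          by (simp add: add_divide_distrib)
        moreover have "0 \<le> 1 / real m" by simp
        ultimately show ?thesis using elim(4) N(5) by linarith
      qed
      have "1 / real m \<le> 1" using m0 by simp
      have "cmod (pert_log (e j) (w j) - of_nat N) \<le> cmod (pert_log (e j) (w j) - of_nat N - \<phi>) + cmod \<phi>"
        using norm_triangle_ineq[of "pert_log (e j) (w j) - of_nat N - \<phi>" \<phi>] by simp
      then have H': "cmod (pert_log (e j) (w j) - of_nat N) \<le> H"
        using elim(3) \<open>1 / real m \<le> 1\<close> by (simp add: H_def)
      have \<eta>s: "\<eta> \<le> 1" "\<eta> < K * d"
      proof -
        show "\<eta> \<le> 1" using \<eta> sm by linarith
        have "1 * d \<le> K * d" using K_bounds d_pos by (intro mult_right_mono) auto
        then show "\<eta> < K * d" using \<eta> sm by linarith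
      qed
      have tr': "\<exists>w'. cmod (w' - of_nat k) \<le> dist_end (n j) k / 4
        \<and> fst ((step (e j) ^^ (k - N)) (z N j)) = - e j * cos (e j * w') / sin (e j * w')
        \<and> cmod (fst ((step (e j) ^^ (k - N)) (z N j))) < d \<and> cmod (snd ((step (e j) ^^ (k - N)) (z N j))) < d
        \<and> cmod (pert_log (e j) w' - pert_log (e j) (w j) - of_nat (k - N)) + K * cmod (snd ((step (e j) ^^ (k - N)) (z N j))) \<le> \<eta>"
        if "N \<le> k" "k \<le> n j - m" for k
      proof -
        have far: "H + 1 + C * (ln \<kappa> + 7) \<le> \<kappa> / 4" if "M\<^sub>0 \<le> \<kappa>" for \<kappa>
          using t\<^sub>0[of \<kappa>] M0(1) that by linarith
        have Nn: "N + m \<le> n j" "2 * N \<le> n j" using elim(6) by auto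
        show ?thesis
          using transit[OF e(1) elim(7) A1 M0(2) M12 far N(6) m Nn less_imp_le[OF elim(2)] elim(1) H' \<eta>s[unfolded \<eta>_def] that]
          unfolding \<eta>_def by blast
      qed
      have Nm: "N \<le> n j - m" "m \<le> n j" using elim(6) by auto
      obtain w' where w': "cmod (w' - of_nat (n j - m)) \<le> dist_end (n j) (n j - m) / 4"
        "fst ((step (e j) ^^ (n j - m - N)) (z N j)) = - e j * cos (e j * w') / sin (e j * w')"
        and E: "cmod (pert_log (e j) w' - pert_log (e j) (w j) - of_nat (n j - m - N)) + K * cmod (snd ((step (e j) ^^ (n j - m - N)) (z N j))) \<le> \<eta>"
        using tr'[OF Nm(1) order_refl] by blast
      \<comment> \<open>The shift by the period pi / e of the cotangent preserves the formula for x
        but reverses the sign of the sine, whence \<open>- sin (e * v)\<close> in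
        \<open>exit_point\<close>. The exit lies near v = - m.\<close>
      define v where "v = w' - of_real pi / e j"
      have ev: "e j * w' = e j * v + of_real pi" using e(1)[of j] by (simp add: v_def right_diff_distrib)
      have sc: "sin (e j * w') = - sin (e j * v)" "cos (e j * w') = - cos (e j * v)"
        unfolding ev sin_add cos_add by (simp_all add: sin_of_real[symmetric] cos_of_real[symmetric])
      have "v + of_nat m = (w' - of_nat (n j - m)) + (of_nat (n j) - of_real pi / e j)"
        using Nm by (simp add: v_def of_nat_diff)
      then have "cmod (v + of_nat m) \<le> cmod (w' - of_nat (n j - m)) + cmod (of_nat (n j) - of_real pi / e j)"
        by (metis norm_triangle_ineq)
      also have "\<dots> \<le> real m / 4 + A"
      proof -
        have "dist_end (n j) (n j - m) \<le> real m" using Nm by (simp add: dist_end_def of_nat_diff)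
        then show ?thesis using w'(1) elim(7) by linarith
      qed
      also have "\<dots> \<le> real m / 2" using m M0(2) A1 by linarith
      finally have v1: "cmod (v + of_nat m) \<le> real m / 2" .
      have v2: "fst ((step (e j) ^^ (n j - m - N)) (z N j)) = - e j * cos (e j * v) / sin (e j * v)"
        unfolding w'(2) sc by simp
      \<comment> \<open>\<open>P\<close> is the drift during the passage, \<open>R\<close> the error
        at the entrance, \<open>S\<close> the error of the phase; each is O(1 / m).\<close>
      define P where "P = pert_log (e j) w' - pert_log (e j) (w j) - of_nat (n j - m - N)"
      define R where "R = pert_log (e j) (w j) - of_nat N - \<phi>"
      define S where "S = of_nat (n j) - of_real pi / e j - \<alpha>"
      have "of_nat (n j - m - N) = of_nat (n j) - of_nat m - (of_nat N :: complex)"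
        using Nm by (simp add: of_nat_diff)
      then have eq: "v + q * (Ln (- sin (e j * v)) - Ln (e j)) + of_nat m - (\<phi> + \<alpha>) = P + R + S"
        unfolding P_def R_def S_def pert_log_def[of _ w'] sc(1) by (simp add: v_def)
      have Kp: "0 \<le> K * cmod (snd ((step (e j) ^^ (n j - m - N)) (z N j)))" using K_bounds by simp
      have "cmod (P + R + S) \<le> cmod P + cmod R + cmod S"
        by (meson add_right_mono norm_triangle_ineq order_trans)
      also have "\<dots> \<le> (G + 3) / real m + 1 / real m + 1 / real m"
        using E \<eta> Kp elim(3,5) unfolding P_def[symmetric] R_def[symmetric] S_def[symmetric] by linarith
      also have "\<dots> \<le> (G + 6) / real m"
        unfolding add_divide_distrib[symmetric] using m0 by (intro divide_right_mono) auto
      finally have v3: "cmod (v + q * (Ln (- sin (e j * v)) - Ln (e j)) + of_nat m - (\<phi> + \<alpha>)) \<le> (G + 6) / real m"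
        unfolding eq .
      have "1 * cmod (snd ((step (e j) ^^ (n j - m - N)) (z N j))) \<le> K * cmod (snd ((step (e j) ^^ (n j - m - N)) (z N j)))"
        using K_bounds by (intro mult_right_mono) auto
      also have "\<dots> \<le> (G + 3) / real m" using E \<eta> unfolding P_def[symmetric] using norm_ge_zero[of P] by linarith
      also have "\<dots> \<le> (G + 6) / real m" using m0 by (intro divide_right_mono) auto
      finally have y: "cmod (snd ((step (e j) ^^ (n j - m - N)) (z N j))) \<le> (G + 6) / real m" by simp
      show ?case unfolding passes_def exit_point_def
      proof (intro conjI ballI exI[of _ v])
        fix k assume "k \<in> {N..n j - m}"
        then have k: "N \<le> k" "k \<le> n j - m" by auto
        show "cmod (fst ((step (e j) ^^ (k - N)) (z N j))) < d" using tr'[OF k] by blast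
        show "cmod (snd ((step (e j) ^^ (k - N)) (z N j))) < d" using tr'[OF k] by blast
      next
        show "N + m \<le> n j" using elim(6) by simp
      qed (fact y v1 v2 v3)+
    qed
    then show "0 < m \<and> (\<exists>N\<ge>N\<^sub>1. \<forall>\<^sub>F j in sequentially. passes N m (n j) (e j) (z N j) (\<phi> + \<alpha>))"
      using N(1) m0 by blast
  qed
qed

text \<open>\<open>v\<close> is only confined to a compact disc, so a limit V is taken along a
  subsequence; it is determined by the limit - 1 / V of x. The disc of radius m / 2 about - m lies
  in the left half-plane, hence V \<noteq> 0 and the logarithm of - V is on its principal
  branch.\<close>

lemma outgoing_limit:
  fixes e v x :: "nat \<Rightarrow> complex" and n :: "nat \<Rightarrow> nat"
  assumes e: "\<And>j. e j \<noteq> 0" "e \<longlonglongrightarrow> 0" and ne: "(\<lambda>j. of_nat (n j) * e j) \<longlonglongrightarrow> of_real pi"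
    and m: "0 < m" and v: "\<And>j. cmod (v j + of_nat m) \<le> real m / 2"
    and x: "x \<longlonglongrightarrow> x\<^sub>0" "\<And>j. x j = - e j * cos (e j * v j) / sin (e j * v j)"
    and fatou: "\<And>j. cmod (v j + q * (Ln (- sin (e j * v j)) - Ln (e j)) + of_nat m - c) \<le> \<eta>"
  shows "x\<^sub>0 \<noteq> 0" "cmod (1 / x\<^sub>0 - of_nat m) \<le> real m / 2" "cmod (w_out q (x\<^sub>0, y) + of_nat m - c) \<le> \<eta>"
proof -
  have "\<exists>V s. strict_mono s \<and> (v \<circ> s) \<longlonglongrightarrow> V"
  proof -
    have "v j \<in> cball (- of_nat m) (real m / 2)" for j
    proof -
      have "- of_nat m - v j = - (v j + of_nat m)" by simp
      then show ?thesis using v[of j] by (simp only: mem_cball dist_norm norm_minus_cancel)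
    qed
    then have "\<forall>j. v j \<in> cball (- of_nat m) (real m / 2)" ..
    from seq_compactE[OF compact_imp_seq_compact[OF compact_cball] this]
    obtain V s where "strict_mono s" "(v \<circ> s) \<longlonglongrightarrow> V" .
    then show ?thesis by blast
  qed
  then obtain V s where s: "strict_mono s" and V: "(\<lambda>j. v (s j)) \<longlonglongrightarrow> V" by (auto simp: o_def)
  have Vm: "cmod (V + of_nat m) \<le> real m / 2"
    by (rule LIMSEQ_le_const2[OF tendsto_norm[OF tendsto_add[OF V tendsto_const]]]) (use v in blast)
  have re: "0 < Re (- V)"
    using abs_Re_le_cmod[of "V + of_nat m"] Vm m by simp
  then have V0: "V \<noteq> 0" by auto
  have es: "\<And>j. e (s j) \<noteq> 0" "(\<lambda>j. e (s j)) \<longlonglongrightarrow> 0" "(\<lambda>j. of_nat (n (s j)) * e (s j)) \<longlonglongrightarrow> of_real pi"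
    using e LIMSEQ_subseq_LIMSEQ[OF e(2) s] LIMSEQ_subseq_LIMSEQ[OF ne s] by (auto simp: o_def)
  have "(\<lambda>j. - cos (e (s j) * v (s j)) / (sin (e (s j) * v (s j)) / e (s j))) \<longlonglongrightarrow> - cos (0 * V) / V"
    by (intro tendsto_intros sin_quotient_tendsto es V V0)
  moreover have "x (s j) = - cos (e (s j) * v (s j)) / (sin (e (s j) * v (s j)) / e (s j))" for j
    using e(1)[of "s j"] x(2)[of "s j"] by simp
  ultimately have "(\<lambda>j. x (s j)) \<longlonglongrightarrow> - 1 / V" by simp
  moreover have "(\<lambda>j. x (s j)) \<longlonglongrightarrow> x\<^sub>0" using LIMSEQ_subseq_LIMSEQ[OF x(1) s] by (simp add: o_def)
  ultimately have x0: "x\<^sub>0 = - 1 / V" using LIMSEQ_unique by blast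
  then show nz: "x\<^sub>0 \<noteq> 0" using V0 by simp
  have inv: "1 / x\<^sub>0 = - V" using x0 V0 by simp
  show "cmod (1 / x\<^sub>0 - of_nat m) \<le> real m / 2"
  proof -
    have "- V - of_nat m = - (V + of_nat m)" by simp
    then show ?thesis using Vm unfolding inv by (simp only: norm_minus_cancel)
  qed
  have L: "(\<lambda>j. Ln ((- 1) * sin (e (s j) * v (s j))) - Ln (e (s j))) \<longlonglongrightarrow> Ln ((- 1) * V)"
    using Ln_sin_quotient_tendsto[OF es V, of "- 1"] re by simp
  have "(\<lambda>j. v (s j) + q * (Ln ((- 1) * sin (e (s j) * v (s j))) - Ln (e (s j))) + of_nat m - c)
      \<longlonglongrightarrow> V + q * Ln ((- 1) * V) + of_nat m - c"
    by (intro tendsto_intros V L)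
  from LIMSEQ_le_const2[OF tendsto_norm[OF this]] fatou
  have "cmod (V + q * Ln ((- 1) * V) + of_nat m - c) \<le> \<eta>" by auto
  moreover have "w_out q (x\<^sub>0, y) = V + q * Ln ((- 1) * V)"
    using w_out_eq[OF nz, of q y] re unfolding inv by (simp add: x0)
  ultimately show "cmod (w_out q (x\<^sub>0, y) + of_nat m - c) \<le> \<eta>" by simp
qed

end

section \<open>The germ on the manifold\<close>

text \<open>Joins the local model to the manifold. Outside the chart only the joint continuity of
  the family and the continuous inverse of \<open>F 0\<close> are available. Holomorphy is kept
  along one-parameter discs, the form that the Cauchy estimate at the axis x = 0 uses.\<close>

locale semiparabolic_germ = semiparabolic_lipschitz d C lam q r a \<beta> b
  for d C lam q r a \<beta> b +
  fixes F :: "complex \<Rightarrow> 'm::metric_space \<Rightarrow> 'm" and pt :: 'm and U :: "'m set"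
    and \<psi> :: "'m \<Rightarrow> complex \<times> complex"
  assumes F_cont: "continuous_on (ball 0 d \<times> UNIV) (\<lambda>(e, p). F e p)"
    and F_bij: "bij (F 0)" and inv_cont: "continuous_on UNIV (inv (F 0))"
    and fixed: "F 0 pt = pt"
    and chart: "open U" "open (\<psi> ` U)" "homeomorphism U (\<psi> ` U) \<psi> (inv_into U \<psi>)"
    and centre: "pt \<in> U" "\<psi> pt = (0, 0)" and polydisc: "ball 0 d \<times> ball 0 d \<subseteq> \<psi> ` U"
    and normal: "\<And>e p. cmod e < d \<Longrightarrow> p \<in> U \<Longrightarrow> cmod (fst (\<psi> p)) < d \<Longrightarrow> cmod (snd (\<psi> p)) < d \<Longrightarrow>
      F e p \<in> U \<and> \<psi> (F e p) = step e (\<psi> p)"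
    and step_holomorphic: "\<And>S u v. open S \<Longrightarrow> u holomorphic_on S \<Longrightarrow> v holomorphic_on S \<Longrightarrow>
      (\<And>z. z \<in> S \<Longrightarrow> cmod (u z) < d \<and> cmod (v z) < d) \<Longrightarrow>
      (\<lambda>z. a 0 (u z) (v z)) holomorphic_on S \<and> (\<lambda>z. snd (step 0 (u z, v z))) holomorphic_on S"
begin

abbreviation "F\<^sub>0 \<equiv> F 0"

abbreviation "\<psi>' \<equiv> inv_into U \<psi>"

definition W :: "'m set" where
  "W = {p \<in> U. cmod (fst (\<psi> p)) < d \<and> cmod (snd (\<psi> p)) < d}"

lemma \<psi>_inj: "inj_on \<psi> U"
  using chart(3) by (metis homeomorphism_def inj_on_inverseI)

lemma \<psi>'_\<psi>: "p \<in> U \<Longrightarrow> \<psi>' (\<psi> p) = p"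
  using \<psi>_inj by simp

lemma \<psi>'_pt: "\<psi>' (0, 0) = pt"
  using \<psi>'_\<psi>[OF centre(1)] centre(2) by simp

lemma \<psi>'_polydisc:
  assumes "cmod x < d" "cmod y < d"
  shows "\<psi>' (x, y) \<in> U" "\<psi> (\<psi>' (x, y)) = (x, y)" "\<psi>' (x, y) \<in> W"
proof -
  have "(x, y) \<in> \<psi> ` U" using polydisc assms by auto
  then show "\<psi>' (x, y) \<in> U" "\<psi> (\<psi>' (x, y)) = (x, y)" by (auto intro: inv_into_into f_inv_into_f)
  then show "\<psi>' (x, y) \<in> W" using assms by (simp add: W_def)
qed

lemma \<psi>_tendsto:
  assumes "(f \<longlongrightarrow> p) net" "p \<in> U"
  shows "((\<lambda>j. \<psi> (f j)) \<longlongrightarrow> \<psi> p) net"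
proof -
  have "isCont \<psi> p" using chart assms by (simp add: continuous_on_eq_continuous_at homeomorphism_def)
  then show ?thesis using assms(1) by (rule isCont_tendsto_compose)
qed

lemma \<psi>'_tendsto:
  assumes "(f \<longlongrightarrow> (x, y)) net" "cmod x < d" "cmod y < d"
  shows "((\<lambda>j. \<psi>' (f j)) \<longlongrightarrow> \<psi>' (x, y)) net"
proof -
  have "(x, y) \<in> \<psi> ` U" using polydisc assms by auto
  moreover have "continuous_on (\<psi> ` U) \<psi>'" using chart(3) unfolding homeomorphism_def by blast
  ultimately have "isCont \<psi>' (x, y)" using continuous_on_eq_continuous_at[OF chart(2)] by blast
  then show ?thesis using assms(1) by (rule isCont_tendsto_compose)
qed

lemma eventually_in_U:
  assumes "(f \<longlongrightarrow> p) net" "p \<in> U" shows "\<forall>\<^sub>F j in net. f j \<in> U"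
  using topological_tendstoD[OF assms(1) chart(1) assms(2)] .

lemma F_tendsto:
  assumes "(e \<longlongrightarrow> 0) net" "(f \<longlongrightarrow> p) net"
  shows "((\<lambda>j. F (e j) (f j)) \<longlongrightarrow> F 0 p) net"
proof -
  have "open (ball (0::complex) d \<times> (UNIV :: 'm set))" by (simp add: open_Times)
  moreover have "(0, p) \<in> ball 0 d \<times> UNIV" using d_pos by simp
  ultimately have "isCont (\<lambda>(e, p). F e p) (0, p)"
    using F_cont by (simp add: continuous_on_eq_continuous_at)
  from isCont_tendsto_compose[OF this tendsto_Pair[OF assms]] show ?thesis by simp
qed

lemma F_iter_tendsto:
  assumes "(e \<longlongrightarrow> 0) net" "(f \<longlongrightarrow> p) net"
  shows "((\<lambda>j. (F (e j) ^^ N) (f j)) \<longlongrightarrow> (F 0 ^^ N) p) net"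
proof (induction N)
  case (Suc N)
  then show ?case using F_tendsto[OF assms(1)] by simp
qed (use assms in simp)

lemma F0_iter_inverse: "(inv F\<^sub>0 ^^ N) ((F\<^sub>0 ^^ N) p) = p" "(F\<^sub>0 ^^ N) ((inv F\<^sub>0 ^^ N) p) = p"
proof -
  have i: "inv F\<^sub>0 (F\<^sub>0 p) = p" "F\<^sub>0 (inv F\<^sub>0 p) = p" for p
    using F_bij by (simp_all add: bij_is_inj bij_is_surj surj_f_inv_f)
  show "(inv F\<^sub>0 ^^ N) ((F\<^sub>0 ^^ N) p) = p"
    by (induction N arbitrary: p) (simp_all add: funpow_swap1 i)
  show "(F\<^sub>0 ^^ N) ((inv F\<^sub>0 ^^ N) p) = p"
    by (induction N arbitrary: p) (simp_all add: funpow_swap1 i)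
qed

lemma inv_F0_iter_tendsto:
  assumes "(f \<longlongrightarrow> p) net"
  shows "((\<lambda>j. (inv F\<^sub>0 ^^ N) (f j)) \<longlongrightarrow> (inv F\<^sub>0 ^^ N) p) net"
proof (induction N)
  case (Suc N)
  have "isCont (inv F\<^sub>0) p" for p using inv_cont by (simp add: continuous_on_eq_continuous_at)
  from isCont_tendsto_compose[OF this Suc] show ?case by simp
qed (use assms in simp)

lemma F_iter_fixed: "(F\<^sub>0 ^^ N) pt = pt"
  by (induction N) (simp_all add: fixed)

lemma F_iter_local:
  assumes "cmod e < d" "p \<in> U"
    and "\<And>i. i < l \<Longrightarrow> cmod (fst ((step e ^^ i) (\<psi> p))) < d \<and> cmod (snd ((step e ^^ i) (\<psi> p))) < d"
  shows "(F e ^^ l) p \<in> U \<and> \<psi> ((F e ^^ l) p) = (step e ^^ l) (\<psi> p)"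
  using assms(3)
proof (induction l)
  case (Suc l)
  then have "(F e ^^ l) p \<in> U \<and> \<psi> ((F e ^^ l) p) = (step e ^^ l) (\<psi> p)" by simp
  then show ?case using normal[OF assms(1), of "(F e ^^ l) p"] Suc.prems[of l] by simp
qed (use assms in simp)

lemma W_neighbourhood:
  assumes "0 < \<eta>"
  obtains V where "open V" "pt \<in> V" "V \<subseteq> W" "\<forall>p\<in>V. cmod (fst (\<psi> p)) < \<eta>"
proof
  let ?V = "U \<inter> \<psi> -` (ball 0 (min d \<eta>) \<times> ball 0 d)"
  have "continuous_on U \<psi>" using chart(3) by (simp add: homeomorphism_def)
  then show "open ?V" using chart(1) by (intro continuous_open_preimage) (auto simp: open_Times)
  show "pt \<in> ?V" using centre d_pos assms by auto
  show "?V \<subseteq> W" by (auto simp: W_def)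
  show "\<forall>p\<in>?V. cmod (fst (\<psi> p)) < \<eta>" by auto
qed

lemma eventually_W:
  assumes "f \<longlonglongrightarrow> pt" shows "\<forall>\<^sub>F i in sequentially. f i \<in> W"
proof -
  obtain V where V: "open V" "pt \<in> V" "V \<subseteq> W" by (rule W_neighbourhood[of 1]) auto
  from topological_tendstoD[OF assms V(1,2)] V(3) show ?thesis by (auto elim: eventually_mono)
qed

lemma coordinates_tendsto:
  assumes "f \<longlonglongrightarrow> pt"
  shows "(\<lambda>i. fst (\<psi> (f i))) \<longlonglongrightarrow> 0" "(\<lambda>i. snd (\<psi> (f i))) \<longlonglongrightarrow> 0"
  using tendsto_fst[OF \<psi>_tendsto[OF assms centre(1)]] tendsto_snd[OF \<psi>_tendsto[OF assms centre(1)]] centre(2)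
  by auto

lemma normal_W: "cmod e < d \<Longrightarrow> p \<in> W \<Longrightarrow> \<psi> (F e p) = step e (\<psi> p)"
  using normal by (auto simp: W_def)

text \<open>The axis \<open>x = 0\<close> does not meet the basin: along it the iterates have derivative \<open>1\<close> in the
  direction of \<open>x\<close>, which by Cauchy's inequality prevents uniform convergence to \<open>O\<close>.\<close>

lemma basin_off_axis:
  assumes "p \<in> basin F\<^sub>0 pt"
  shows "\<forall>\<^sub>F i in sequentially. fst (\<psi> ((F\<^sub>0 ^^ i) p)) \<noteq> 0"
proof -
  obtain N where N: "open N" "p \<in> N" "uniform_limit N (\<lambda>n. F\<^sub>0 ^^ n) (\<lambda>_. pt) sequentially"
    using assms by (auto simp: basin_def)
  have unif: "\<exists>i0. \<forall>i\<ge>i0. \<forall>p\<in>N. (F\<^sub>0 ^^ i) p \<in> V" if "open V" "pt \<in> V" for V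
  proof -
    have "\<exists>\<epsilon>>0. ball pt \<epsilon> \<subseteq> V" using that open_contains_ball by blast
    then obtain \<epsilon> where \<epsilon>: "0 < \<epsilon>" "ball pt \<epsilon> \<subseteq> V" by blast
    from uniform_limitD[OF N(3) \<epsilon>(1)] have "\<forall>\<^sub>F i in sequentially. \<forall>p\<in>N. (F\<^sub>0 ^^ i) p \<in> V"
      using \<epsilon>(2) by (auto simp: dist_commute subset_iff elim!: eventually_mono)
    then show ?thesis by (simp add: eventually_sequentially)
  qed
  obtain V where V: "open V" "pt \<in> V" "V \<subseteq> W" by (rule W_neighbourhood[of 1]) auto
  obtain i0 where i0: "\<And>i p. i0 \<le> i \<Longrightarrow> p \<in> N \<Longrightarrow> (F\<^sub>0 ^^ i) p \<in> W"
    using unif[OF V(1,2)] V(3) by blast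
  have "fst (\<psi> ((F\<^sub>0 ^^ k) p)) \<noteq> 0" if k: "i0 \<le> k" for k
  proof
    assume x0: "fst (\<psi> ((F\<^sub>0 ^^ k) p)) = 0"
    define y where "y = snd (\<psi> ((F\<^sub>0 ^^ k) p))"
    have Pk: "(F\<^sub>0 ^^ k) p \<in> W" using i0[OF k N(2)] .
    then have yd: "cmod y < d" and pk: "\<psi>' (0, y) = (F\<^sub>0 ^^ k) p"
      using \<psi>'_\<psi>[of "(F\<^sub>0 ^^ k) p"] x0 by (auto simp: W_def y_def) (metis prod.collapse)
    \<comment> \<open>Pulls the slice of constant y back under the k-th iterate to a disc through
      \<open>p\<close>, where the convergence is uniform. From time \<open>k\<close> on, the orbit
      of \<open>g x\<close> is that of the slice point.\<close>
    define g where "g x = (inv F\<^sub>0 ^^ k) (\<psi>' (x, y))" for x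
    have "((\<lambda>x. (x, y)) \<longlongrightarrow> (0, y)) (at 0)" by (intro tendsto_intros)
    then have "(g \<longlongrightarrow> (inv F\<^sub>0 ^^ k) (\<psi>' (0, y))) (at 0)"
      unfolding g_def using yd d_pos by (intro inv_F0_iter_tendsto \<psi>'_tendsto) auto
    then have "(g \<longlongrightarrow> p) (at 0)" using pk F0_iter_inverse(1)[of k p] by simp
    from topological_tendstoD[OF this N(1,2)] have "\<forall>\<^sub>F x in at 0. g x \<in> N" .
    then obtain s0 where s0: "0 < s0" "\<And>x. x \<noteq> 0 \<Longrightarrow> cmod x < s0 \<Longrightarrow> g x \<in> N"
      by (auto simp: eventually_at)
    define s where "s = min s0 d"
    have s: "0 < s" "s \<le> d" using s0 d_pos by (auto simp: s_def)
    have gN: "g x \<in> N" if "cmod x < s" for x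
    proof (cases "x = 0")
      case True
      then show ?thesis using N(2) pk F0_iter_inverse(1)[of k p] by (simp add: g_def)
    qed (use s0 that in \<open>auto simp: s_def\<close>)
    have gF: "(F\<^sub>0 ^^ (i + k)) (g x) = (F\<^sub>0 ^^ i) (\<psi>' (x, y))" for i x
      by (simp add: funpow_add g_def F0_iter_inverse(2))
    define f where "f i x = fst ((step 0 ^^ i) (x, y))" for i x
    define h where "h i x = snd ((step 0 ^^ i) (x, y))" for i x
    \<comment> \<open>Strong induction: \<open>F_iter_local\<close> needs all earlier iterates in
      the polydisc, and uniform convergence supplies the membership at time \<open>i\<close>
      itself.\<close>
    have loc: "\<psi> ((F\<^sub>0 ^^ i) (\<psi>' (x, y))) = (f i x, h i x) \<and> cmod (f i x) < d \<and> cmod (h i x) < d"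
      if x: "cmod x < s" for i x
    proof (induction i rule: less_induct)
      case (less i)
      have xd: "cmod x < d" using x s by simp
      have "\<psi> ((F\<^sub>0 ^^ i) (\<psi>' (x, y))) = (step 0 ^^ i) (\<psi> (\<psi>' (x, y)))"
        using F_iter_local[of 0 "\<psi>' (x, y)" i] \<psi>'_polydisc[OF xd yd] less d_pos by (simp add: f_def h_def)
      moreover have "(F\<^sub>0 ^^ i) (\<psi>' (x, y)) \<in> W"
        using i0[of "i + k" "g x"] gN[OF x] k gF by simp
      ultimately show ?case using \<psi>'_polydisc[OF xd yd] by (simp add: W_def f_def h_def)
    qed
    have fS: "f (Suc i) = (\<lambda>x. f i x + (f i x)\<^sup>2 * a 0 (f i x) (h i x))" "h (Suc i) = (\<lambda>x. snd (step 0 (f i x, h i x)))" for i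
      by (simp_all add: fun_eq_iff f_def h_def step_def split: prod.split)
    have hol: "f i holomorphic_on ball 0 s \<and> h i holomorphic_on ball 0 s" for i
    proof (induction i)
      case 0
      then show ?case by (simp add: f_def h_def)
    next
      case (Suc i)
      have "(\<lambda>z. a 0 (f i z) (h i z)) holomorphic_on ball 0 s \<and> (\<lambda>z. snd (step 0 (f i z, h i z))) holomorphic_on ball 0 s"
        using Suc loc by (intro step_holomorphic) auto
      then show ?case using Suc unfolding fS by (auto intro!: holomorphic_intros)
    qed
    have f0: "f i 0 = 0" for i
      by (induction i) (simp_all add: fS, simp add: f_def)
    \<comment> \<open>The map changes x by x^2 a, which vanishes to second order at x = 0, so every
      iterate keeps the derivative 1.\<close>
    have df: "(f i has_field_derivative 1) (at 0)" for i
    proof (induction i)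
      case 0
      then show ?case by (simp add: f_def)
    next
      case (Suc i)
      have "(\<lambda>z. a 0 (f i z) (h i z)) holomorphic_on ball 0 s"
        using hol loc step_holomorphic[of "ball 0 s" "f i" "h i"] by simp
      then have "(\<lambda>z. a 0 (f i z) (h i z)) field_differentiable at 0"
        using s by (intro holomorphic_on_imp_differentiable_at[of _ "ball 0 s"]) auto
      then obtain D where D: "((\<lambda>z. a 0 (f i z) (h i z)) has_field_derivative D) (at 0)"
        unfolding field_differentiable_def ..
      from DERIV_add[OF Suc DERIV_mult[OF DERIV_power[OF Suc, of 2] D]]
      show ?case unfolding fS by (simp add: f0)
    qed
    \<comment> \<open>A bound s / 4 on the circle of radius s / 2 limits the derivative at the
      centre to 1/2, against the value 1.\<close>
    have "0 < s / 4" using s by simp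
    then obtain V' where V': "open V'" "pt \<in> V'" "V' \<subseteq> W" "\<forall>p\<in>V'. cmod (fst (\<psi> p)) < s / 4"
      by (rule W_neighbourhood)
    obtain i1 where i1: "\<And>i p. i1 \<le> i \<Longrightarrow> p \<in> N \<Longrightarrow> (F\<^sub>0 ^^ i) p \<in> V'"
      using unif[OF V'(1,2)] by blast
    have small: "cmod (f i1 x) \<le> s / 4" if "cmod x < s" for x
      using bspec[OF V'(4) i1[of "i1 + k" "g x"]] gN[OF that] gF loc[OF that, of i1] by simp
    have "cmod ((deriv ^^ 1) (f i1) 0) \<le> fact 1 * (s / 4) / (s / 2) ^ 1"
    proof (rule Cauchy_inequality[of "f i1" 0 "s / 2" "s / 4" 1])
      have "cball 0 (s / 2) \<subseteq> ball 0 s" using s by auto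
      then show "continuous_on (cball 0 (s / 2)) (f i1)"
        by (rule continuous_on_subset[OF holomorphic_on_imp_continuous_on[OF conjunct1[OF hol]]])
      show "f i1 holomorphic_on ball 0 (s / 2)"
        using conjunct1[OF hol] by (rule holomorphic_on_subset) (use s in auto)
      show "cmod (f i1 x) \<le> s / 4" if "cmod (0 - x) = s / 2" for x
        using small[of x] that s by simp
    qed (use s in auto)
    then show False using DERIV_imp_deriv[OF df[of i1]] s by simp
  qed
  then show ?thesis by (auto simp: eventually_sequentially)
qed

lemma basin_orbit:
  assumes "p \<in> basin F\<^sub>0 pt"
  shows "(\<lambda>i. (F\<^sub>0 ^^ i) p) \<longlonglongrightarrow> pt"
proof -
  obtain N where "p \<in> N" "uniform_limit N (\<lambda>n. F\<^sub>0 ^^ n) (\<lambda>_. pt) sequentially"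
    using assms by (auto simp: basin_def)
  then show ?thesis by (rule tendsto_uniform_limitI[rotated])
qed

lemma basin_coordinates:
  assumes "p \<in> basin F\<^sub>0 pt"
  defines "X \<equiv> \<lambda>i. fst (\<psi> ((F\<^sub>0 ^^ i) p))" and "Y \<equiv> \<lambda>i. snd (\<psi> ((F\<^sub>0 ^^ i) p))"
  shows "\<forall>\<^sub>F i in sequentially. (X (Suc i), Y (Suc i)) = step 0 (X i, Y i)"
    and "\<forall>\<^sub>F i in sequentially. X i \<noteq> 0" and "X \<longlonglongrightarrow> 0" "Y \<longlonglongrightarrow> 0"
    and "(\<lambda>i. w_in q (X i, Y i) - of_nat i) \<longlonglongrightarrow> fatou_in q \<psi> F\<^sub>0 p"
proof -
  have orb: "(\<lambda>i. (F\<^sub>0 ^^ i) p) \<longlonglongrightarrow> pt" using assms(1) by (rule basin_orbit)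
  show rec: "\<forall>\<^sub>F i in sequentially. (X (Suc i), Y (Suc i)) = step 0 (X i, Y i)"
    using eventually_W[OF orb] by eventually_elim (use normal_W[of 0] d_pos in \<open>simp add: X_def Y_def\<close>)
  show nz: "\<forall>\<^sub>F i in sequentially. X i \<noteq> 0" unfolding X_def using assms(1) by (rule basin_off_axis)
  show lim: "X \<longlonglongrightarrow> 0" "Y \<longlonglongrightarrow> 0" unfolding X_def Y_def using coordinates_tendsto[OF orb] by auto
  have "convergent (\<lambda>i. w_in q (X i, Y i) - of_nat i)"
    by (rule forward_Fatou_convergent[OF rec nz lim])
  then show "(\<lambda>i. w_in q (X i, Y i) - of_nat i) \<longlonglongrightarrow> fatou_in q \<psi> F\<^sub>0 p"
    by (simp add: convergent_LIMSEQ_iff fatou_in_def X_def Y_def)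
qed

text \<open>Near O the axis x = 0 is invariant in both directions, and on it the map does not
  increase |y|. A backward orbit on the axis that tends to O would therefore consist of O alone,
  which \<open>unstable_curve\<close> excludes; so x does not vanish.\<close>

lemma unstable_coordinates:
  assumes "p \<in> unstable_curve F\<^sub>0 pt"
  defines "X \<equiv> \<lambda>i. fst (\<psi> ((inv F\<^sub>0 ^^ i) p))" and "Y \<equiv> \<lambda>i. snd (\<psi> ((inv F\<^sub>0 ^^ i) p))"
  shows "\<forall>\<^sub>F i in sequentially. (X i, Y i) = step 0 (X (Suc i), Y (Suc i))"
    and "\<forall>\<^sub>F i in sequentially. X i \<noteq> 0" and "X \<longlonglongrightarrow> 0" "Y \<longlonglongrightarrow> 0"
    and "(\<lambda>i. w_out q (X i, Y i) + of_nat i) \<longlonglongrightarrow> fatou_out q \<psi> F\<^sub>0 p"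
proof -
  define Z where "Z i = (inv F\<^sub>0 ^^ i) p" for i
  have orb: "Z \<longlonglongrightarrow> pt" and ppt: "p \<noteq> pt" using assms(1) by (auto simp: unstable_curve_def Z_def[abs_def])
  have FZ: "F\<^sub>0 (Z (Suc i)) = Z i" for i
    using F_bij by (simp add: Z_def bij_is_surj surj_f_inv_f)
  have "\<forall>\<^sub>F i in sequentially. Z i \<in> W \<and> Z (Suc i) \<in> W"
    using eventually_conj[OF eventually_W[OF orb] eventually_W[OF LIMSEQ_Suc[OF orb]]] .
  then obtain i0 where i0: "\<And>i. i0 \<le> i \<Longrightarrow> Z i \<in> W" by (auto simp: eventually_sequentially)
  have XY: "\<psi> (Z i) = (X i, Y i)" for i by (simp add: X_def Y_def Z_def)
  have XYd: "cmod (X i) < d" "cmod (Y i) < d" if "i0 \<le> i" for i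
    using i0[OF that] XY[of i] by (auto simp: W_def)
  have rec0: "(X i, Y i) = step 0 (X (Suc i), Y (Suc i))" if "i0 \<le> i" for i
    using normal_W[of 0 "Z (Suc i)"] i0[of "Suc i"] that d_pos FZ[of i] XY by simp
  then show rec: "\<forall>\<^sub>F i in sequentially. (X i, Y i) = step 0 (X (Suc i), Y (Suc i))"
    by (auto simp: eventually_sequentially)
  show lim: "X \<longlonglongrightarrow> 0" "Y \<longlonglongrightarrow> 0"
    unfolding X_def Y_def using coordinates_tendsto[OF orb] by (auto simp: Z_def)
  have up: "X (Suc i) = 0 \<longleftrightarrow> X i = 0" if "i0 \<le> i" for i
  proof -
    have Xi: "X i = fst (step 0 (X (Suc i), Y (Suc i)))" using rec0[OF that] by (metis fst_conv)
    show ?thesis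
    proof
      assume "X (Suc i) = 0"
      then show "X i = 0" unfolding Xi by (simp add: step_def)
    next
      assume "X i = 0"
      then show "X (Suc i) = 0" using step_zero(1)[of "X (Suc i)" "Y (Suc i)"] XYd[of "Suc i"] that Xi by auto
    qed
  qed
  have nz0: "X i \<noteq> 0" if "i0 \<le> i" for i
  proof
    assume Xi: "X i = 0"
    have X0: "X l = 0" if "i \<le> l" for l
      using that
    proof (induction l rule: dec_induct)
      case (step l)
      then show ?case using up[of l] \<open>i0 \<le> i\<close> by simp
    qed (rule Xi)
    have Y_mono: "cmod (Y l) \<le> cmod (Y (Suc l))" if "i \<le> l" for l
    proof -
      have "cmod (Y l) = cmod (b 0 0 * Y (Suc l))"
        using rec0[of l] X0[of l] X0[of "Suc l"] that \<open>i0 \<le> i\<close> by (simp add: step_def)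
      also have "\<dots> \<le> 1 * cmod (Y (Suc l))"
        unfolding norm_mult using b_bound[of 0 0] lam d_pos by (intro mult_right_mono) auto
      finally show ?thesis by simp
    qed
    have "cmod (Y i) \<le> cmod (Y l)" if "i \<le> l" for l
      using that
    proof (induction l rule: dec_induct)
      case (step l)
      then show ?case using Y_mono[of l] by linarith
    qed simp
    then have "cmod (Y i) \<le> 0"
      using tendsto_lowerbound[OF tendsto_norm_zero[OF lim(2)], of "cmod (Y i)"]
      by (auto simp: eventually_sequentially)
    then have "\<psi> (Z i) = \<psi> pt" using XY[of i] \<open>X i = 0\<close> centre(2) by simp
    then have "Z i = pt" using \<psi>_inj i0[OF that] centre(1) by (auto simp: W_def inj_on_def)
    then have "p = (F\<^sub>0 ^^ i) pt" using F0_iter_inverse(2)[of i p] by (simp add: Z_def)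
    then show False using ppt F_iter_fixed by simp
  qed
  then show nz: "\<forall>\<^sub>F i in sequentially. X i \<noteq> 0" by (auto simp: eventually_sequentially)
  have "convergent (\<lambda>i. w_out q (X i, Y i) + of_nat i)"
    by (rule backward_Fatou_convergent[OF rec nz lim])
  then show "(\<lambda>i. w_out q (X i, Y i) + of_nat i) \<longlonglongrightarrow> fatou_out q \<psi> F\<^sub>0 p"
    by (simp add: convergent_LIMSEQ_iff fatou_out_def X_def Y_def)
qed

lemma fatou_out_inj: "inj_on (fatou_out q \<psi> F\<^sub>0) (unstable_curve F\<^sub>0 pt)"
proof (rule inj_onI)
  fix p p' assume p: "p \<in> unstable_curve F\<^sub>0 pt" and p': "p' \<in> unstable_curve F\<^sub>0 pt"
    and eq: "fatou_out q \<psi> F\<^sub>0 p = fatou_out q \<psi> F\<^sub>0 p'"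
  note c = unstable_coordinates[OF p]
  note c' = unstable_coordinates[OF p']
  have "\<forall>\<^sub>F i in sequentially. fst (\<psi> ((inv F\<^sub>0 ^^ i) p)) = fst (\<psi> ((inv F\<^sub>0 ^^ i) p'))
      \<and> snd (\<psi> ((inv F\<^sub>0 ^^ i) p)) = snd (\<psi> ((inv F\<^sub>0 ^^ i) p'))"
    by (rule backward_unique[OF c(1-4) c'(1-4) c(5) c'(5)[folded eq]])
  moreover have "\<forall>\<^sub>F i in sequentially. (inv F\<^sub>0 ^^ i) p \<in> W"
    using p by (intro eventually_W) (simp add: unstable_curve_def)
  moreover have "\<forall>\<^sub>F i in sequentially. (inv F\<^sub>0 ^^ i) p' \<in> W"
    using p' by (intro eventually_W) (simp add: unstable_curve_def)
  ultimately have "\<forall>\<^sub>F i in sequentially. (inv F\<^sub>0 ^^ i) p = (inv F\<^sub>0 ^^ i) p'"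
    by eventually_elim (use \<psi>_inj in \<open>auto simp: W_def inj_on_def prod_eq_iff\<close>)
  then obtain i where "(inv F\<^sub>0 ^^ i) p = (inv F\<^sub>0 ^^ i) p'"
    by (auto simp: eventually_sequentially)
  then show "p = p'" by (metis F0_iter_inverse(2))
qed

text \<open>Injectivity makes \<open>inv_into\<close> independent of any choice, so exhibiting one
  preimage on the curve determines the value.\<close>

lemma T_map_eqI:
  assumes "p' \<in> unstable_curve F\<^sub>0 pt" "fatou_out q \<psi> F\<^sub>0 p' = fatou_in q \<psi> F\<^sub>0 p + \<alpha>"
  shows "T_map q \<psi> F\<^sub>0 pt \<alpha> p = p'"
  unfolding T_map_def assms(2)[symmetric] using fatou_out_inj assms(1) by (rule inv_into_f_f)

end

section \<open>Limits of perturbed orbits along subsequences\<close>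

context semiparabolic_germ
begin

text \<open>The initial points vary with j, so that uniformity on compact sets can be deduced by
  compactness. A subsequence is enough: its limit is identified through the Fatou coordinates and
  does not depend on the subsequence.\<close>

lemma perturbed_orbit_subsequence:
  fixes e :: "nat \<Rightarrow> complex" and n :: "nat \<Rightarrow> nat" and p :: "nat \<Rightarrow> 'm"
  assumes e: "\<And>j. e j \<noteq> 0" "e \<longlonglongrightarrow> 0" and n: "filterlim n at_top sequentially"
    and phase: "(\<lambda>j. of_nat (n j) - complex_of_real pi / e j) \<longlonglongrightarrow> \<alpha>"
    and p: "p \<longlonglongrightarrow> p\<^sub>0" "p\<^sub>0 \<in> basin F\<^sub>0 pt"
  shows "\<exists>s. strict_mono s \<and> (\<lambda>j. (F (e (s j)) ^^ n (s j)) (p (s j))) \<longlonglongrightarrow> T_map q \<psi> F\<^sub>0 pt \<alpha> p\<^sub>0"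
proof -
  define X where "X i = fst (\<psi> ((F\<^sub>0 ^^ i) p\<^sub>0))" for i
  define Y where "Y i = snd (\<psi> ((F\<^sub>0 ^^ i) p\<^sub>0))" for i
  define \<phi> where "\<phi> = fatou_in q \<psi> F\<^sub>0 p\<^sub>0"
  have bc: "\<forall>\<^sub>F i in sequentially. (X (Suc i), Y (Suc i)) = step 0 (X i, Y i)"
    "\<forall>\<^sub>F i in sequentially. X i \<noteq> 0" "X \<longlonglongrightarrow> 0" "Y \<longlonglongrightarrow> 0"
    "(\<lambda>i. w_in q (X i, Y i) - of_nat i) \<longlonglongrightarrow> \<phi>"
    unfolding X_def[abs_def] Y_def[abs_def] \<phi>_def by (rule basin_coordinates[OF p(2)])+
  define z where "z N j = \<psi> ((F (e j) ^^ N) (p j))" for N j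
  define R where "R = G + 6"
  have "\<forall>\<^sub>F N in sequentially. (F\<^sub>0 ^^ N) p\<^sub>0 \<in> W"
    using basin_orbit[OF p(2)] by (rule eventually_W)
  then obtain N1 where N1: "\<And>N. N1 \<le> N \<Longrightarrow> (F\<^sub>0 ^^ N) p\<^sub>0 \<in> U"
    by (auto simp: eventually_sequentially W_def)
  have FN: "(\<lambda>j. (F (e j) ^^ N) (p j)) \<longlonglongrightarrow> (F\<^sub>0 ^^ N) p\<^sub>0" for N
    using e(2) p(1) by (rule F_iter_tendsto)
  have z: "z N \<longlonglongrightarrow> (X N, Y N)" if "N1 \<le> N" for N
    using \<psi>_tendsto[OF FN N1[OF that]] by (simp add: z_def[abs_def] X_def Y_def)
  then have z': "\<forall>\<^sub>F N in sequentially. z N \<longlonglongrightarrow> (X N, Y N)"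
    by (auto simp: eventually_sequentially)
  \<comment> \<open>The entrance time depends on \<open>m\<close>. \<open>Q\<close> describes the
    orbit \<open>m\<close> steps before its end without mentioning that time, so that all
    \<open>m\<close> can be treated along one sequence.\<close>
  define Q where "Q m j \<longleftrightarrow> m \<le> n j \<and> (F (e j) ^^ (n j - m)) (p j) \<in> W \<and> exit_point m (e j) (z (n j - m) j) (\<phi> + \<alpha>)"
    for m j
  obtain M where M: "\<And>m. M \<le> m \<Longrightarrow> 0 < m \<and> (\<forall>\<^sub>F j in sequentially. Q m j)"
  proof -
    have ed: "\<forall>\<^sub>F j in sequentially. cmod (e j) < d"
      using tendstoD[OF e(2) d_pos] by simp
    obtain M where M: "\<forall>m\<ge>M. 0 < m \<and> (\<exists>N\<ge>N1. \<forall>\<^sub>F j in sequentially. passes N m (n j) (e j) (z N j) (\<phi> + \<alpha>))"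
      by (rule transit_limit[OF bc(1-4) bc(5) e n phase z', of N1])
    have "0 < m \<and> (\<forall>\<^sub>F j in sequentially. Q m j)" if m: "M \<le> m" for m
    proof -
      obtain N where N: "N1 \<le> N" and ev: "\<forall>\<^sub>F j in sequentially. passes N m (n j) (e j) (z N j) (\<phi> + \<alpha>)"
        using M m by blast
      have "\<forall>\<^sub>F j in sequentially. Q m j"
        using ev ed eventually_in_U[OF FN N1[OF N]]
      proof eventually_elim
        case (elim j)
        then have box: "cmod (fst ((step (e j) ^^ (k - N)) (z N j))) < d \<and> cmod (snd ((step (e j) ^^ (k - N)) (z N j))) < d"
          if "N \<le> k" "k \<le> n j - m" for k using that by (simp add: passes_def)
        have Nm: "N \<le> n j - m" "m \<le> n j" using elim(1) unfolding passes_def by linarith+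
        have loc: "(F (e j) ^^ (n j - m - N)) ((F (e j) ^^ N) (p j)) \<in> U \<and>
           \<psi> ((F (e j) ^^ (n j - m - N)) ((F (e j) ^^ N) (p j))) = (step (e j) ^^ (n j - m - N)) (z N j)"
          unfolding z_def
        proof (rule F_iter_local[OF elim(2,3)])
          fix i assume "i < n j - m - N"
          then show "cmod (fst ((step (e j) ^^ i) (\<psi> ((F (e j) ^^ N) (p j))))) < d \<and>
              cmod (snd ((step (e j) ^^ i) (\<psi> ((F (e j) ^^ N) (p j))))) < d"
            using box[of "N + i"] by (simp add: z_def)
        qed
        have "(F (e j) ^^ (n j - m - N)) ((F (e j) ^^ N) (p j)) = (F (e j) ^^ (n j - m - N + N)) (p j)"
          by (simp only: funpow_add comp_apply)
        also have "n j - m - N + N = n j - m" using Nm by simp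
        finally have zz: "(F (e j) ^^ (n j - m)) (p j) \<in> U" "z (n j - m) j = (step (e j) ^^ (n j - m - N)) (z N j)"
          using loc by (simp_all add: z_def)
        have "(F (e j) ^^ (n j - m)) (p j) \<in> W"
          using zz box[OF Nm(1) order_refl] by (simp add: W_def z_def)
        then show ?case using elim(1) Nm(2) unfolding Q_def zz(2) passes_def by blast
      qed
      then show ?thesis using M m by blast
    qed
    then show ?thesis by (rule that)
  qed
  define u where "u m j = z (n j - m) j" for m j
  have udisc: "\<forall>\<^sub>F j in sequentially. u m j \<in> cball 0 d \<times> cball 0 d" if "M \<le> m" for m
  proof -
    have "\<forall>\<^sub>F j in sequentially. Q m j" using M[OF that] by blast
    then show ?thesis
    proof eventually_elim
      case (elim j)
      then have "cmod (fst (u m j)) < d" "cmod (snd (u m j)) < d" by (auto simp: Q_def W_def u_def z_def)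
      then show ?case by (auto simp: mem_Times_iff)
    qed
  qed
  define P where "P i s \<longleftrightarrow> (\<exists>l. (\<lambda>j. u (M + i) (s j)) \<longlonglongrightarrow> l)" for i and s :: "nat \<Rightarrow> nat"
  interpret subseqs P
  proof
    fix i and s :: "nat \<Rightarrow> nat" assume s: "strict_mono s"
    define K0 where "K0 = cball (0::complex) d \<times> cball (0::complex) d"
    \<comment> \<open>Membership in the compact set holds only from some index on; the default
      \<open>(0, 0)\<close> repairs the finitely many other terms.\<close>
    define u' where "u' j = (if u (M + i) (s j) \<in> K0 then u (M + i) (s j) else (0, 0))" for j
    have "compact K0" unfolding K0_def by (intro compact_Times compact_cball)
    moreover have "\<forall>j. u' j \<in> K0" using d_pos by (simp add: u'_def K0_def)
    ultimately obtain l r where r: "strict_mono r" "(u' \<circ> r) \<longlonglongrightarrow> l"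
      by (rule seq_compactE[OF compact_imp_seq_compact])
    have "\<forall>\<^sub>F j in sequentially. u (M + i) j \<in> K0" using udisc[of "M + i"] by (simp add: K0_def)
    from eventually_subseq[OF strict_mono_o[OF s r(1)] this]
    have "\<forall>\<^sub>F j in sequentially. (u' \<circ> r) j = u (M + i) ((s \<circ> r) j)"
      by eventually_elim (simp add: u'_def)
    with r(2) have "(\<lambda>j. u (M + i) ((s \<circ> r) j)) \<longlonglongrightarrow> l" by (rule Lim_transform_eventually)
    then show "\<exists>r'. strict_mono r' \<and> P i (s \<circ> r')" using r(1) unfolding P_def by blast
  qed
  define D where "D = diagseq"
  have D: "strict_mono D" unfolding D_def by (rule subseq_diagseq)
  have "\<exists>l. (\<lambda>j. u (M + i) (D j)) \<longlonglongrightarrow> l" for i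
  proof -
    have "P i (diagseq \<circ> ((+) (Suc i)))"
    proof (rule diagseq_holds)
      fix r s :: "nat \<Rightarrow> nat" and k assume r: "strict_mono r" and "P k s"
      then obtain l where "(\<lambda>j. u (M + k) (s j)) \<longlonglongrightarrow> l" unfolding P_def by blast
      from LIMSEQ_subseq_LIMSEQ[OF this r] show "P k (s \<circ> r)" unfolding P_def o_def by blast
    qed
    \<comment> \<open>Only after its first terms are dropped is the diagonal sequence a subsequence
      of the i-th one; the limit is not affected.\<close>
    then obtain l where "(\<lambda>j. u (M + i) (D (j + Suc i))) \<longlonglongrightarrow> l" by (auto simp: P_def D_def add.commute)
    then have "(\<lambda>j. u (M + i) (D j)) \<longlonglongrightarrow> l" by (rule LIMSEQ_offset)
    then show ?thesis ..
  qed
  note limit = this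
  have "\<forall>m. \<exists>l. M \<le> m \<longrightarrow> (\<lambda>j. u m (D j)) \<longlonglongrightarrow> l"
  proof
    fix m show "\<exists>l. M \<le> m \<longrightarrow> (\<lambda>j. u m (D j)) \<longlonglongrightarrow> l"
      using limit[of "m - M"] by (cases "M \<le> m") auto
  qed
  from choice[OF this] obtain L where L: "\<And>m. M \<le> m \<Longrightarrow> (\<lambda>j. u m (D j)) \<longlonglongrightarrow> L m" by blast
  have QD: "\<forall>\<^sub>F j in sequentially. Q m (D j)" if "M \<le> m" for m
    using eventually_subseq[OF D, of "Q m"] M[OF that] by blast
  have eD: "\<And>j. e (D j) \<noteq> 0" "(\<lambda>j. e (D j)) \<longlonglongrightarrow> 0"
    using e LIMSEQ_subseq_LIMSEQ[OF e(2) D] by (auto simp: o_def)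
  have Lm: "fst (L m) \<noteq> 0" "cmod (1 / fst (L m) - of_nat m) \<le> real m / 2"
    "cmod (w_out q (L m) + of_nat m - (\<phi> + \<alpha>)) \<le> R / real m" "cmod (snd (L m)) \<le> R / real m" if m: "M \<le> m" for m
  proof -
    obtain J where J: "\<And>j. J \<le> j \<Longrightarrow> Q m (D j)" using QD[OF m] by (auto simp: eventually_sequentially)
    \<comment> \<open>Dropping \<open>J\<close> terms makes \<open>Q m\<close> hold at every index,
      as the choice of \<open>v\<close> requires.\<close>
    define s where "s j = D (j + J)" for j
    have Qs: "Q m (s j)" for j using J by (simp add: s_def)
    have Ls: "(\<lambda>j. u m (s j)) \<longlonglongrightarrow> L m"
      unfolding s_def using L[OF m] by (rule LIMSEQ_ignore_initial_segment)
    have es: "\<And>j. e (s j) \<noteq> 0" "(\<lambda>j. e (s j)) \<longlonglongrightarrow> 0"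
      using e(1) LIMSEQ_ignore_initial_segment[OF eD(2), of J] by (auto simp: s_def)
    have nes: "(\<lambda>j. of_nat (n (s j)) * e (s j)) \<longlonglongrightarrow> of_real pi"
      using LIMSEQ_ignore_initial_segment[OF LIMSEQ_subseq_LIMSEQ[OF parameter_times_time[OF e phase] D], of J]
      by (simp add: s_def o_def)
    have "\<exists>v. \<forall>j. cmod (v j + of_nat m) \<le> real m / 2 \<and> fst (u m (s j)) = - e (s j) * cos (e (s j) * v j) / sin (e (s j) * v j) \<and>
        cmod (v j + q * (Ln (- sin (e (s j) * v j)) - Ln (e (s j))) + of_nat m - (\<phi> + \<alpha>)) \<le> R / real m"
      by (rule choice) (use Qs in \<open>auto simp: Q_def u_def R_def exit_point_def\<close>)
    then obtain v where v: "\<And>j. cmod (v j + of_nat m) \<le> real m / 2"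
      "\<And>j. fst (u m (s j)) = - e (s j) * cos (e (s j) * v j) / sin (e (s j) * v j)"
      "\<And>j. cmod (v j + q * (Ln (- sin (e (s j) * v j)) - Ln (e (s j))) + of_nat m - (\<phi> + \<alpha>)) \<le> R / real m"
      by blast
    have m0: "0 < m" using M[OF m] by blast
    note ol = outgoing_limit[OF es nes m0 v(1) tendsto_fst[OF Ls] v(2,3)]
    show "fst (L m) \<noteq> 0" "cmod (1 / fst (L m) - of_nat m) \<le> real m / 2" by (fact ol(1), fact ol(2))
    show "cmod (w_out q (L m) + of_nat m - (\<phi> + \<alpha>)) \<le> R / real m"
      using ol(3)[of "snd (L m)"] by simp
    show "cmod (snd (L m)) \<le> R / real m"
      by (rule LIMSEQ_le_const2[OF tendsto_norm[OF tendsto_snd[OF Ls]]]) (use Qs in \<open>auto simp: Q_def u_def R_def exit_point_def\<close>)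
  qed
  have Lx: "cmod (fst (L m)) \<le> 2 / real m" if m: "M \<le> m" for m
  proof -
    have m0: "0 < real m" using M[OF m] by simp
    have "real m / 2 \<le> cmod (1 / fst (L m))"
      using norm_triangle_ineq2[of "of_nat m" "of_nat m - 1 / fst (L m)"] Lm(2)[OF m]
      by (simp add: norm_minus_commute)
    then show ?thesis using m0 Lm(1)[OF m] by (simp add: norm_divide field_simps)
  qed
  have Llim: "L \<longlonglongrightarrow> (0, 0)"
  proof -
    have "(\<lambda>m. fst (L m)) \<longlonglongrightarrow> 0"
      using Lx by (intro Lim_null_comparison[OF _ lim_const_over_n[of 2]]) (auto simp: eventually_sequentially)
    moreover have "(\<lambda>m. snd (L m)) \<longlonglongrightarrow> 0"
      using Lm(4) by (intro Lim_null_comparison[OF _ lim_const_over_n[of R]]) (auto simp: eventually_sequentially)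
    ultimately have "(\<lambda>m. (fst (L m), snd (L m))) \<longlonglongrightarrow> (0, 0)" by (rule tendsto_Pair)
    then show ?thesis by simp
  qed
  have "\<forall>\<^sub>F m in sequentially. cmod (fst (L m)) < d \<and> cmod (snd (L m)) < d"
    using eventually_in_polydisc tendsto_fst[OF Llim] tendsto_snd[OF Llim] by simp
  then have "\<forall>\<^sub>F m in sequentially. M \<le> m \<and> cmod (fst (L m)) < d \<and> cmod (snd (L m)) < d"
    using eventually_ge_at_top[of M] by eventually_elim simp
  then obtain M2 where M2: "\<And>m. M2 \<le> m \<Longrightarrow> M \<le> m \<and> cmod (fst (L m)) < d \<and> cmod (snd (L m)) < d"
    by (auto simp: eventually_sequentially)
  define Z where "Z m = \<psi>' (L m)" for m
  have \<psi>Z: "\<psi> (Z m) = L m" if "M2 \<le> m" for m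
    using \<psi>'_polydisc(2)[of "fst (L m)" "snd (L m)"] M2[OF that] by (simp add: Z_def)
  have FZ: "(\<lambda>j. (F (e (D j)) ^^ (n (D j) - m)) (p (D j))) \<longlonglongrightarrow> Z m" if m: "M2 \<le> m" for m
  proof -
    have "(\<lambda>j. u m (D j)) \<longlonglongrightarrow> (fst (L m), snd (L m))" using L M2[OF m] by simp
    then have "(\<lambda>j. \<psi>' (u m (D j))) \<longlonglongrightarrow> \<psi>' (fst (L m), snd (L m))"
      using M2[OF m] by (intro \<psi>'_tendsto) auto
    moreover have "\<forall>\<^sub>F j in sequentially. \<psi>' (u m (D j)) = (F (e (D j)) ^^ (n (D j) - m)) (p (D j))"
      using QD[of m] M2[OF m] by (auto elim!: eventually_mono simp: Q_def W_def u_def z_def \<psi>'_\<psi>)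
    ultimately show ?thesis by (simp add: Z_def Lim_transform_eventually)
  qed
  have advance: "(\<lambda>j. (F (e (D j)) ^^ (n (D j) - (m - k))) (p (D j))) \<longlonglongrightarrow> (F\<^sub>0 ^^ k) (Z m)" if m: "M2 \<le> m" "k \<le> m" for m k
  proof -
    have "(\<lambda>j. (F (e (D j)) ^^ k) ((F (e (D j)) ^^ (n (D j) - m)) (p (D j)))) \<longlonglongrightarrow> (F\<^sub>0 ^^ k) (Z m)"
      using eD(2) FZ[OF m(1)] by (rule F_iter_tendsto)
    moreover have "\<forall>\<^sub>F j in sequentially. (F (e (D j)) ^^ k) ((F (e (D j)) ^^ (n (D j) - m)) (p (D j)))
      = (F (e (D j)) ^^ (n (D j) - (m - k))) (p (D j))"
      using QD[OF conjunct1[OF M2[OF m(1)]]]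
    proof eventually_elim
      case (elim j)
      then have "m \<le> n (D j)" by (simp add: Q_def)
      then have "n (D j) - (m - k) = k + (n (D j) - m)" using m(2) by simp
      then show "(F (e (D j)) ^^ k) ((F (e (D j)) ^^ (n (D j) - m)) (p (D j)))
        = (F (e (D j)) ^^ (n (D j) - (m - k))) (p (D j))" by (simp only: funpow_add comp_apply)
    qed
    ultimately show ?thesis by (rule Lim_transform_eventually)
  qed
  \<comment> \<open>The end of the orbit may lie outside the chart; it is reached from
    \<open>M2\<close> steps before by continuity of the family. Any larger number of steps leads to
    the same limit, which makes the points \<open>Z m\<close> a backward orbit of it.\<close>
  define z0 where "z0 = (F\<^sub>0 ^^ M2) (Z M2)"
  have lim0: "(\<lambda>j. (F (e (D j)) ^^ n (D j)) (p (D j))) \<longlonglongrightarrow> z0"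
    using advance[of M2 M2] by (simp add: z0_def)
  have inv: "(inv F\<^sub>0 ^^ m) z0 = Z m" if "M2 \<le> m" for m
  proof -
    have "(\<lambda>j. (F (e (D j)) ^^ n (D j)) (p (D j))) \<longlonglongrightarrow> (F\<^sub>0 ^^ m) (Z m)"
      using advance[OF that order_refl] by simp
    then have "z0 = (F\<^sub>0 ^^ m) (Z m)" using lim0 LIMSEQ_unique by blast
    then show ?thesis using F0_iter_inverse(1) by simp
  qed
  have Zlim: "Z \<longlonglongrightarrow> pt"
    using \<psi>'_tendsto[OF Llim] d_pos by (simp add: Z_def[abs_def] \<psi>'_pt)
  have ev: "\<forall>\<^sub>F m in sequentially. Z m = (inv F\<^sub>0 ^^ m) z0"
    using eventually_ge_at_top[of M2] by eventually_elim (simp add: inv)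
  have "(\<lambda>m. (inv F\<^sub>0 ^^ m) z0) \<longlonglongrightarrow> pt"
    using Zlim ev by (rule Lim_transform_eventually)
  moreover have "z0 \<noteq> pt"
  proof
    assume "z0 = pt"
    then have "Z M2 = pt" using inv[of M2] F0_iter_inverse(1)[of M2 pt] F_iter_fixed by simp
    then have "L M2 = (0, 0)" using \<psi>Z[of M2] centre by simp
    then show False using Lm(1)[of M2] M2[of M2] by simp
  qed
  ultimately have z0: "z0 \<in> unstable_curve F\<^sub>0 pt" by (simp add: unstable_curve_def)
  have "(\<lambda>m. w_out q (\<psi> ((inv F\<^sub>0 ^^ m) z0)) + of_nat m) \<longlonglongrightarrow> \<phi> + \<alpha>"
  proof -
    \<comment> \<open>For fixed \<open>m\<close> the outgoing coordinate is known only up to R / m;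
      going backwards along the orbit removes this error.\<close>
    have "(\<lambda>m. w_out q (L m) + of_nat m - (\<phi> + \<alpha>)) \<longlonglongrightarrow> 0"
      using Lm(3) by (intro Lim_null_comparison[OF _ lim_const_over_n[of R]]) (auto simp: eventually_sequentially)
    then have "(\<lambda>m. w_out q (L m) + of_nat m) \<longlonglongrightarrow> \<phi> + \<alpha>" by (rule LIM_zero_cancel)
    moreover have "\<forall>\<^sub>F m in sequentially. w_out q (L m) + of_nat m = w_out q (\<psi> ((inv F\<^sub>0 ^^ m) z0)) + of_nat m"
      using eventually_ge_at_top[of M2] by eventually_elim (simp add: inv \<psi>Z)
    ultimately show ?thesis by (rule Lim_transform_eventually)
  qed
  then have "fatou_out q \<psi> F\<^sub>0 z0 = \<phi> + \<alpha>" unfolding fatou_out_def by (rule limI)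
  then have "T_map q \<psi> F\<^sub>0 pt \<alpha> p\<^sub>0 = z0" using z0 by (intro T_map_eqI) (simp_all add: \<phi>_def)
  then show ?thesis using D lim0 by blast
qed

end

text \<open>If uniformity fails, compactness gives points \<open>x j\<close> tending to
  \<open>x0\<close> where \<open>f\<close> stays away from \<open>g (x j)\<close>, although it tends
  to \<open>g x0\<close> along a subsequence. The contradiction requires \<open>g (x j)\<close> to
  tend to \<open>g x0\<close> as well; this too is extracted from \<open>sub\<close>, which is why
  \<open>sub\<close> admits moving points.\<close>

lemma uniform_limit_from_subsequences:
  fixes f :: "nat \<Rightarrow> 'a::metric_space \<Rightarrow> 'b::metric_space"
  assumes K: "compact K"
    and sub: "\<And>s x x0. strict_mono s \<Longrightarrow> (\<And>j. x j \<in> K) \<Longrightarrow> x0 \<in> K \<Longrightarrow> x \<longlonglongrightarrow> x0 \<Longrightarrow>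
      \<exists>r. strict_mono r \<and> (\<lambda>j. f (s (r j)) (x (r j))) \<longlonglongrightarrow> g x0"
  shows "uniform_limit K f g sequentially"
proof (rule ccontr)
  assume "\<not> uniform_limit K f g sequentially"
  then obtain \<eta> where \<eta>: "0 < \<eta>" "\<not> (\<forall>\<^sub>F j in sequentially. \<forall>x\<in>K. dist (f j x) (g x) < \<eta>)"
    by (auto simp: uniform_limit_iff)
  then have "infinite {j. \<exists>x\<in>K. \<eta> \<le> dist (f j x) (g x)}"
    unfolding eventually_sequentially infinite_nat_iff_unbounded_le by (auto simp: not_less) 
  from infinite_enumerate[OF this]
  obtain s0 :: "nat \<Rightarrow> nat" where s0: "strict_mono s0" "\<forall>j. s0 j \<in> {j. \<exists>x\<in>K. \<eta> \<le> dist (f j x) (g x)}" by blast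
  from s0(2) have "\<forall>j. \<exists>x. x \<in> K \<and> \<eta> \<le> dist (f (s0 j) x) (g x)" by auto
  from choice[OF this]
  obtain y where y: "\<And>j. y j \<in> K" "\<And>j. \<eta> \<le> dist (f (s0 j) (y j)) (g (y j))" by blast
  have "\<forall>j. y j \<in> K" using y(1) ..
  then obtain x0 r0 where r0: "x0 \<in> K" "strict_mono r0" "(y \<circ> r0) \<longlonglongrightarrow> x0"
    by (rule seq_compactE[OF compact_imp_seq_compact[OF K]])
  define s where "s = s0 \<circ> r0"
  define x where "x = y \<circ> r0"
  have s: "strict_mono s" unfolding s_def using s0(1) r0(2) by (rule strict_mono_o)
  have x: "\<And>j. x j \<in> K" "x \<longlonglongrightarrow> x0" "\<And>j. \<eta> \<le> dist (f (s j) (x j)) (g (x j))"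
    using y r0 by (auto simp: x_def s_def)
  text \<open>\<open>g\<close> is continuous along \<open>x\<close>, because \<open>g (x j)\<close> is approximated by \<open>f (t j) (x j)\<close>.\<close>
  have near: "\<exists>l>k. dist (f l (x j)) (g (x j)) < inverse (real (Suc j))" for j k
  proof -
    obtain r where r: "strict_mono r" "(\<lambda>i. f (id (r i)) (x j)) \<longlonglongrightarrow> g (x j)"
      using sub[of id "\<lambda>_. x j" "x j"] x(1) by (auto simp: strict_mono_id)
    have "\<forall>\<^sub>F i in sequentially. dist (f (r i) (x j)) (g (x j)) < inverse (real (Suc j)) \<and> Suc k \<le> i"
    proof -
      have "0 < inverse (real (Suc j))" by simp
      from tendstoD[OF r(2) this] eventually_ge_at_top[of "Suc k"]
      show ?thesis by eventually_elim simp
    qed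
    then obtain i where i: "dist (f (r i) (x j)) (g (x j)) < inverse (real (Suc j))" "Suc k \<le> i"
      by (auto simp: eventually_sequentially)
    then have "k < r i" using seq_suble[OF r(1), of i] by linarith
    then show ?thesis using i(1) by blast
  qed
  \<comment> \<open>\<open>t\<close> must increase strictly to count as a subsequence in
    \<open>sub\<close>; \<open>near\<close> supplies suitable indices beyond any bound.\<close>
  have "\<exists>t. \<forall>j. dist (f (t j) (x j)) (g (x j)) < inverse (real (Suc j)) \<and> t j < t (Suc j)"
    by (rule dependent_nat_choice) (use near in blast)+
  then obtain t where t: "\<And>j. dist (f (t j) (x j)) (g (x j)) < inverse (real (Suc j))" "\<And>j. t j < t (Suc j)"
    by blast
  then have tm: "strict_mono t" by (simp add: strict_mono_Suc_iff)
  obtain r1 where r1: "strict_mono r1" "(\<lambda>j. f (s (r1 j)) (x (r1 j))) \<longlonglongrightarrow> g x0"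
    using sub[OF s x(1) r0(1) x(2)] by blast
  have "(\<lambda>j. x (r1 j)) \<longlonglongrightarrow> x0" using LIMSEQ_subseq_LIMSEQ[OF x(2) r1(1)] by (simp add: o_def)
  from sub[OF strict_mono_o[OF tm r1(1)] _ r0(1) this] x(1)
  obtain r2 where r2: "strict_mono r2" "(\<lambda>j. f (t (r1 (r2 j))) (x (r1 (r2 j)))) \<longlonglongrightarrow> g x0"
    by auto
  define c where "c = (\<lambda>j. r1 (r2 j))"
  have c: "strict_mono c" unfolding c_def using strict_mono_o[OF r1(1) r2(1)] by (simp add: o_def)
  have 1: "(\<lambda>j. f (s (c j)) (x (c j))) \<longlonglongrightarrow> g x0"
    using LIMSEQ_subseq_LIMSEQ[OF r1(2) r2(1)] by (simp add: o_def c_def)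
  have 2: "(\<lambda>j. f (t (c j)) (x (c j))) \<longlonglongrightarrow> g x0" using r2(2) by (simp add: c_def)
  have "(\<lambda>j. dist (g (x (c j))) (g x0)) \<longlonglongrightarrow> 0"
  proof (rule Lim_null_comparison)
    show "\<forall>\<^sub>F j in sequentially. norm (dist (g (x (c j))) (g x0))
        \<le> inverse (real (Suc (c j))) + dist (f (t (c j)) (x (c j))) (g x0)"
    proof (intro always_eventually allI)
      fix j
      show "norm (dist (g (x (c j))) (g x0)) \<le> inverse (real (Suc (c j))) + dist (f (t (c j)) (x (c j))) (g x0)"
        using dist_triangle3[of "g (x (c j))" "g x0" "f (t (c j)) (x (c j))"] t(1)[of "c j"] by simp
    qed
    have "(\<lambda>j. inverse (real (Suc (c j)))) \<longlonglongrightarrow> 0"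
      using LIMSEQ_subseq_LIMSEQ[OF LIMSEQ_inverse_real_of_nat c] by (simp add: o_def)
    from tendsto_add[OF this tendsto_dist[OF 2 tendsto_const[of "g x0"]]]
    show "(\<lambda>j. inverse (real (Suc (c j))) + dist (f (t (c j)) (x (c j))) (g x0)) \<longlonglongrightarrow> 0" by simp
  qed
  then have "(\<lambda>j. g (x (c j))) \<longlonglongrightarrow> g x0" by (simp add: tendsto_dist_iff[symmetric])
  from tendsto_dist[OF 1 this] have "(\<lambda>j. dist (f (s (c j)) (x (c j))) (g (x (c j)))) \<longlonglongrightarrow> 0" by simp
  then have "\<eta> \<le> 0" by (rule LIMSEQ_le_const) (use x(3) in blast)
  then show False using \<eta>(1) by simp
qed

section \<open>Reduction to the local model\<close>

lemma cholomorphic_on_isCont: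
  assumes "f cholomorphic_on S" "z \<in> S" shows "isCont f z"
  using assms unfolding cholomorphic_on_def by (meson has_derivative_continuous)

lemma cholomorphic_on_along_curve:
  fixes f :: "'a::complex_normed_vector \<Rightarrow> complex"
  assumes f: "f cholomorphic_on S" and g: "(g has_derivative (\<lambda>h. h *\<^sub>C c)) (at z)" "g z \<in> S"
  shows "(\<lambda>z. f (g z)) field_differentiable at z"
proof -
  obtain D where D: "(f has_derivative D) (at (g z))" "\<And>c v. D (c *\<^sub>C v) = c *\<^sub>C D v"
    using f g(2) unfolding cholomorphic_on_def by blast
  have "((\<lambda>z. f (g z)) has_derivative (\<lambda>h. D (h *\<^sub>C c))) (at z)"
    using has_derivative_compose[OF g(1) D(1)] .
  moreover have "(\<lambda>h. D (h *\<^sub>C c)) = (*) (D c)"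
    by (simp add: fun_eq_iff D(2) scaleC_complex_def mult.commute)
  ultimately show ?thesis by (auto simp: field_differentiable_def has_field_derivative_def)
qed

lemma holomorphic_on_cholomorphic_pair:
  fixes f :: "complex \<times> complex \<Rightarrow> complex"
  assumes "f cholomorphic_on T" "open S" "u holomorphic_on S" "v holomorphic_on S"
    and "\<And>z. z \<in> S \<Longrightarrow> (u z, v z) \<in> T"
  shows "(\<lambda>z. f (u z, v z)) holomorphic_on S"
  unfolding holomorphic_on_def
proof (rule ballI, rule field_differentiable_at_within)
  fix z assume z: "z \<in> S"
  obtain u' v' where "(u has_field_derivative u') (at z)" "(v has_field_derivative v') (at z)"
    using holomorphic_on_imp_differentiable_at[OF assms(3,2) z] holomorphic_on_imp_differentiable_at[OF assms(4,2) z]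
    unfolding field_differentiable_def by blast
  moreover have "(\<lambda>h. h * c) = (*) c" for c :: complex by (simp add: fun_eq_iff mult.commute)
  ultimately have "(u has_derivative (\<lambda>h. h * u')) (at z)" "(v has_derivative (\<lambda>h. h * v')) (at z)"
    by (simp_all only: has_field_derivative_def)
  from has_derivative_Pair[OF this]
  have "((\<lambda>z. (u z, v z)) has_derivative (\<lambda>h. h *\<^sub>C (u', v'))) (at z)"
    by (simp add: scaleC_prod_def scaleC_complex_def)
  then show "(\<lambda>z. f (u z, v z)) field_differentiable at z"
    using assms(5)[OF z] by (rule cholomorphic_on_along_curve[OF assms(1)])
qed

lemma cholomorphic_slice:
  fixes f :: "complex \<times> complex \<times> complex \<Rightarrow> complex"
  assumes "f cholomorphic_on (E \<times> T)" "e \<in> E"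
  shows "(\<lambda>w. f (e, w)) cholomorphic_on T"
  unfolding cholomorphic_on_def
proof
  fix w assume "w \<in> T"
  then obtain D where D: "(f has_derivative D) (at (e, w))" "\<And>c v. D (c *\<^sub>C v) = c *\<^sub>C D v"
    using assms unfolding cholomorphic_on_def by blast
  have "((\<lambda>w. (e, w)) has_derivative (\<lambda>h. (0, h))) (at w)"
    by (intro derivative_intros)
  from has_derivative_compose[OF this, of f D] D(1)
  have "((\<lambda>w. f (e, w)) has_derivative (\<lambda>h. D (0, h))) (at w)" by simp
  moreover have "D (0, c *\<^sub>C v) = c *\<^sub>C D (0, v)" for c v
    using D(2)[of c "(0, v)"] by (simp add: scaleC_prod_def scaleC_complex_def)
  ultimately show "\<exists>D. ((\<lambda>w. f (e, w)) has_derivative D) (at w) \<and> (\<forall>c v. D (c *\<^sub>C v) = c *\<^sub>C D v)"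
    by blast
qed

text \<open>Around each point of the half disc a disc of radius R / 2 fits into the full one, so
  Cauchy's inequality bounds the derivative by 2 M / R.\<close>

lemma bounded_holomorphic_lipschitz:
  assumes f: "f holomorphic_on ball 0 R" and M: "\<And>z. z \<in> ball 0 R \<Longrightarrow> cmod (f z) \<le> M"
    and x: "x \<in> ball 0 (R / 2)" "x' \<in> ball 0 (R / 2)"
  shows "cmod (f x - f x') \<le> 2 * M / R * cmod (x - x')"
proof (rule field_differentiable_bound[OF convex_ball _ _ x])
  have R: "0 < R" using x(1) norm_ge_zero[of x] unfolding mem_ball_0 by linarith
  fix z :: complex assume z: "z \<in> ball 0 (R / 2)"
  then have "z \<in> ball 0 R" using R by simp
  then show "(f has_field_derivative deriv f z) (at z within ball 0 (R / 2))"
    by (rule has_field_derivative_at_within[OF holomorphic_derivI[OF f open_ball]])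
  have sub: "cball z (R / 2) \<subseteq> ball 0 R"
  proof
    fix y assume "y \<in> cball z (R / 2)"
    then show "y \<in> ball 0 R"
      using z norm_triangle_ineq[of z "y - z"] by (simp add: dist_norm norm_minus_commute)
  qed
  have "cmod ((deriv ^^ 1) f z) \<le> fact 1 * M / (R / 2) ^ 1"
  proof (rule Cauchy_inequality[of f z "R / 2" M 1])
    show "f holomorphic_on ball z (R / 2)"
      using f by (rule holomorphic_on_subset) (use sub in auto)
    show "continuous_on (cball z (R / 2)) f"
      using holomorphic_on_imp_continuous_on[OF f] sub by (rule continuous_on_subset)
    show "cmod (f y) \<le> M" if "cmod (z - y) = R / 2" for y
      using M[of y] sub that by (auto simp: dist_norm)
  qed (use R in auto)
  then show "cmod (deriv f z) \<le> 2 * M / R" by (simp add: mult.commute)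
qed

lemma polydisc_lipschitz:
  fixes g :: "complex \<Rightarrow> complex \<Rightarrow> complex"
  assumes g: "(\<lambda>(x, y). g x y) cholomorphic_on (ball 0 R \<times> ball 0 R)"
    and M: "\<And>x y. cmod x < R \<Longrightarrow> cmod y < R \<Longrightarrow> cmod (g x y) \<le> M"
    and xy: "cmod x < R / 2" "cmod x' < R / 2" "cmod y < R / 2" "cmod y' < R / 2"
  shows "cmod (g x y - g x' y') \<le> 2 * M / R * (cmod (x - x') + cmod (y - y'))"
proof -
  have R: "0 < R" using xy(1) norm_ge_zero[of x] by linarith
  have "(\<lambda>x. (\<lambda>(x, y). g x y) (x, y)) holomorphic_on ball 0 R"
    using xy R by (intro holomorphic_on_cholomorphic_pair[OF g]) auto
  then have 1: "cmod (g x y - g x' y) \<le> 2 * M / R * cmod (x - x')"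
    using xy M R by (intro bounded_holomorphic_lipschitz) auto
  have "(\<lambda>y. (\<lambda>(x, y). g x y) (x', y)) holomorphic_on ball 0 R"
    using xy R by (intro holomorphic_on_cholomorphic_pair[OF g]) auto
  then have 2: "cmod (g x' y - g x' y') \<le> 2 * M / R * cmod (y - y')"
    using xy M R by (intro bounded_holomorphic_lipschitz) auto
  have "cmod (g x y - g x' y') \<le> cmod (g x y - g x' y) + cmod (g x' y - g x' y')"
    by (rule norm_diff_triangle_ineq')
  with 1 2 show ?thesis by (simp add: distrib_left)
qed

lemma eventually_nhds_zero_triple:
  assumes "\<forall>\<^sub>F t in nhds (0, 0, 0). P t"
  obtains R where "0 < R" "\<forall>e x y. cmod e < R \<longrightarrow> cmod x < R \<longrightarrow> cmod y < R \<longrightarrow> P (e, x, y :: complex)"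
proof -
  obtain s where s: "0 < s" "\<And>t. dist t (0, 0, 0) < s \<Longrightarrow> P t"
    using assms by (auto simp: eventually_nhds_metric)
  have "P (e, x, y)" if "cmod e < s / 3" "cmod x < s / 3" "cmod y < s / 3" for e x y
  proof (rule s(2))
    have "norm (e, x, y) \<le> cmod e + (cmod x + cmod y)"
      using norm_Pair_le[of e "(x, y)"] norm_Pair_le[of x y] by linarith
    then show "dist (e, x, y) (0, 0, 0) < s"
      using that by (simp add: dist_norm)
  qed
  then show ?thesis using that[of "s / 3"] s(1) by simp
qed

lemma eventually_near_centre:
  fixes f :: "complex \<times> complex \<times> complex \<Rightarrow> complex"
  assumes "isCont f (0, 0, 0)" "cmod (f (0, 0, 0)) < M"
  shows "\<forall>\<^sub>F t in nhds (0, 0, 0). cmod (f t) < M"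
proof -
  have "(f \<longlongrightarrow> f (0, 0, 0)) (nhds (0, 0, 0))"
    using assms(1) by (simp add: isCont_def tendsto_at_iff_tendsto_nhds)
  from order_tendstoD(2)[OF tendsto_norm[OF this] assms(2)] show ?thesis .
qed

theorem theorem3p9:
  fixes \<A> :: "('m::{metric_space, second_countable_topology}, complex \<times> complex) chart set"
    and F :: "complex \<Rightarrow> 'm \<Rightarrow> 'm"
    and pt :: 'm
    and U :: "'m set" and \<psi> :: "'m \<Rightarrow> complex \<times> complex"
    and \<rho> \<delta> :: real
    and a \<beta> :: "complex \<Rightarrow> complex \<Rightarrow> complex \<Rightarrow> complex"
    and b :: "complex \<Rightarrow> complex \<Rightarrow> complex"
    and b0 q r \<alpha> :: complex
    and \<epsilon> :: "nat \<Rightarrow> complex" and n :: "nat \<Rightarrow> nat"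
  assumes manifold: "complex_atlas \<A>"
    and radii: "\<rho> > 0" "\<delta> > 0"
    and family: "holomorphic_family_of_automorphisms \<A> (ball 0 \<rho>) F"
    and fixed_point: "F 0 pt = pt"
    and coordinates: "holomorphic_chart \<A> (U, \<psi>)" "pt \<in> U" "\<psi> pt = (0, 0)"
      "ball 0 \<delta> \<times> ball 0 \<delta> \<subseteq> \<psi> ` U"
    and holo_a: "(\<lambda>(e, x, y). a e x y) cholomorphic_on (ball 0 \<rho> \<times> ball 0 \<delta> \<times> ball 0 \<delta>)"
    and holo_\<beta>: "(\<lambda>(e, x, y). \<beta> e x y) cholomorphic_on (ball 0 \<rho> \<times> ball 0 \<delta> \<times> ball 0 \<delta>)"
    and holo_b: "(\<lambda>(e, x). b e x) cholomorphic_on (ball 0 \<rho> \<times> ball 0 \<delta>)"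
    and normal_form: "\<And>e p x y. e \<in> ball 0 \<rho> \<Longrightarrow> p \<in> U \<Longrightarrow> \<psi> p = (x, y) \<Longrightarrow>
        x \<in> ball 0 \<delta> \<Longrightarrow> y \<in> ball 0 \<delta> \<Longrightarrow>
        F e p \<in> U \<and>
        \<psi> (F e p) = (x + (x\<^sup>2 + e\<^sup>2) * a e x y, b e x * y + (x\<^sup>2 + e\<^sup>2) * \<beta> e x y)"
    and expansion_a: "(\<lambda>(e, x, y). cmod (a e x y - (1 + (q + 1) * x + r * y)))
        \<in> O[nhds (0, 0, 0)](\<lambda>(e, x, y). (cmod x)\<^sup>2 + (cmod y)\<^sup>2 + (cmod e)\<^sup>2)"
    and multiplier: "b 0 0 = b0" "0 < cmod b0" "cmod b0 < 1"
    and eps: "\<And>j. \<epsilon> j \<noteq> 0" "\<epsilon> \<longlonglongrightarrow> 0"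
    and n: "\<And>j. n j > 0" "filterlim n at_top sequentially"
    and phase: "(\<lambda>j. of_nat (n j) - complex_of_real pi / \<epsilon> j) \<longlonglongrightarrow> \<alpha>"
  shows "\<forall>K. compact K \<and> K \<subseteq> basin (F 0) pt \<longrightarrow>
    uniform_limit K (\<lambda>j. F (\<epsilon> j) ^^ n j) (T_map q \<psi> (F 0) pt \<alpha>) sequentially"
proof -
  have F0: "automorphism \<A> (F 0)"
    using family radii by (simp add: holomorphic_family_of_automorphisms_def)
  have F_cont: "continuous_on (ball 0 \<rho> \<times> UNIV) (\<lambda>(e, p). F e p)"
    using family by (simp add: holomorphic_family_of_automorphisms_def holomorphic_map_on_def)
  have chart: "open U" "open (\<psi> ` U)" "homeomorphism U (\<psi> ` U) \<psi> (inv_into U \<psi>)"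
    using coordinates(1) by (auto simp: holomorphic_chart_def is_chart_def)
  have centre: "(0, 0, 0) \<in> ball (0::complex) \<rho> \<times> ball (0::complex) \<delta> \<times> ball (0::complex) \<delta>"
    using radii by simp
  from landau_o.bigE[OF expansion_a]
  obtain c where c: "0 < c" "\<forall>\<^sub>F t in nhds (0, 0, 0). norm ((\<lambda>(e, x, y). cmod (a e x y - (1 + (q + 1) * x + r * y))) t)
      \<le> c * norm ((\<lambda>(e, x, y). (cmod x)\<^sup>2 + (cmod y)\<^sup>2 + (cmod e)\<^sup>2) t)"
    by blast
  define Ma where "Ma = cmod (a 0 0 0) + 1"
  define Mb where "Mb = cmod (\<beta> 0 0 0) + 1"
  \<comment> \<open>Halfway between |b0| and 1: continuity keeps |b e x| below it near the origin,
    and it is still a contraction factor.\<close>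
  define lam where "lam = (1 + cmod b0) / 2"
  have lam: "0 \<le> lam" "lam < 1" "cmod b0 < lam" using multiplier(3) norm_ge_zero[of b0] by (auto simp: lam_def)
  have eva: "\<forall>\<^sub>F t in nhds (0, 0, 0). cmod ((\<lambda>(e, x, y). a e x y) t) < Ma"
    by (rule eventually_near_centre[OF cholomorphic_on_isCont[OF holo_a centre]]) (simp add: Ma_def)
  have evb: "\<forall>\<^sub>F t in nhds (0, 0, 0). cmod ((\<lambda>(e, x, y). \<beta> e x y) t) < Mb"
    by (rule eventually_near_centre[OF cholomorphic_on_isCont[OF holo_\<beta> centre]]) (simp add: Mb_def)
  have evl: "\<forall>\<^sub>F t in nhds (0, 0, 0). cmod ((\<lambda>(e, x, y::complex). b e x) t) < lam"
  proof -
    have "isCont (\<lambda>(e, x). b e x) (0, 0)"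
      using radii by (intro cholomorphic_on_isCont[OF holo_b]) simp
    moreover have "isCont (\<lambda>t::complex \<times> complex \<times> complex. (fst t, fst (snd t))) (0, 0, 0)"
      by (intro continuous_intros)
    ultimately have "isCont (\<lambda>t. (\<lambda>(e, x). b e x) (fst t, fst (snd t))) ((0, 0, 0) :: complex \<times> complex \<times> complex)"
      using isCont_o2[of "(0, 0, 0)" "\<lambda>t. (fst t, fst (snd t))" "\<lambda>(e, x). b e x"] by simp
    then have "isCont (\<lambda>(e, x, y::complex). b e x) ((0, 0, 0) :: complex \<times> complex \<times> complex)"
      by (simp add: case_prod_unfold)
    then show ?thesis by (rule eventually_near_centre) (simp add: multiplier(1) lam(3))
  qed
  define P where "P = (\<lambda>(e, x, y). cmod (a e x y - (1 + (q + 1) * x + r * y)) \<le> c * ((cmod x)\<^sup>2 + (cmod y)\<^sup>2 + (cmod e)\<^sup>2)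
      \<and> cmod (a e x y) < Ma \<and> cmod (\<beta> e x y) < Mb \<and> cmod (b e x) < lam)"
  have "\<forall>\<^sub>F t in nhds (0, 0, 0). P t"
    using c(2) eva evb evl
  proof eventually_elim
    case (elim t)
    then show ?case by (cases t) (simp add: P_def)
  qed
  then obtain R\<^sub>0 where R0: "0 < R\<^sub>0" "\<forall>e x y. cmod e < R\<^sub>0 \<longrightarrow> cmod x < R\<^sub>0 \<longrightarrow> cmod y < R\<^sub>0 \<longrightarrow> P (e, x, y)"
    by (rule eventually_nhds_zero_triple)
  define R where "R = min R\<^sub>0 (min \<rho> \<delta>)"
  have R: "0 < R" "R \<le> R\<^sub>0" "R \<le> \<rho>" "R \<le> \<delta>" using R0(1) radii by (auto simp: R_def)
  have bounds: "cmod (a e x y - (1 + (q + 1) * x + r * y)) \<le> c * ((cmod x)\<^sup>2 + (cmod y)\<^sup>2 + (cmod e)\<^sup>2)"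
      "cmod (a e x y) \<le> Ma" "cmod (\<beta> e x y) \<le> Mb" "cmod (b e x) \<le> lam"
    if "cmod e < R" "cmod x < R" "cmod y < R" for e x y
    using R0(2)[rule_format, of e x y] that R(2) by (auto simp: P_def)
  \<comment> \<open>The quotients by \<open>R\<close> are the Lipschitz constants that Cauchy's
    inequality gives on the half polydisc.\<close>
  define C where "C = Max {1, cmod q, cmod (q + 1), cmod r, c, Mb, 2 * Ma / R, 2 * Mb / R, 2 * lam / R}"
  have C: "1 \<le> C" "cmod q \<le> C" "cmod (q + 1) \<le> C" "cmod r \<le> C" "c \<le> C" "Mb \<le> C"
      "2 * Ma / R \<le> C" "2 * Mb / R \<le> C" "2 * lam / R \<le> C"
    unfolding C_def by (rule Max_ge; simp)+
  \<comment> \<open>R / 2 because the Lipschitz bounds hold on the half polydisc; 1 / (100 C) gives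
    \<open>C * d \<le> 1 / 100\<close>.\<close>
  define d where "d = min (R / 2) (1 / (100 * C))"
  have d: "0 < d" "d \<le> R / 2" "C * d \<le> 1 / 100"
  proof -
    show "0 < d" "d \<le> R / 2" using R C(1) by (auto simp: d_def)
    have "C * d \<le> C * (1 / (100 * C))" using C(1) by (intro mult_left_mono) (auto simp: d_def)
    then show "C * d \<le> 1 / 100" using C(1) by simp
  qed
  have dR: "d < R" "d \<le> \<rho>" "d \<le> \<delta>" using d R by auto
  have slice: "(\<lambda>(x, y). g 0 x y) cholomorphic_on (ball 0 R' \<times> ball 0 R')"
    if g: "(\<lambda>(e, x, y). g e x y) cholomorphic_on (ball 0 \<rho> \<times> ball 0 \<delta> \<times> ball 0 \<delta>)" and "R' \<le> \<delta>"
    for g :: "complex \<Rightarrow> complex \<Rightarrow> complex \<Rightarrow> complex" and R'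
  proof -
    have "(\<lambda>w. (\<lambda>(e, x, y). g e x y) (0, w)) cholomorphic_on (ball 0 \<delta> \<times> ball 0 \<delta>)"
      using radii by (intro cholomorphic_slice[OF g]) simp
    then show ?thesis using \<open>R' \<le> \<delta>\<close> by (auto simp: cholomorphic_on_def)
  qed
  have b_slice: "(\<lambda>z. b 0 (u z)) holomorphic_on S"
    if "open S" "u holomorphic_on S" "\<And>z. z \<in> S \<Longrightarrow> cmod (u z) < \<delta>" for S u
  proof -
    have "(\<lambda>z. (\<lambda>(e, x). b e x) (0, u z)) holomorphic_on S"
      using that radii by (intro holomorphic_on_cholomorphic_pair[OF holo_b]) auto
    then show ?thesis by simp
  qed
  interpret semiparabolic_lipschitz d C lam q r a \<beta> b
  proof
    show "0 < d" "C * d \<le> 1 / 100" "1 \<le> C" "cmod q \<le> C" "cmod (q + 1) \<le> C" "cmod r \<le> C" "0 \<le> lam" "lam < 1"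
      using d C lam by auto
  next
    fix e x y assume "cmod e < d" "cmod x < d" "cmod y < d"
    then have s: "cmod e < R" "cmod x < R" "cmod y < R" using dR by auto
    have "c * ((cmod x)\<^sup>2 + (cmod y)\<^sup>2 + (cmod e)\<^sup>2) \<le> C * ((cmod x)\<^sup>2 + (cmod y)\<^sup>2 + (cmod e)\<^sup>2)"
      using C by (intro mult_right_mono) auto
    then show "cmod (a e x y - (1 + (q + 1) * x + r * y)) \<le> C * ((cmod x)\<^sup>2 + (cmod y)\<^sup>2 + (cmod e)\<^sup>2)"
      using bounds(1)[OF s] by linarith
    show "cmod (\<beta> e x y) \<le> C" using bounds(3)[OF s] C by linarith
  next
    fix e x assume "cmod e < d" "cmod x < d"
    then show "cmod (b e x) \<le> lam" using bounds(4)[of e x 0] dR R by auto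
  next
    fix x x' y y' assume "cmod x < d" "cmod x' < d" "cmod y < d" "cmod y' < d"
    then have s: "cmod x < R / 2" "cmod x' < R / 2" "cmod y < R / 2" "cmod y' < R / 2" using d by auto
    have "cmod (a 0 x y - a 0 x' y') \<le> 2 * Ma / R * (cmod (x - x') + cmod (y - y'))"
      using bounds(2)[of 0] R by (intro polydisc_lipschitz[OF slice[OF holo_a R(4)] _ s]) auto
    also have "\<dots> \<le> C * (cmod (x - x') + cmod (y - y'))" by (intro mult_right_mono C add_nonneg_nonneg norm_ge_zero)
    finally show "cmod (a 0 x y - a 0 x' y') \<le> C * (cmod (x - x') + cmod (y - y'))" .
    have "cmod (\<beta> 0 x y - \<beta> 0 x' y') \<le> 2 * Mb / R * (cmod (x - x') + cmod (y - y'))"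
      using bounds(3)[of 0] R by (intro polydisc_lipschitz[OF slice[OF holo_\<beta> R(4)] _ s]) auto
    also have "\<dots> \<le> C * (cmod (x - x') + cmod (y - y'))" by (intro mult_right_mono C add_nonneg_nonneg norm_ge_zero)
    finally show "cmod (\<beta> 0 x y - \<beta> 0 x' y') \<le> C * (cmod (x - x') + cmod (y - y'))" .
  next
    fix x x' assume "cmod x < d" "cmod x' < d"
    then have s: "x \<in> ball 0 (R / 2)" "x' \<in> ball 0 (R / 2)" using d by auto
    have "(\<lambda>x. b 0 x) holomorphic_on ball 0 R" using R by (intro b_slice) auto
    then have "cmod (b 0 x - b 0 x') \<le> 2 * lam / R * cmod (x - x')"
      using bounds(4)[of 0 _ 0] R by (intro bounded_holomorphic_lipschitz[OF _ _ s]) auto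
    also have "\<dots> \<le> C * cmod (x - x')" by (intro mult_right_mono C add_nonneg_nonneg norm_ge_zero)
    finally show "cmod (b 0 x - b 0 x') \<le> C * cmod (x - x')" .
  qed
  interpret semiparabolic_germ d C lam q r a \<beta> b F pt U \<psi>
  proof
    show "continuous_on (ball 0 d \<times> UNIV) (\<lambda>(e, p). F e p)"
      using F_cont by (rule continuous_on_subset) (use dR in auto)
    show "bij (F 0)" "continuous_on UNIV (inv (F 0))"
      using F0 by (auto simp: automorphism_def holomorphic_map_on_def)
    show "F 0 pt = pt" "open U" "open (\<psi> ` U)" "homeomorphism U (\<psi> ` U) \<psi> (inv_into U \<psi>)" "pt \<in> U" "\<psi> pt = (0, 0)"
      by fact+
    have "ball (0::complex) d \<times> ball (0::complex) d \<subseteq> ball 0 \<delta> \<times> ball 0 \<delta>" using dR by auto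
    then show "ball 0 d \<times> ball 0 d \<subseteq> \<psi> ` U" using coordinates(4) by blast
  next
    fix e p assume "cmod e < d" "p \<in> U" "cmod (fst (\<psi> p)) < d" "cmod (snd (\<psi> p)) < d"
    then show "F e p \<in> U \<and> \<psi> (F e p) = step e (\<psi> p)"
      using normal_form[of e p "fst (\<psi> p)" "snd (\<psi> p)"] dR
      by (auto simp: step_def case_prod_unfold)
  next
    fix S u v assume S: "open S" "u holomorphic_on S" "v holomorphic_on S"
      and uv: "\<And>z. z \<in> S \<Longrightarrow> cmod (u z) < d \<and> cmod (v z) < d"
    have "(\<lambda>z. (\<lambda>(x, y). a 0 x y) (u z, v z)) holomorphic_on S"
      using uv by (intro holomorphic_on_cholomorphic_pair[OF slice[OF holo_a dR(3)] S]) auto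
    moreover have "(\<lambda>z. (\<lambda>(x, y). \<beta> 0 x y) (u z, v z)) holomorphic_on S"
      using uv by (intro holomorphic_on_cholomorphic_pair[OF slice[OF holo_\<beta> dR(3)] S]) auto
    moreover have "(\<lambda>z. b 0 (u z)) holomorphic_on S"
      using S uv dR by (intro b_slice) (auto intro: less_le_trans)
    ultimately show "(\<lambda>z. a 0 (u z) (v z)) holomorphic_on S \<and> (\<lambda>z. snd (step 0 (u z, v z))) holomorphic_on S"
      using S by (auto simp: step_def intro!: holomorphic_intros)
  qed
  show ?thesis
  proof (intro allI impI)
    fix K assume K: "compact K \<and> K \<subseteq> basin (F 0) pt"
    show "uniform_limit K (\<lambda>j. F (\<epsilon> j) ^^ n j) (T_map q \<psi> (F 0) pt \<alpha>) sequentially"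
    proof (rule uniform_limit_from_subsequences)
      show "compact K" using K by simp
      fix s :: "nat \<Rightarrow> nat" and x x0
      assume s: "strict_mono s" and x: "\<And>j. x j \<in> K" "x0 \<in> K" "x \<longlonglongrightarrow> x0"
      \<comment> \<open>Parameters, times and phases along \<open>s\<close> satisfy the original
        hypotheses, so the result for moving initial points applies to them.\<close>
      have "filterlim (\<lambda>j. n (s j)) at_top sequentially"
        using n(2) filterlim_subseq[OF s] by (rule filterlim_compose)
      then show "\<exists>t. strict_mono t \<and>
          (\<lambda>j. (F (\<epsilon> (s (t j))) ^^ n (s (t j))) (x (t j))) \<longlonglongrightarrow> T_map q \<psi> (F 0) pt \<alpha> x0"
        using eps(1) LIMSEQ_subseq_LIMSEQ[OF eps(2) s] LIMSEQ_subseq_LIMSEQ[OF phase s] x K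
        by (intro perturbed_orbit_subsequence[of "\<lambda>j. \<epsilon> (s j)" "\<lambda>j. n (s j)" \<alpha> x x0]) (auto simp: o_def)
    qed
  qed
qed

end
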